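(* Let $d,h,k\ge 2$ and $N=(d^h-1)/(d-1)$ (the number of nodes of $T^h_d$). Any $Nk$-way branching program $\hat B$ solving $\hat FT^h_d(Nk)$ (resp. $\hat BT^h_d(Nk)$) can be transformed into a $k$-way branching program $B$ solving $FT^h_d(k)$ (resp. $BT^h_d(k)$) such that $B$ has no more states than $\hat B$, and $B$ is deterministic iff $\hat B$ is deterministic. Moreover, for each $d\ge 2$, the decision problem $BT_d(h,k)$ is logspace reducible to $\hat BT_d(h,k)$ (where $h,k$ are input parameters).
   Context: $T^h_d$ is the balanced rooted $d$-ary tree with $h$ levels. An instance with parameter $k$ of $FT^h_d(k)$/$BT^h_d(k)$ assigns to each internal node $i$ a function $f_i:[k]^d\to[k]$ (given by its $k^d$ values) and to each leaf an element of $[k]=\{1,\dots,k\}$; $v_i$ is the leaf label for a leaf and $v_i=f_i(v_{j_1},\dots,v_{j_d})$ for an internal node with children $j_1,\dots,j_d$; $FT^h_d(k)$ outputs the root value and $BT^h_d(k)$ decides whether it equals $1$; the $k$-ary input variables are $f_i(x)$ and one per leaf. The restricted problems $\hat FT^h_d(k)$ and $\hat BT^h_d(k)$ are the same except that all internal nodes carry the same function $\hat f:[k]^d\to[k]$; an instance is given by one table for $\hat f$ (its $k^d$ values as variables) together with the leaf values. $BT_d(h,k)$ and $\hat BT_d(h,k)$ denote the corresponding languages with $h,k$ part of the binary-encoded input. A nondeterministic $k$-way branching program computing $g:[k]^m\to R$ is a directed rooted multigraph of states, edges labelled by elements of $[k]$, nonfinal states labelled by variable indices, $|R|$ final sink states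 labelled by elements of $R$; on input $x$, edges labelled $x_j$ out of states labelled $j$ are activated; each computation (path of activated edges from the root) is infinite, ends in the final state labelled $g(x)$, or aborts, and at least one ends in a final state. Deterministic: every nonfinal state has exactly $k$ outedges labelled $1,\dots,k$. *)

theory Defs
  imports Complex_Main "HOL-Library.FuncSet" "Graph_Theory.Digraph" "Graph_Theory.Arc_Walk"
begin

section \<open>Branching programs\<close>

datatype ('v, 'r) state_label = Query 'v | Final 'r

text \<open>
  The underlying directed multigraph is a \<^typ>\<open>('s, 'e) pre_digraph\<close> (its vertices are the
  states). Input variables are indexed by an arbitrary type \<open>'v\<close> in place of \<open>{1..m}\<close>;
  \<open>'r\<close> is the type of output values.
\<close>

record ('s, 'e, 'v, 'r) branching_program =
  state_graph :: "('s, 'e) pre_digraph"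
  start :: 's
  edge_label :: "'e \<Rightarrow> nat"
  state_label :: "'s \<Rightarrow> ('v, 'r) state_label"

abbreviation states :: "('s, 'e, 'v, 'r) branching_program \<Rightarrow> 's set" where
  "states B \<equiv> verts (state_graph B)"

definition wf_bp ::
  "nat \<Rightarrow> 'v set \<Rightarrow> 'r set \<Rightarrow> ('s, 'e, 'v, 'r) branching_program \<Rightarrow> bool" where
  "wf_bp k V R B \<longleftrightarrow>
     fin_digraph (state_graph B) \<and>
     start B \<in> states B \<and>
     (\<forall>e \<in> arcs (state_graph B). edge_label B e \<in> {1..k}) \<and>
     (\<forall>s \<in> states B. \<forall>v. state_label B s = Query v \<longrightarrow> v \<in> V) \<and>
     (\<forall>s \<in> states B. \<forall>r. state_label B s = Final r \<longrightarrow>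
        r \<in> R \<and> out_arcs (state_graph B) s = {}) \<and>
     (\<forall>r \<in> R. \<exists>!s. s \<in> states B \<and> state_label B s = Final r)"

definition activated :: "('s, 'e, 'v, 'r) branching_program \<Rightarrow> ('v \<Rightarrow> nat) \<Rightarrow> 'e \<Rightarrow> bool" where
  "activated B x e \<longleftrightarrow>
     (\<exists>v. state_label B (tail (state_graph B) e) = Query v \<and> edge_label B e = x v)"

definition finite_computation ::
  "('s, 'e, 'v, 'r) branching_program \<Rightarrow> ('v \<Rightarrow> nat) \<Rightarrow> 'e list \<Rightarrow> 's \<Rightarrow> bool" where
  "finite_computation B x p s \<longleftrightarrow>
     pre_digraph.awalk (state_graph B) (start B) p s \<and> (\<forall>e \<in> set p. activated B x e)"

text \<open>
  An activated path that can be continued forever is an infinite computation, and one that gets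
  stuck in a nonfinal state aborts; both are allowed. Hence the only requirement on the
  individual computations is that those reaching a final state reach the correct one.
\<close>

definition computes ::
  "nat \<Rightarrow> 'v set \<Rightarrow> 'r set \<Rightarrow> (('v \<Rightarrow> nat) \<Rightarrow> 'r) \<Rightarrow> ('s, 'e, 'v, 'r) branching_program \<Rightarrow> bool" where
  "computes k V R g B \<longleftrightarrow>
     wf_bp k V R B \<and>
     (\<forall>x \<in> V \<rightarrow>\<^sub>E {1..k}.
        (\<forall>p s r. finite_computation B x p s \<and> state_label B s = Final r \<longrightarrow> r = g x) \<and>
        (\<exists>p s r. finite_computation B x p s \<and> state_label B s = Final r))"

definition deterministic :: "nat \<Rightarrow> ('s, 'e, 'v, 'r) branching_program \<Rightarrow> bool" where
  "deterministic k B \<longleftrightarrow>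
     (\<forall>s \<in> states B. \<forall>v. state_label B s = Query v \<longrightarrow>
        bij_betw (edge_label B) (out_arcs (state_graph B) s) {1..k})"


section \<open>Tree evaluation\<close>

text \<open>
  The nodes of the balanced \<open>d\<close>-ary tree with \<open>h\<close> levels are numbered \<open>1, 2, \<dots>\<close> level by level
  from left to right (heap order): the root is \<open>1\<close>, and for \<open>d = 2\<close> the children of \<open>i\<close> are
  \<open>2 * i\<close> and \<open>2 * i + 1\<close>. The internal nodes are those on the first \<open>h - 1\<close> levels.
\<close>

definition num_nodes :: "nat \<Rightarrow> nat \<Rightarrow> nat" where
  "num_nodes d h = (\<Sum>l<h. d ^ l)"

definition internal_nodes :: "nat \<Rightarrow> nat \<Rightarrow> nat set" where
  "internal_nodes d h = {1..num_nodes d (h - 1)}"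

definition leaves :: "nat \<Rightarrow> nat \<Rightarrow> nat set" where
  "leaves d h = {num_nodes d (h - 1) + 1..num_nodes d h}"

definition children :: "nat \<Rightarrow> nat \<Rightarrow> nat list" where
  "children d i = map (\<lambda>j. d * (i - 1) + j + 1) [1..<Suc d]"

lemma children_greater: "c \<in> set (children d i) \<Longrightarrow> i < c"
proof -
  assume "c \<in> set (children d i)"
  then obtain j where j: "1 \<le> j" "j \<le> d" and c: "c = d * (i - 1) + j + 1"
    unfolding children_def by auto
  have "1 * (i - 1) \<le> d * (i - 1)"
    using j by (intro mult_right_mono) auto
  then show "i < c"
    using j c by linarith
qed

function node_value ::
  "nat \<Rightarrow> nat \<Rightarrow> (nat \<Rightarrow> nat list \<Rightarrow> nat) \<Rightarrow> (nat \<Rightarrow> nat) \<Rightarrow> nat \<Rightarrow> nat" where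
  "node_value d h f l i =
     (if i \<in> internal_nodes d h then f i (map (node_value d h f l) (children d i)) else l i)"
  by auto
termination
  by (relation "measure (\<lambda>(d, h, f, l, i). Suc (num_nodes d (h - 1)) - i)")
     (auto simp: internal_nodes_def dest!: children_greater)

declare node_value.simps [simp del]

text \<open>
  An instance is the assignment of its input variables: \<open>Fn i xs\<close> stands for \<open>f\<^sub>i(xs)\<close>, and
  \<open>Leaf i\<close> for the label of the leaf \<open>i\<close>.
\<close>

datatype ft_var = Fn nat "nat list" | Leaf nat

definition FT_vars :: "nat \<Rightarrow> nat \<Rightarrow> nat \<Rightarrow> ft_var set" where
  "FT_vars d h k =
     {Fn i xs | i xs. i \<in> internal_nodes d h \<and> length xs = d \<and> set xs \<subseteq> {1..k}} \<union> Leaf ` leaves d h"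

definition FT :: "nat \<Rightarrow> nat \<Rightarrow> (ft_var \<Rightarrow> nat) \<Rightarrow> nat" where
  "FT d h x = node_value d h (\<lambda>i xs. x (Fn i xs)) (\<lambda>i. x (Leaf i)) 1"

definition BT :: "nat \<Rightarrow> nat \<Rightarrow> (ft_var \<Rightarrow> nat) \<Rightarrow> bool" where
  "BT d h x \<longleftrightarrow> FT d h x = 1"

datatype hat_var = HatFn "nat list" | HatLeaf nat

definition hatFT_vars :: "nat \<Rightarrow> nat \<Rightarrow> nat \<Rightarrow> hat_var set" where
  "hatFT_vars d h k =
     {HatFn xs | xs. length xs = d \<and> set xs \<subseteq> {1..k}} \<union> HatLeaf ` leaves d h"

definition hatFT :: "nat \<Rightarrow> nat \<Rightarrow> (hat_var \<Rightarrow> nat) \<Rightarrow> nat" where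
  "hatFT d h x = node_value d h (\<lambda>_ xs. x (HatFn xs)) (\<lambda>i. x (HatLeaf i)) 1"

definition hatBT :: "nat \<Rightarrow> nat \<Rightarrow> (hat_var \<Rightarrow> nat) \<Rightarrow> bool" where
  "hatBT d h x \<longleftrightarrow> hatFT d h x = 1"

definition solves_FT ::
  "nat \<Rightarrow> nat \<Rightarrow> nat \<Rightarrow> ('s, 'e, ft_var, nat) branching_program \<Rightarrow> bool" where
  "solves_FT d h k = computes k (FT_vars d h k) {1..k} (FT d h)"

definition solves_BT ::
  "nat \<Rightarrow> nat \<Rightarrow> nat \<Rightarrow> ('s, 'e, ft_var, bool) branching_program \<Rightarrow> bool" where
  "solves_BT d h k = computes k (FT_vars d h k) UNIV (BT d h)"

definition solves_hatFT ::
  "nat \<Rightarrow> nat \<Rightarrow> nat \<Rightarrow> ('s, 'e, hat_var, nat) branching_program \<Rightarrow> bool" where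
  "solves_hatFT d h k = computes k (hatFT_vars d h k) {1..k} (hatFT d h)"

definition solves_hatBT ::
  "nat \<Rightarrow> nat \<Rightarrow> nat \<Rightarrow> ('s, 'e, hat_var, bool) branching_program \<Rightarrow> bool" where
  "solves_hatBT d h k = computes k (hatFT_vars d h k) UNIV (hatBT d h)"


section \<open>The languages\<close>

text \<open>
  Numbers are written in binary, least significant digit first. To make the code
  self-delimiting, every digit is preceded by \<open>True\<close> and the number is closed by \<open>False\<close>.
\<close>

fun binary_digits :: "nat \<Rightarrow> bool list" where
  "binary_digits n = (if n = 0 then [] else odd n # binary_digits (n div 2))"

declare binary_digits.simps [simp del]

definition encode_nat :: "nat \<Rightarrow> bool list" where
  "encode_nat n = concat (map (\<lambda>b. [True, b]) (binary_digits n)) @ [False]"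

definition encode_nats :: "nat list \<Rightarrow> bool list" where
  "encode_nats ns = concat (map encode_nat ns)"

text \<open>All \<open>d\<close>-tuples over \<open>{1..k}\<close> in lexicographic order:\<close>

definition tuples :: "nat \<Rightarrow> nat \<Rightarrow> nat list list" where
  "tuples d k = product_lists (replicate d [1..<Suc k])"

definition encode_FT :: "nat \<Rightarrow> nat \<Rightarrow> nat \<Rightarrow> (ft_var \<Rightarrow> nat) \<Rightarrow> bool list" where
  "encode_FT d h k x = encode_nats
     ([h, k] @
      concat (map (\<lambda>i. map (\<lambda>xs. x (Fn i xs)) (tuples d k)) (sorted_list_of_set (internal_nodes d h))) @
      map (\<lambda>i. x (Leaf i)) (sorted_list_of_set (leaves d h)))"

definition encode_hatFT :: "nat \<Rightarrow> nat \<Rightarrow> nat \<Rightarrow> (hat_var \<Rightarrow> nat) \<Rightarrow> bool list" where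
  "encode_hatFT d h k x = encode_nats
     ([h, k] @
      map (\<lambda>xs. x (HatFn xs)) (tuples d k) @
      map (\<lambda>i. x (HatLeaf i)) (sorted_list_of_set (leaves d h)))"

definition BT_language :: "nat \<Rightarrow> bool list set" where
  "BT_language d =
     {encode_FT d h k x | h k x. 2 \<le> h \<and> 2 \<le> k \<and> x \<in> FT_vars d h k \<rightarrow>\<^sub>E {1..k} \<and> BT d h x}"

definition hatBT_language :: "nat \<Rightarrow> bool list set" where
  "hatBT_language d =
     {encode_hatFT d h k x | h k x. 2 \<le> h \<and> 2 \<le> k \<and> x \<in> hatFT_vars d h k \<rightarrow>\<^sub>E {1..k} \<and> hatBT d h x}"


section \<open>Logspace reductions\<close>

text \<open>
  Deterministic Turing machines with a read-only input tape (with end markers, which the head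
  cannot pass), finitely many one-way infinite work tapes (cell contents \<open>< tm_symbols M\<close>, with
  \<open>0\<close> the blank), and a write-only output tape to which each step appends at most one bit. The
  control states are \<open>{..<tm_states M}\<close>.
\<close>

datatype input_symbol = LeftEnd | Bit bool | RightEnd

datatype head_move = MoveLeft | Stay | MoveRight

record turing_machine =
  tm_tapes :: nat
  tm_states :: nat
  tm_symbols :: nat
  tm_start :: nat
  tm_halt :: nat
  tm_delta :: "nat \<Rightarrow> input_symbol \<Rightarrow> nat list \<Rightarrow>
    nat \<times> head_move \<times> (nat \<times> head_move) list \<times> bool option"

definition wf_tm :: "turing_machine \<Rightarrow> bool" where
  "wf_tm M \<longleftrightarrow>
     tm_start M < tm_states M \<and> tm_halt M < tm_states M \<and> 0 < tm_symbols M \<and>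
     (\<forall>q a ss q' m acts out.
        q < tm_states M \<and> length ss = tm_tapes M \<and> set ss \<subseteq> {..<tm_symbols M} \<and>
        tm_delta M q a ss = (q', m, acts, out) \<longrightarrow>
        q' < tm_states M \<and> length acts = tm_tapes M \<and> fst ` set acts \<subseteq> {..<tm_symbols M})"

record tm_config =
  cf_state :: nat
  cf_input_pos :: nat
  cf_work :: "((nat \<Rightarrow> nat) \<times> nat) list"  \<comment> \<open>contents and head position of each work tape\<close>
  cf_output :: "bool list"

definition tm_init :: "turing_machine \<Rightarrow> tm_config" where
  "tm_init M = \<lparr>cf_state = tm_start M, cf_input_pos = 0,
     cf_work = replicate (tm_tapes M) (\<lambda>_. 0, 0), cf_output = []\<rparr>"

definition input_symbol_at :: "bool list \<Rightarrow> nat \<Rightarrow> input_symbol" where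
  "input_symbol_at w p =
     (if p = 0 then LeftEnd else if p \<le> length w then Bit (w ! (p - 1)) else RightEnd)"

fun move_head :: "head_move \<Rightarrow> nat \<Rightarrow> nat" where
  "move_head MoveLeft p = p - 1"
| "move_head Stay p = p"
| "move_head MoveRight p = p + 1"

definition tm_step :: "turing_machine \<Rightarrow> bool list \<Rightarrow> tm_config \<Rightarrow> tm_config" where
  "tm_step M w c =
     (if cf_state c = tm_halt M then c
      else case tm_delta M (cf_state c) (input_symbol_at w (cf_input_pos c))
                  (map (\<lambda>(t, p). t p) (cf_work c)) of
        (q, m, acts, out) \<Rightarrow>
          \<lparr>cf_state = q,
           cf_input_pos = min (length w + 1) (move_head m (cf_input_pos c)),
           cf_work = map2 (\<lambda>(t, p) (b, m'). (t(p := b), move_head m' p)) (cf_work c) acts,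
           cf_output = cf_output c @ (case out of None \<Rightarrow> [] | Some b \<Rightarrow> [b])\<rparr>)"

definition tm_run :: "turing_machine \<Rightarrow> bool list \<Rightarrow> nat \<Rightarrow> tm_config" where
  "tm_run M w t = (tm_step M w ^^ t) (tm_init M)"

definition logspace_computable :: "(bool list \<Rightarrow> bool list) \<Rightarrow> bool" where
  "logspace_computable F \<longleftrightarrow>
     (\<exists>M. wf_tm M \<and>
        (\<forall>w. \<exists>t. cf_state (tm_run M w t) = tm_halt M \<and> cf_output (tm_run M w t) = F w) \<and>
        (\<exists>c::real. \<forall>w t. \<forall>(_, p) \<in> set (cf_work (tm_run M w t)).
           real p \<le> c * log 2 (real (length w) + 2)))"

definition logspace_reducible :: "bool list set \<Rightarrow> bool list set \<Rightarrow> bool" where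
  "logspace_reducible A B \<longleftrightarrow> (\<exists>F. logspace_computable F \<and> (\<forall>w. w \<in> A \<longleftrightarrow> F w \<in> B))"

end

theory Submission
  imports Defs
begin

text \<open>
  A pair of a node \<open>i\<close> and a value \<open>v\<close> is coded by the number \<open>(i - 1) * k + v\<close>. A single function
  can then simulate all \<open>f\<^sub>i\<close>, since it recognises the node from the codes of its children. Every
  variable of the hat problem becomes a function of a single variable of the original problem, so a
  branching program is translated state by state.

  For the reduction, programs over finitely many registers with values polynomial in the input
  length are run in logarithmic space, one work tape per register. Expressions built from bounded
  sums and capped iteration describe all numbers that occur: the numbers in the input, the number
  of nodes, and the entries of the table of the simulating function.
\<close>

section \<open>Substituting variables in branching programs\<close>

text \<open>The delicate point of the first claim is the equivalence on determinism. Substitution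
  drops every edge whose label is not a value of the substituted function, so a nondeterministic
  program might become deterministic by accident; the parallel copies of edges exclude this. They
  have an effect because the root queries a variable: a final root would make the output constant.

  In the reduction, the binary numbers in the input may be exponential in its length, so they cannot
  be read exactly from an arbitrary word. Every number read, and every number of nodes, is capped at
  the input length plus one. A genuine instance lists all leaves and at least \<open>k\<close> table
  entries, so its parameters lie below the cap; a word that is no instance is detected and mapped to
  the empty word.

  The space bound rests on the choice of the base: registers have as many digits as the binary
  numeral of the input length plus two, and with base \<open>2 ^ C\<close> such a register holds any
  value up to the \<open>C\<close>-th power of that length. The degree of the polynomial thus enters
  the tape alphabet and not the length of the tapes.\<close>

inductive reach ::
  "('s, 'e, 'v, 'r) branching_program \<Rightarrow> ('v \<Rightarrow> nat) \<Rightarrow> 's \<Rightarrow> bool"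
  for B x where
  reach_start: "reach B x (start B)"
| reach_step: "reach B x (tail (state_graph B) e) \<Longrightarrow> e \<in> arcs (state_graph B) \<Longrightarrow>
    activated B x e \<Longrightarrow> reach B x (head (state_graph B) e)"

lemma cas_snoc:
  "pre_digraph.cas G u (p @ [e]) v \<longleftrightarrow> pre_digraph.cas G u p (tail G e) \<and> head G e = v"
  by (induction p arbitrary: u) (auto simp: pre_digraph.cas.simps)

lemma finite_computation_iff_reach:
  assumes "wf_bp k V R B"
  shows "(\<exists>p. finite_computation B x p s) \<longleftrightarrow> reach B x s"
proof
  assume "\<exists>p. finite_computation B x p s"
  then obtain p where "finite_computation B x p s" ..
  then show "reach B x s"
  proof (induction p arbitrary: s rule: rev_induct)
    case Nil
    then show ?case
      by (auto simp: finite_computation_def pre_digraph.awalk_def pre_digraph.cas.simps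
          intro: reach_start)
  next
    case (snoc e p)
    then have "finite_computation B x p (tail (state_graph B) e)"
      by (auto simp: finite_computation_def pre_digraph.awalk_def cas_snoc)
    from reach_step[OF snoc.IH[OF this], of] snoc.prems show ?case
      by (auto simp: finite_computation_def pre_digraph.awalk_def cas_snoc)
  qed
next
  have start: "start B \<in> states B"
    using assms by (simp add: wf_bp_def)
  assume "reach B x s"
  then show "\<exists>p. finite_computation B x p s"
  proof induction
    case reach_start
    have "finite_computation B x [] (start B)"
      using start by (simp add: finite_computation_def pre_digraph.awalk_def pre_digraph.cas.simps)
    then show ?case ..
  next
    case (reach_step e)
    then obtain p where "finite_computation B x p (tail (state_graph B) e)" by blast
    with reach_step have "finite_computation B x (p @ [e]) (head (state_graph B) e)"
      by (auto simp: finite_computation_def pre_digraph.awalk_def cas_snoc)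
    then show ?case ..
  qed
qed

text \<open>Correctness mentions only the end states of computations, so the walks can be forgotten
  here. Simulations between programs then become inductions on \<open>reach\<close>.\<close>

lemma computes_iff_reach:
  "computes k V R g B \<longleftrightarrow> wf_bp k V R B \<and>
     (\<forall>x \<in> V \<rightarrow>\<^sub>E {1..k}.
        (\<forall>s r. reach B x s \<and> state_label B s = Final r \<longrightarrow> r = g x) \<and>
        (\<exists>s r. reach B x s \<and> state_label B s = Final r))"
  unfolding computes_def using finite_computation_iff_reach[of k V R B] by metis

text \<open>
  Every variable \<open>v\<close> of the program \<open>Bh\<close> is a function \<open>\<gamma> v\<close> of one variable \<open>\<sigma> v\<close> of the new
  program. Each edge of \<open>Bh\<close> is replaced by one edge for every value of \<open>\<sigma> v\<close> activating it. The
  final states whose label is not a legal output become unreachable query states with loops. Every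
  edge gets \<open>m\<close> parallel copies: with \<open>m = 2\<close> the result is never deterministic.
\<close>

locale bp_substitution =
  fixes Bh :: "('s, 'e, 'w, 'r) branching_program"
    and \<sigma> :: "'w \<Rightarrow> 'v" and \<gamma> :: "'w \<Rightarrow> nat \<Rightarrow> nat"
    and kh k m :: nat and Vh :: "'w set" and V :: "'v set" and Rh R :: "'r set"
    and gh :: "('w \<Rightarrow> nat) \<Rightarrow> 'r" and g :: "('v \<Rightarrow> nat) \<Rightarrow> 'r" and v0 :: 'v
  assumes Bh: "computes kh Vh Rh gh Bh"
    and \<sigma>: "\<And>v. v \<in> Vh \<Longrightarrow> \<sigma> v \<in> V" and v0: "v0 \<in> V"
    and \<gamma>: "\<And>v a. v \<in> Vh \<Longrightarrow> a \<in> {1..k} \<Longrightarrow> \<gamma> v a \<in> {1..kh}"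
    and gh: "\<And>x. x \<in> V \<rightarrow>\<^sub>E {1..k} \<Longrightarrow> gh (restrict (\<lambda>v. \<gamma> v (x (\<sigma> v))) Vh) = g x"
    and g: "\<And>x. x \<in> V \<rightarrow>\<^sub>E {1..k} \<Longrightarrow> g x \<in> R"
    and R: "R \<subseteq> Rh" and m: "m \<noteq> 0"
    and nonconst: "\<exists>x \<in> V \<rightarrow>\<^sub>E {1..k}. \<exists>y \<in> V \<rightarrow>\<^sub>E {1..k}. g x \<noteq> g y"
begin

abbreviation "Gh \<equiv> state_graph Bh"

definition xh :: "('v \<Rightarrow> nat) \<Rightarrow> 'w \<Rightarrow> nat" where
  "xh x = restrict (\<lambda>v. \<gamma> v (x (\<sigma> v))) Vh"

definition new_label :: "'s \<Rightarrow> ('v, 'r) state_label" where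
  "new_label s = (case state_label Bh s of Query v \<Rightarrow> Query (\<sigma> v)
     | Final r \<Rightarrow> if r \<in> R then Final r else Query v0)"

text \<open>The second component is the label of the new arc and the third its copy number. The
  loops at discarded final states carry every label in \<open>{1..k}\<close>, so that these states
  do not violate determinism after they have become queries.\<close>

definition new_arcs :: "(('e + 's) \<times> nat \<times> nat) set" where
  "new_arcs =
     {(Inl e, a, c) | e a c v. e \<in> arcs Gh \<and> state_label Bh (tail Gh e) = Query v \<and>
        a \<in> {1..k} \<and> edge_label Bh e = \<gamma> v a \<and> c < m} \<union>
     {(Inr s, a, c) | s a c r. s \<in> verts Gh \<and> state_label Bh s = Final r \<and> r \<notin> R \<and>
        a \<in> {1..k} \<and> c < m}"

fun new_tail :: "('e + 's) \<times> nat \<times> nat \<Rightarrow> 's" where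
  "new_tail (Inl e, _) = tail Gh e"
| "new_tail (Inr s, _) = s"

fun new_head :: "('e + 's) \<times> nat \<times> nat \<Rightarrow> 's" where
  "new_head (Inl e, _) = head Gh e"
| "new_head (Inr s, _) = s"

lemma wf_Bh: "wf_bp kh Vh Rh Bh"
  using Bh by (simp add: computes_iff_reach)

sublocale fin_digraph Gh
  using wf_Bh by (simp add: wf_bp_def)

lemma finite_new_arcs: "finite new_arcs"
proof (rule finite_subset)
  show "new_arcs \<subseteq> (arcs Gh <+> verts Gh) \<times> {1..k} \<times> {..<m}"
    unfolding new_arcs_def by auto
qed auto

text \<open>The resulting program must have natural numbers as states and arcs; since both sets are
  finite, arbitrary injections rename them.\<close>

definition \<phi> :: "'s \<Rightarrow> nat" where
  "\<phi> = (SOME f. inj_on f (verts Gh))"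

definition \<psi> :: "('e + 's) \<times> nat \<times> nat \<Rightarrow> nat" where
  "\<psi> = (SOME f. inj_on f new_arcs)"

lemma inj_\<phi>: "inj_on \<phi> (verts Gh)"
  unfolding \<phi>_def using finite_imp_inj_to_nat_seg[OF finite_verts] by (metis (mono_tags, lifting) someI)

lemma inj_\<psi>: "inj_on \<psi> new_arcs"
  unfolding \<psi>_def using finite_imp_inj_to_nat_seg[OF finite_new_arcs] by (metis (mono_tags, lifting) someI)

definition \<phi>' :: "nat \<Rightarrow> 's" where "\<phi>' = inv_into (verts Gh) \<phi>"
definition \<psi>' :: "nat \<Rightarrow> ('e + 's) \<times> nat \<times> nat" where "\<psi>' = inv_into new_arcs \<psi>"

lemma \<phi>'_\<phi> [simp]: "s \<in> verts Gh \<Longrightarrow> \<phi>' (\<phi> s) = s"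
  unfolding \<phi>'_def by (rule inv_into_f_f[OF inj_\<phi>])

lemma \<psi>'_\<psi> [simp]: "e \<in> new_arcs \<Longrightarrow> \<psi>' (\<psi> e) = e"
  unfolding \<psi>'_def by (rule inv_into_f_f[OF inj_\<psi>])

definition B :: "(nat, nat, 'v, 'r) branching_program" where
  "B = \<lparr>state_graph = \<lparr>verts = \<phi> ` verts Gh, arcs = \<psi> ` new_arcs,
      tail = \<lambda>e. \<phi> (new_tail (\<psi>' e)), head = \<lambda>e. \<phi> (new_head (\<psi>' e))\<rparr>,
    start = \<phi> (start Bh), edge_label = \<lambda>e. fst (snd (\<psi>' e)),
    state_label = \<lambda>s. new_label (\<phi>' s)\<rparr>"

lemma new_tail_in [simp]: "e \<in> new_arcs \<Longrightarrow> new_tail e \<in> verts Gh"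
  unfolding new_arcs_def by auto

lemma new_head_in [simp]: "e \<in> new_arcs \<Longrightarrow> new_head e \<in> verts Gh"
  unfolding new_arcs_def by auto

lemma start_in [simp]: "start Bh \<in> verts Gh"
  using wf_Bh by (simp add: wf_bp_def)

lemma Query_in_Vh: "s \<in> verts Gh \<Longrightarrow> state_label Bh s = Query v \<Longrightarrow> v \<in> Vh"
  using wf_Bh by (simp add: wf_bp_def)

lemma new_label_Query: "s \<in> verts Gh \<Longrightarrow> new_label s = Query v \<Longrightarrow> v \<in> V"
  using \<sigma> v0 Query_in_Vh unfolding new_label_def
  by (auto split: state_label.splits if_splits)

lemma new_label_Final: "new_label s = Final r \<longleftrightarrow> state_label Bh s = Final r \<and> r \<in> R"
  unfolding new_label_def by (auto split: state_label.splits if_splits)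

lemma new_label_tail: "e \<in> new_arcs \<Longrightarrow> new_label (new_tail e) \<noteq> Final r"
  unfolding new_arcs_def by (auto simp: new_label_Final)

lemma out_arcs_B: "s \<in> verts Gh \<Longrightarrow>
  out_arcs (state_graph B) (\<phi> s) = \<psi> ` {e \<in> new_arcs. new_tail e = s}"
  using inj_on_eq_iff[OF inj_\<phi>] by (auto simp: out_arcs_def B_def image_iff)

lemma wf_B: "wf_bp k V R B"
  unfolding wf_bp_def
proof (intro conjI ballI allI impI)
  show "fin_digraph (state_graph B)"
    by (unfold_locales) (auto simp: B_def finite_new_arcs)
  show "start B \<in> states B"
    by (simp add: B_def)
next
  fix e assume "e \<in> arcs (state_graph B)"
  then show "edge_label B e \<in> {1..k}"
    by (auto simp: B_def) (auto simp: new_arcs_def)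
next
  fix s v assume "s \<in> states B" "state_label B s = Query v"
  then show "v \<in> V"
    by (auto simp: B_def intro: new_label_Query)
next
  fix s r assume *: "s \<in> states B" "state_label B s = Final r"
  then show "r \<in> R"
    by (auto simp: B_def new_label_Final)
  from * obtain t where t: "s = \<phi> t" "t \<in> verts Gh" "new_label t = Final r"
    by (auto simp: B_def)
  then show "out_arcs (state_graph B) s = {}"
    using new_label_tail by (auto simp: out_arcs_B)
next
  fix r assume r: "r \<in> R"
  then have "\<exists>!s. s \<in> verts Gh \<and> state_label Bh s = Final r"
    using wf_Bh R unfolding wf_bp_def by blast
  then obtain s where s: "s \<in> verts Gh" "state_label Bh s = Final r"
    and u: "\<And>t. t \<in> verts Gh \<Longrightarrow> state_label Bh t = Final r \<Longrightarrow> t = s" by blast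
  show "\<exists>!s. s \<in> states B \<and> state_label B s = Final r"
  proof (rule ex1I[of _ "\<phi> s"])
    show "\<phi> s \<in> states B \<and> state_label B (\<phi> s) = Final r"
      using s r by (simp add: B_def new_label_Final)
    fix t assume "t \<in> states B \<and> state_label B t = Final r"
    then show "t = \<phi> s"
      using u by (auto simp: B_def new_label_Final)
  qed
qed

lemma xh_in: "x \<in> V \<rightarrow>\<^sub>E {1..k} \<Longrightarrow> xh x \<in> Vh \<rightarrow>\<^sub>E {1..kh}"
  using \<gamma> \<sigma> unfolding xh_def by (intro PiE_I) (auto simp: PiE_mem simp del: atLeastAtMost_iff)

text \<open>Because \<open>g x\<close> lies in \<open>R\<close>, a final state labelled outside
  \<open>R\<close> is never reached on a translated input. Turning it into a query is therefore
  harmless.\<close>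

lemma no_illegal_final:
  assumes "x \<in> V \<rightarrow>\<^sub>E {1..k}" "reach Bh (xh x) s" "state_label Bh s = Final r"
  shows "r = g x"
  using Bh xh_in[OF assms(1)] assms gh[OF assms(1)] by (auto simp: computes_iff_reach xh_def)

lemma reach_Bh_in: "reach Bh y s \<Longrightarrow> s \<in> verts Gh"
  by (induction rule: reach.induct) auto

lemma reach_B_imp:
  assumes x: "x \<in> V \<rightarrow>\<^sub>E {1..k}" and "reach B x t"
  shows "\<exists>s. t = \<phi> s \<and> s \<in> verts Gh \<and> reach Bh (xh x) s"
  using assms(2)
proof induction
  case reach_start
  show ?case
    by (rule exI[of _ "start Bh"]) (auto simp: B_def intro: reach.intros)
next
  case (reach_step e')
  from reach_step.hyps(2) obtain e where e: "e \<in> new_arcs" "e' = \<psi> e"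
    by (auto simp: B_def)
  from reach_step.IH e have r: "reach Bh (xh x) (new_tail e)"
    using inj_on_eq_iff[OF inj_\<phi>] by (auto simp: B_def)
  have "reach Bh (xh x) (new_head e)"
  proof -
    from e(1) consider (1) e0 a c v where "e = (Inl e0, a, c)" "e0 \<in> arcs Gh"
        "state_label Bh (tail Gh e0) = Query v" "edge_label Bh e0 = \<gamma> v a"
      | (2) s0 a c where "e = (Inr s0, a, c)"
      unfolding new_arcs_def by blast
    then show ?thesis
    proof cases
      case 1
      have v: "v \<in> Vh" using Query_in_Vh[OF tail_in_verts[OF 1(2)] 1(3)] .
      have "a = x (\<sigma> v)"
        using reach_step.hyps(3) e 1 by (auto simp: activated_def B_def new_label_def)
      then have "activated Bh (xh x) e0"
        using 1 v by (auto simp: activated_def xh_def)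
      then show ?thesis
        using 1 r reach.reach_step[of Bh "xh x" e0] by auto
    next
      case 2
      then show ?thesis using r by simp
    qed
  qed
  then show ?case
    using e by (auto simp: B_def)
qed

lemma reach_B:
  assumes x: "x \<in> V \<rightarrow>\<^sub>E {1..k}" and "reach Bh (xh x) s"
  shows "reach B x (\<phi> s)"
  using assms(2)
proof induction
  case reach_start
  show ?case
    using reach.reach_start[of B x] by (simp add: B_def)
next
  case (reach_step e)
  then obtain v where v: "state_label Bh (tail Gh e) = Query v" "edge_label Bh e = xh x v"
    by (auto simp: activated_def)
  have vV: "v \<in> Vh" using v reach_step by (auto intro!: Query_in_Vh)
  \<comment> \<open>Copy \<open>0\<close> exists because \<open>m\<close> is positive. The value
    component has to be the actual value of the queried variable, so that exactly this arc is
    activated.\<close>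
  let ?e = "(Inl e, x (\<sigma> v), 0)"
  have e: "?e \<in> new_arcs"
    using v vV reach_step.hyps m \<sigma>[OF vV] PiE_mem[OF x, of "\<sigma> v"] by (auto simp: new_arcs_def xh_def)
  have "activated B x (\<psi> ?e)"
    using e v reach_step.hyps by (auto simp: activated_def B_def new_label_def)
  from reach.reach_step[of B x "\<psi> ?e", OF _ _ this] e reach_step
  show ?case by (auto simp: B_def)
qed

lemma computes_B: "computes k V R g B"
  unfolding computes_iff_reach
proof (intro conjI ballI wf_B allI impI)
  fix x s r assume x: "x \<in> V \<rightarrow>\<^sub>E {1..k}" and "reach B x s \<and> state_label B s = Final r"
  then show "r = g x"
    using reach_B_imp[OF x, of s] no_illegal_final[OF x]
    by (auto simp: B_def new_label_Final)
next
  fix x assume x: "x \<in> V \<rightarrow>\<^sub>E {1..k}"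
  then obtain s r where s: "reach Bh (xh x) s" "state_label Bh s = Final r"
    using Bh xh_in[OF x] unfolding computes_iff_reach by blast
  then have "r = g x" using no_illegal_final x by blast
  then have "reach B x (\<phi> s) \<and> state_label B (\<phi> s) = Final r"
    using s reach_B[OF x] g[OF x] reach_Bh_in by (auto simp: B_def new_label_Final)
  then show "\<exists>s r. reach B x s \<and> state_label B s = Final r" by blast
qed

lemma card_states_B: "card (states B) \<le> card (states Bh)"
  by (simp add: B_def card_image_le)

text \<open>A final root is reached by every computation, so its label would be the output on all
  inputs, against \<open>nonconst\<close>.\<close>

lemma start_Query: "\<exists>v. state_label Bh (start Bh) = Query v"
proof (cases "state_label Bh (start Bh)")
  case (Final r)
  then have "g x = r" if "x \<in> V \<rightarrow>\<^sub>E {1..k}" for x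
    using no_illegal_final[OF that reach_start] by simp
  then show ?thesis using nonconst by metis
qed auto

text \<open>For each \<open>a\<close> in \<open>{1..k}\<close> the value \<open>\<gamma> w a\<close>
  is the label of exactly one old arc out of the state, hence exactly one new arc has label
  \<open>a\<close>, even if \<open>\<gamma> w\<close> is not injective.\<close>

lemma deterministic_B:
  assumes "deterministic kh Bh" "m = 1"
  shows "deterministic k B"
  unfolding deterministic_def
proof (intro ballI allI impI)
  fix t v assume "t \<in> states B" "state_label B t = Query v"
  then obtain s where s: "t = \<phi> s" "s \<in> verts Gh" "new_label s = Query v"
    by (auto simp: B_def)
  let ?A = "{e \<in> new_arcs. new_tail e = s}"
  have bij: "bij_betw (\<lambda>e. fst (snd e)) ?A {1..k}"
  proof (cases "state_label Bh s")
    case (Query w)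
    then have w: "w \<in> Vh" using s Query_in_Vh by auto
    have b: "bij_betw (edge_label Bh) (out_arcs Gh s) {1..kh}"
      using assms(1) Query s unfolding deterministic_def by blast
    have A: "?A = {(Inl e, a, 0) | e a. e \<in> out_arcs Gh s \<and> a \<in> {1..k} \<and> edge_label Bh e = \<gamma> w a}"
      using Query assms(2) unfolding new_arcs_def by auto
    show ?thesis
      unfolding bij_betw_def
    proof
      show "inj_on (\<lambda>e. fst (snd e)) ?A"
        unfolding A using bij_betw_imp_inj_on[OF b] by (auto simp: inj_on_def)
      have "\<exists>e \<in> out_arcs Gh s. edge_label Bh e = \<gamma> w a" if "a \<in> {1..k}" for a
        using \<gamma>[OF w that] bij_betw_imp_surj_on[OF b] by (metis imageE)
      then show "(\<lambda>e. fst (snd e)) ` ?A = {1..k}"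
        unfolding A by (force simp: image_iff)
    qed
  next
    case (Final r)
    then have "r \<notin> R" using s(3) by (auto simp: new_label_def split: if_splits)
    then have A: "?A = {(Inr s, a, 0) | a. a \<in> {1..k}}"
      using Final assms(2) s(2) unfolding new_arcs_def by auto
    show ?thesis
      unfolding A bij_betw_def by (force simp: inj_on_def image_iff)
  qed
  show "bij_betw (edge_label B) (out_arcs (state_graph B) t) {1..k}"
  proof -
    have "bij_betw \<psi> ?A (\<psi> ` ?A)"
      using inj_\<psi> by (auto intro!: inj_on_imp_bij_betw intro: inj_on_subset)
    moreover have "bij_betw (edge_label B) (\<psi> ` ?A) {1..k} \<longleftrightarrow>
        bij_betw (edge_label B \<circ> \<psi>) ?A {1..k}"
      using bij_betw_comp_iff[OF calculation] by blast
    moreover have "bij_betw (edge_label B \<circ> \<psi>) ?A {1..k} \<longleftrightarrow> bij_betw (\<lambda>e. fst (snd e)) ?A {1..k}"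
      by (rule bij_betw_cong) (auto simp: B_def)
    ultimately show ?thesis
      using bij s by (simp add: out_arcs_B)
  qed
qed

text \<open>Determinism would give the root an arc with label \<open>1\<close>. Exchanging the copy
  numbers \<open>0\<close> and \<open>1\<close> yields a second arc with the same tail and the same
  label.\<close>

lemma not_deterministic_B:
  assumes "m = 2"
  shows "\<not> deterministic k B"
proof
  assume det: "deterministic k B"
  obtain v where v: "state_label Bh (start Bh) = Query v"
    using start_Query by blast
  let ?O = "out_arcs (state_graph B) (\<phi> (start Bh))"
  have bij: "bij_betw (edge_label B) ?O {1..k}"
    using det v unfolding deterministic_def by (auto simp: B_def new_label_def)
  obtain x where "x \<in> V \<rightarrow>\<^sub>E {1..k}" using nonconst by blast
  from PiE_mem[OF this v0] have "x v0 \<in> {1..k}" .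
  then have "1 \<in> {1..k}" by simp
  then obtain e where e: "e \<in> ?O" using bij_betw_imp_surj_on[OF bij] by blast
  then obtain f where f: "f \<in> new_arcs" "new_tail f = start Bh" "e = \<psi> f"
    by (auto simp: out_arcs_B)
  then obtain e0 a c where f': "f = (Inl e0, a, c)" "c < 2"
    using v assms unfolding new_arcs_def by auto
  let ?f' = "(Inl e0, a, 1 - c)"
  have fn: "?f' \<in> new_arcs" "new_tail ?f' = start Bh"
    using f f' assms unfolding new_arcs_def by auto
  have "\<psi> ?f' \<in> ?O" using fn by (auto simp: out_arcs_B)
  moreover have "edge_label B (\<psi> ?f') = edge_label B e"
    using f f' fn by (simp add: B_def)
  ultimately have "\<psi> ?f' = \<psi> f"
    using bij_betw_imp_inj_on[OF bij] e f by (auto dest: inj_onD)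
  then have "?f' = f" using inj_onD[OF inj_\<psi>] fn f by blast
  then show False using f' by (simp, presburger)
qed

end

lemma bp_substitution_exists:
  fixes Bh :: "('s, 'e, 'w, 'r) branching_program"
    and \<sigma> :: "'w \<Rightarrow> 'v"
  assumes "computes kh Vh Rh gh Bh"
    and "\<And>v. v \<in> Vh \<Longrightarrow> \<sigma> v \<in> V" and "dflt \<in> V"
    and "\<And>v a. v \<in> Vh \<Longrightarrow> a \<in> {1..k} \<Longrightarrow> \<gamma> v a \<in> {1..kh}"
    and "\<And>x. x \<in> V \<rightarrow>\<^sub>E {1..k} \<Longrightarrow> gh (restrict (\<lambda>v. \<gamma> v (x (\<sigma> v))) Vh) = g x"
    and "\<And>x. x \<in> V \<rightarrow>\<^sub>E {1..k} \<Longrightarrow> g x \<in> R"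
    and "R \<subseteq> Rh"
    and "\<exists>x \<in> V \<rightarrow>\<^sub>E {1..k}. \<exists>y \<in> V \<rightarrow>\<^sub>E {1..k}. g x \<noteq> g y"
  shows "\<exists>B :: (nat, nat, 'v, 'r) branching_program. computes k V R g B \<and>
    card (states B) \<le> card (states Bh) \<and> (deterministic k B \<longleftrightarrow> deterministic kh Bh)"
proof -
  define m :: nat where "m = (if deterministic kh Bh then 1 else 2)"
  interpret bp_substitution Bh \<sigma> \<gamma> kh k m Vh V Rh R gh g dflt
    using assms by unfold_locales (auto simp: m_def)
  have "deterministic k B \<longleftrightarrow> deterministic kh Bh"
    using deterministic_B not_deterministic_B by (cases "deterministic kh Bh") (auto simp: m_def)
  then show ?thesis using computes_B card_states_B by blast
qed

section \<open>Coding nodes and values by numbers\<close>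

lemma num_nodes_Suc: "num_nodes d (Suc h) = d * num_nodes d h + 1"
  unfolding num_nodes_def by (simp add: sum.lessThan_Suc_shift sum_distrib_left del: sum.lessThan_Suc)

lemma num_nodes_closed_form:
  assumes "d \<ge> 2"
  shows "(d ^ h - 1) div (d - 1) = num_nodes d h"
proof -
  have "(d - 1) * num_nodes d h + 1 = d ^ h"
  proof (induction h)
    case 0
    show ?case by (simp add: num_nodes_def)
  next
    case (Suc h)
    have "(d - 1) * num_nodes d (Suc h) + 1 = d * ((d - 1) * num_nodes d h + 1)"
      using assms by (cases d) (simp_all add: num_nodes_Suc algebra_simps)
    then show ?case unfolding Suc power_Suc .
  qed
  then have "d ^ h - 1 = (d - 1) * num_nodes d h" by linarith
  then show ?thesis using assms by simp
qed

lemma num_nodes_mono: "h \<le> h' \<Longrightarrow> num_nodes d h \<le> num_nodes d h'"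
  unfolding num_nodes_def by (rule sum_mono2) auto

lemma num_nodes_pos: "0 < h \<Longrightarrow> 0 < num_nodes d h"
  by (cases h) (simp_all add: num_nodes_Suc)

lemma nth_children: "j < d \<Longrightarrow> children d i ! j = d * (i - 1) + j + 2"
  by (simp add: children_def nth_append del: upt_Suc)

lemma length_children [simp]: "length (children d i) = d"
  by (simp add: children_def)

text \<open>The first child \<open>d * (i - 1) + 2\<close> already determines \<open>i\<close>. This
  is what lets a common function recognise the node at which it is applied.\<close>

lemma children_inj:
  assumes "children d i = children d i'" "0 < d" "0 < i" "0 < i'"
  shows "i = i'"
proof -
  have "children d i ! 0 = children d i' ! 0" using assms by simp
  then have "d * (i - 1) = d * (i' - 1)" using assms(2) by (simp add: nth_children)
  then have "i - 1 = i' - 1" using assms(2) by (simp only: mult_cancel1) simp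
  then show ?thesis using assms(3,4) by linarith
qed

lemma children_le:
  assumes "i \<in> internal_nodes d h" "c \<in> set (children d i)" "2 \<le> h"
  shows "c \<in> {1..num_nodes d h}"
proof -
  obtain j where j: "j \<le> d" "c = d * (i - 1) + j + 1" "1 \<le> j"
    using assms(2) unfolding children_def by auto
  have "d * (i - 1) + d = d * i"
    using assms(1) by (cases i) (auto simp: internal_nodes_def)
  also have "\<dots> \<le> d * num_nodes d (h - 1)"
    using assms(1) by (simp add: internal_nodes_def)
  also have "\<dots> + 1 = num_nodes d h"
    using num_nodes_Suc[of d "h - 1"] assms(3) by simp
  finally show ?thesis using j by simp
qed

text \<open>
  Since the root is the node \<open>1\<close>, its values are coded by themselves, so the two problems have the
  same output.
\<close>

definition code_nodes :: "nat \<Rightarrow> nat list \<Rightarrow> nat list" where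
  "code_nodes k ys = map (\<lambda>y. (y - 1) div k + 1) ys"

definition code_values :: "nat \<Rightarrow> nat list \<Rightarrow> nat list" where
  "code_values k ys = map (\<lambda>y. (y - 1) mod k + 1) ys"

definition parent :: "nat \<Rightarrow> nat \<Rightarrow> nat list \<Rightarrow> nat" where
  "parent d k ys = (THE i. 0 < i \<and> children d i = code_nodes k ys)"

definition is_siblings :: "nat \<Rightarrow> nat \<Rightarrow> nat \<Rightarrow> nat list \<Rightarrow> bool" where
  "is_siblings d h k ys \<longleftrightarrow> (\<exists>i \<in> internal_nodes d h. children d i = code_nodes k ys)"

text \<open>On tuples that do not decode to the children of an internal node the simulating function
  is constantly \<open>1\<close>. A state querying such an entry still has to query some variable;
  the last leaf serves as a dummy.\<close>

fun sub_var :: "nat \<Rightarrow> nat \<Rightarrow> nat \<Rightarrow> hat_var \<Rightarrow> ft_var" where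
  "sub_var d h k (HatLeaf i) = Leaf i"
| "sub_var d h k (HatFn ys) =
    (if is_siblings d h k ys then Fn (parent d k ys) (code_values k ys) else Leaf (num_nodes d h))"

fun sub_val :: "nat \<Rightarrow> nat \<Rightarrow> nat \<Rightarrow> hat_var \<Rightarrow> nat \<Rightarrow> nat" where
  "sub_val d h k (HatLeaf i) a = (i - 1) * k + a"
| "sub_val d h k (HatFn ys) a =
    (if is_siblings d h k ys then (parent d k ys - 1) * k + a else 1)"

definition hat_instance :: "nat \<Rightarrow> nat \<Rightarrow> nat \<Rightarrow> (ft_var \<Rightarrow> nat) \<Rightarrow> hat_var \<Rightarrow> nat" where
  "hat_instance d h k x = restrict (\<lambda>v. sub_val d h k v (x (sub_var d h k v)))
     (hatFT_vars d h (num_nodes d h * k))"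

lemma parent_eq:
  assumes "0 < d" "0 < i" "children d i = code_nodes k ys"
  shows "parent d k ys = i"
  unfolding parent_def using assms by (intro the_equality) (auto intro: children_inj[of d])

lemma parent_in_internal_nodes:
  assumes "0 < d" "is_siblings d h k ys"
  shows "parent d k ys \<in> internal_nodes d h"
proof -
  obtain i where "i \<in> internal_nodes d h" "children d i = code_nodes k ys"
    using assms(2) unfolding is_siblings_def by blast
  then show ?thesis using parent_eq[of d i k ys] assms(1) by (simp add: internal_nodes_def)
qed

lemma code_range:
  assumes "i \<in> {1..n}" "a \<in> {1..k::nat}"
  shows "(i - 1) * k + a \<in> {1..n * k}"
proof -
  have "(i - 1) * k + a \<le> (i - 1) * k + k" using assms by simp
  also have "\<dots> = i * k" using assms by (cases i) auto
  also have "\<dots> \<le> n * k" using assms by simp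
  finally show ?thesis using assms by simp
qed

lemma num_nodes_in_leaves:
  assumes "2 \<le> h" "0 < d"
  shows "num_nodes d h \<in> leaves d h"
proof -
  obtain h' where h': "h = Suc h'" "0 < h'" using assms by (cases h) auto
  have "num_nodes d h' < num_nodes d h"
    using num_nodes_Suc[of d h'] h' assms by (cases d) auto
  then show ?thesis using h' by (simp add: leaves_def)
qed

lemma node_value_internal:
  "i \<in> internal_nodes d h \<Longrightarrow>
    node_value d h f l i = f i (map (node_value d h f l) (children d i))"
  by (subst node_value.simps) (simp only: if_True)

lemma node_value_leaf: "i \<notin> internal_nodes d h \<Longrightarrow> node_value d h f l i = l i"
  by (subst node_value.simps) (simp only: if_False)

context
  fixes d h k :: nat
  assumes d: "2 \<le> d" and h: "2 \<le> h" and k: "2 \<le> k"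
begin

lemma length_hat_var: "HatFn ys \<in> hatFT_vars d h K \<longleftrightarrow> length ys = d \<and> set ys \<subseteq> {1..K}"
  by (auto simp: hatFT_vars_def)

lemma Fn_in_FT_vars:
  "Fn i xs \<in> FT_vars d h k \<longleftrightarrow> i \<in> internal_nodes d h \<and> length xs = d \<and> set xs \<subseteq> {1..k}"
  by (auto simp: FT_vars_def)

lemma sub_var_in:
  assumes "v \<in> hatFT_vars d h (num_nodes d h * k)"
  shows "sub_var d h k v \<in> FT_vars d h k"
proof (cases v)
  case (HatLeaf i)
  then show ?thesis using assms by (auto simp: hatFT_vars_def FT_vars_def)
next
  case (HatFn ys)
  have "set (code_values k ys) \<subseteq> {1..k}"
    using k unfolding code_values_def by (auto simp: Suc_le_eq)
  moreover have "parent d k ys \<in> internal_nodes d h" if "is_siblings d h k ys"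
    using parent_in_internal_nodes[OF _ that] d by simp
  ultimately show ?thesis
    using HatFn assms num_nodes_in_leaves[OF h, of d] d
    by (auto simp: length_hat_var Fn_in_FT_vars code_values_def) (auto simp: FT_vars_def)
qed

lemma sub_val_in:
  assumes "v \<in> hatFT_vars d h (num_nodes d h * k)" "a \<in> {1..k}"
  shows "sub_val d h k v a \<in> {1..num_nodes d h * k}"
proof (cases v)
  case (HatLeaf i)
  then have "i \<in> {1..num_nodes d h}"
    using assms by (auto simp: hatFT_vars_def leaves_def)
  from code_range[OF this assms(2)] show ?thesis using HatLeaf by simp
next
  case (HatFn ys)
  have "parent d k ys \<in> {1..num_nodes d h}" if "is_siblings d h k ys"
  proof -
    from that have "parent d k ys \<in> internal_nodes d h"
      using parent_in_internal_nodes d by simp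
    then show ?thesis
      using num_nodes_mono[of "h - 1" h d] by (auto simp: internal_nodes_def)
  qed
  from code_range[OF this assms(2)] show ?thesis
    using HatFn k num_nodes_pos[of h d] h by (auto simp: Suc_le_eq)
qed

lemma hat_instance_in:
  assumes "x \<in> FT_vars d h k \<rightarrow>\<^sub>E {1..k}"
  shows "hat_instance d h k x \<in> hatFT_vars d h (num_nodes d h * k) \<rightarrow>\<^sub>E {1..num_nodes d h * k}"
  unfolding hat_instance_def
  using sub_val_in PiE_mem[OF assms sub_var_in] by (intro PiE_I) (auto simp del: atLeastAtMost_iff)

lemma node_value_hat_instance:
  assumes x: "x \<in> FT_vars d h k \<rightarrow>\<^sub>E {1..k}" and "i \<in> {1..num_nodes d h}"
  defines "nv \<equiv> node_value d h (\<lambda>i xs. x (Fn i xs)) (\<lambda>i. x (Leaf i))"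
    and "nh \<equiv> node_value d h (\<lambda>_ xs. hat_instance d h k x (HatFn xs))
      (\<lambda>i. hat_instance d h k x (HatLeaf i))"
  shows "nh i = (i - 1) * k + nv i \<and> nv i \<in> {1..k}"
  using assms(2)
\<comment> \<open>Children have larger numbers than their parent, so the measure decreases on the
  way down to the leaves.\<close>
proof (induction i rule: measure_induct_rule[where f = "\<lambda>i. num_nodes d h - i"])
  case (less i)
  show ?case
  proof (cases "i \<in> internal_nodes d h")
    case True
    let ?ys = "map nh (children d i)" and ?xs = "map nv (children d i)"
    have IH: "nh c = (c - 1) * k + nv c \<and> nv c \<in> {1..k} \<and> c \<in> {1..num_nodes d h}"
      if "c \<in> set (children d i)" for c
    proof -
      have c: "c \<in> {1..num_nodes d h}" by (rule children_le[OF True that h])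
      have "num_nodes d h - c < num_nodes d h - i"
        using children_greater[OF that] c by auto
      from less.IH[OF this c] c show ?thesis by blast
    qed
    \<comment> \<open>Values range over \<open>{1..k}\<close> and not \<open>{0..<k}\<close>. After
      subtracting one from the code, \<open>nv c - 1\<close> is a genuine remainder modulo
      \<open>k\<close> and \<open>c - 1\<close> the quotient.\<close>
    have dm: "(nh c - 1) div k + 1 = c" "(nh c - 1) mod k + 1 = nv c" if "c \<in> set (children d i)" for c
    proof -
      have lt: "nv c - 1 < k" "0 < nv c" "0 < c" using IH[OF that] by auto
      have "nh c - 1 = (c - 1) * k + (nv c - 1)" using IH[OF that] lt by linarith
      then have "(nh c - 1) div k = c - 1" "(nh c - 1) mod k = nv c - 1"
        using lt by (simp_all only: div_mult_self3 mod_mult_self3 div_less mod_less add_0_right)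
      then show "(nh c - 1) div k + 1 = c" "(nh c - 1) mod k + 1 = nv c"
        using lt by linarith+
    qed
    have nodes: "code_nodes k ?ys = children d i"
      unfolding code_nodes_def map_map by (rule map_idI) (simp only: comp_def dm)
    have vals: "code_values k ?ys = ?xs"
      unfolding code_values_def map_map by (rule map_cong) (simp_all only: comp_def dm)
    have sib: "is_siblings d h k ?ys"
      unfolding is_siblings_def by (rule bexI[of _ i]) (fact nodes[symmetric] True)+
    have i: "0 < i" using True by (auto simp: internal_nodes_def)
    have par: "parent d k ?ys = i"
      by (rule parent_eq) (use d i nodes in simp_all)
    have "nh c \<in> {1..num_nodes d h * k}" if "c \<in> set (children d i)" for c
      using IH[OF that] code_range[of c "num_nodes d h" "nv c" k] by simp
    then have "set ?ys \<subseteq> {1..num_nodes d h * k}"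
      unfolding set_map by (rule image_subsetI)
    then have in_hat: "HatFn ?ys \<in> hatFT_vars d h (num_nodes d h * k)"
      unfolding length_hat_var length_map length_children by blast
    have "nv i = x (Fn i ?xs)"
      unfolding nv_def by (rule node_value_internal[OF True])
    moreover have "x (Fn i ?xs) \<in> {1..k}"
    proof (rule PiE_mem[OF x])
      have "set ?xs \<subseteq> {1..k}"
      proof
        fix v assume "v \<in> set ?xs"
        then obtain c where "c \<in> set (children d i)" "v = nv c" by auto
        then show "v \<in> {1..k}" using IH[of c] by blast
      qed
      then show "Fn i ?xs \<in> FT_vars d h k"
        using True unfolding Fn_in_FT_vars length_map length_children by (intro conjI refl)
    qed
    moreover have "nh i = hat_instance d h k x (HatFn ?ys)"
      unfolding nh_def by (rule node_value_internal[OF True])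
    moreover have "\<dots> = (i - 1) * k + x (Fn i ?xs)"
      unfolding hat_instance_def restrict_apply' [OF in_hat] by (simp only: sub_var.simps sub_val.simps sib par vals if_True)
    ultimately show ?thesis by (simp only: simp_thms)
  next
    case False
    have i: "i \<in> leaves d h"
      using False less.prems by (auto simp: internal_nodes_def leaves_def)
    have "nv i = x (Leaf i)"
      unfolding nv_def by (rule node_value_leaf[OF False])
    moreover have "x (Leaf i) \<in> {1..k}"
      by (rule PiE_mem[OF x]) (use i in \<open>simp add: FT_vars_def\<close>)
    moreover have "nh i = hat_instance d h k x (HatLeaf i)"
      unfolding nh_def by (rule node_value_leaf[OF False])
    moreover have "\<dots> = (i - 1) * k + x (Leaf i)"
      unfolding hat_instance_def using i by (simp add: hatFT_vars_def)
    ultimately show ?thesis by (simp only: simp_thms)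
  qed
qed

lemma hatFT_hat_instance:
  assumes "x \<in> FT_vars d h k \<rightarrow>\<^sub>E {1..k}"
  shows "hatFT d h (hat_instance d h k x) = FT d h x" "FT d h x \<in> {1..k}"
  using node_value_hat_instance[OF assms, of 1] num_nodes_pos[of h d] h
  unfolding hatFT_def FT_def by (simp_all add: Suc_le_eq)

text \<open>If all variables equal \<open>a\<close>, so does the entry read at the root. The values
  \<open>1\<close> and \<open>2\<close> show that neither problem has a constant output, as the
  substitution requires.\<close>

lemma FT_const:
  assumes "a \<in> {1..k}"
  shows "\<exists>x \<in> FT_vars d h k \<rightarrow>\<^sub>E {1..k}. FT d h x = a"
proof
  define x where "x = restrict (\<lambda>_. a) (FT_vars d h k)"
  show x: "restrict (\<lambda>_. a) (FT_vars d h k) \<in> FT_vars d h k \<rightarrow>\<^sub>E {1..k}" using assms by auto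
  have 1: "1 \<in> internal_nodes d h"
    using h num_nodes_pos[of "h - 1" d] by (auto simp: internal_nodes_def Suc_le_eq)
  define nv where "nv = node_value d h (\<lambda>i xs. x (Fn i xs)) (\<lambda>i. x (Leaf i))"
  have "nv c \<in> {1..k}" if "c \<in> set (children d 1)" for c
    unfolding nv_def using node_value_hat_instance[OF x[folded x_def] children_le[OF 1 that h]] by blast
  then have "set (map nv (children d 1)) \<subseteq> {1..k}"
    unfolding set_map by (rule image_subsetI)
  then have "Fn 1 (map nv (children d 1)) \<in> FT_vars d h k"
    using 1 unfolding Fn_in_FT_vars length_map length_children by (intro conjI refl)
  then have "x (Fn 1 (map nv (children d 1))) = a"
    unfolding x_def by (rule restrict_apply')
  then have "FT d h x = a"
    unfolding FT_def nv_def using node_value_internal[OF 1] by metis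
  then show "FT d h (restrict (\<lambda>_. a) (FT_vars d h k)) = a"
    by (simp only: x_def)
qed

text \<open>The function \<open>out\<close> treats both problems at once: it is the identity for the
  function problem and the test for \<open>1\<close> for the decision problem.\<close>

lemma program_of_hat_program:
  fixes Bh :: "('s, 'e, hat_var, 'r) branching_program" and out :: "nat \<Rightarrow> 'r"
  assumes "computes (num_nodes d h * k) (hatFT_vars d h (num_nodes d h * k)) Rh (\<lambda>x. out (hatFT d h x)) Bh"
    and "R \<subseteq> Rh" "\<And>a. a \<in> {1..k} \<Longrightarrow> out a \<in> R" "out 1 \<noteq> out 2"
  shows "\<exists>B :: (nat, nat, ft_var, 'r) branching_program.
    computes k (FT_vars d h k) R (\<lambda>x. out (FT d h x)) B \<and> card (states B) \<le> card (states Bh) \<and>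
    (deterministic k B \<longleftrightarrow> deterministic (num_nodes d h * k) Bh)"
proof (rule bp_substitution_exists[OF assms(1), where \<sigma> = "sub_var d h k"
      and \<gamma> = "sub_val d h k" and dflt = "Leaf (num_nodes d h)"])
  show "Leaf (num_nodes d h) \<in> FT_vars d h k"
    using num_nodes_in_leaves[OF h, of d] d by (auto simp: FT_vars_def)
  obtain x where "x \<in> FT_vars d h k \<rightarrow>\<^sub>E {1..k}" "FT d h x = 1" using FT_const[of 1] k by auto
  moreover obtain y where "y \<in> FT_vars d h k \<rightarrow>\<^sub>E {1..k}" "FT d h y = 2" using FT_const[of 2] k by auto
  ultimately show "\<exists>x\<in>FT_vars d h k \<rightarrow>\<^sub>E {1..k}. \<exists>y\<in>FT_vars d h k \<rightarrow>\<^sub>E {1..k}. out (FT d h x) \<noteq> out (FT d h y)"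
    using assms(4) by (intro bexI[of _ x] bexI[of _ y]) simp_all
next
  fix x assume x: "x \<in> FT_vars d h k \<rightarrow>\<^sub>E {1..k}"
  show "out (hatFT d h (restrict (\<lambda>v. sub_val d h k v (x (sub_var d h k v)))
      (hatFT_vars d h (num_nodes d h * k)))) = out (FT d h x)"
    using hatFT_hat_instance(1)[OF x] by (simp only: hat_instance_def)
  show "out (FT d h x) \<in> R"
    by (rule assms(3)[OF hatFT_hat_instance(2)[OF x]])
qed (fact sub_var_in sub_val_in assms(2))+

lemma FT_program_of_hatFT_program:
  fixes Bh :: "('s, 'e, hat_var, nat) branching_program"
  assumes "solves_hatFT d h (num_nodes d h * k) Bh"
  shows "\<exists>B :: (nat, nat, ft_var, nat) branching_program. solves_FT d h k B \<and>
    card (states B) \<le> card (states Bh) \<and>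
    (deterministic k B \<longleftrightarrow> deterministic (num_nodes d h * k) Bh)"
proof -
  have "k \<le> num_nodes d h * k" using num_nodes_pos[of h d] h by (cases "num_nodes d h") auto
  then show ?thesis
    using program_of_hat_program[of "{1..num_nodes d h * k}" "\<lambda>a. a" Bh "{1..k}"] assms
    by (simp add: solves_hatFT_def solves_FT_def)
qed

lemma BT_program_of_hatBT_program:
  fixes Bh :: "('s, 'e, hat_var, bool) branching_program"
  assumes "solves_hatBT d h (num_nodes d h * k) Bh"
  shows "\<exists>B :: (nat, nat, ft_var, bool) branching_program. solves_BT d h k B \<and>
    card (states B) \<le> card (states Bh) \<and>
    (deterministic k B \<longleftrightarrow> deterministic (num_nodes d h * k) Bh)"
  using program_of_hat_program[of UNIV "\<lambda>a. a = 1" Bh UNIV] assms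
  by (simp add: solves_hatBT_def solves_BT_def hatBT_def[abs_def] BT_def[abs_def])

end

section \<open>Compiling programs to Turing machines\<close>

datatype test = TestInput "input_symbol \<Rightarrow> bool" | TestTapes nat nat "nat \<Rightarrow> nat \<Rightarrow> bool"

datatype com = Tape "nat set" "nat \<Rightarrow> nat \<times> head_move"
  | Input head_move | Output bool | Seq com com | Cond test com com | While test com

text \<open>Programs run on infinitely many tapes, so that no number of tapes has to be chosen while
  programs are put together. The compiled machine keeps only the first \<open>m\<close> of
  them.\<close>

type_synonym memory = "nat \<times> (nat \<Rightarrow> nat \<Rightarrow> nat) \<times> (nat \<Rightarrow> nat) \<times> bool list"

fun holds :: "bool list \<Rightarrow> test \<Rightarrow> memory \<Rightarrow> bool" where
  "holds w (TestInput Q) (p, T, P, out) = Q (input_symbol_at w p)"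
| "holds w (TestTapes r s Q) (p, T, P, out) = Q (T r (P r)) (T s (P s))"

fun tape_action :: "nat set \<Rightarrow> (nat \<Rightarrow> nat \<times> head_move) \<Rightarrow> memory \<Rightarrow> memory" where
  "tape_action X f (p, T, P, out) =
    (p, \<lambda>i. if i \<in> X then (T i)(P i := fst (f (T i (P i)))) else T i,
     \<lambda>i. if i \<in> X then move_head (snd (f (T i (P i)))) (P i) else P i, out)"

definition bounded :: "nat \<Rightarrow> memory \<Rightarrow> bool" where
  "bounded b \<mu> \<longleftrightarrow> (\<forall>i. fst (snd (snd \<mu>)) i \<le> b)"

text \<open>The parameter \<open>b\<close> bounds all head positions during the execution.\<close>

inductive exec :: "bool list \<Rightarrow> nat \<Rightarrow> com \<Rightarrow> memory \<Rightarrow> memory \<Rightarrow> bool" for w b where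
  exec_Tape: "bounded b (tape_action X f \<mu>) \<Longrightarrow> exec w b (Tape X f) \<mu> (tape_action X f \<mu>)"
| exec_Input: "exec w b (Input m) (p, r) (min (length w + 1) (move_head m p), r)"
| exec_Output: "exec w b (Output x) (p, T, P, out) (p, T, P, out @ [x])"
| exec_Seq: "exec w b c1 \<mu> \<mu>' \<Longrightarrow> exec w b c2 \<mu>' \<mu>'' \<Longrightarrow> exec w b (Seq c1 c2) \<mu> \<mu>''"
| exec_Cond: "exec w b (if holds w t \<mu> then c1 else c2) \<mu> \<mu>' \<Longrightarrow> exec w b (Cond t c1 c2) \<mu> \<mu>'"
| exec_WhileF: "\<not> holds w t \<mu> \<Longrightarrow> exec w b (While t c) \<mu> \<mu>"
| exec_WhileT: "holds w t \<mu> \<Longrightarrow> exec w b c \<mu> \<mu>' \<Longrightarrow> exec w b (While t c) \<mu>' \<mu>'' \<Longrightarrow>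
    exec w b (While t c) \<mu> \<mu>''"

lemma exec_bounded: "exec w b c \<mu> \<mu>' \<Longrightarrow> bounded b \<mu> \<Longrightarrow> bounded b \<mu>'"
  by (induction rule: exec.induct) (auto simp: bounded_def)

text \<open>Tests may look only at the first \<open>m\<close> tapes, but actions may touch any tape:
  what happens on the tapes that the machine lacks cannot influence the run. The set
  \<open>X\<close> may even be infinite.\<close>

fun com_ok :: "nat \<Rightarrow> nat \<Rightarrow> com \<Rightarrow> bool" where
  "com_ok m B (Tape X f) \<longleftrightarrow> (\<forall>s < B. fst (f s) < B)"
| "com_ok m B (Input _) \<longleftrightarrow> True"
| "com_ok m B (Output _) \<longleftrightarrow> True"
| "com_ok m B (Seq c1 c2) \<longleftrightarrow> com_ok m B c1 \<and> com_ok m B c2"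
| "com_ok m B (Cond t c1 c2) \<longleftrightarrow>
    (\<forall>r s Q. t = TestTapes r s Q \<longrightarrow> r < m \<and> s < m) \<and> com_ok m B c1 \<and> com_ok m B c2"
| "com_ok m B (While t c) \<longleftrightarrow> (\<forall>r s Q. t = TestTapes r s Q \<longrightarrow> r < m \<and> s < m) \<and> com_ok m B c"

text \<open>
  The control states of the machine are the continuations of the program: lists of programs that
  remain to be executed. Only finitely many of them arise.
\<close>

fun continuations :: "com \<Rightarrow> com list \<Rightarrow> com list set" where
  "continuations (Seq c1 c2) ks =
    {Seq c1 c2 # ks} \<union> continuations c1 (c2 # ks) \<union> continuations c2 ks"
| "continuations (Cond t c1 c2) ks =
    {Cond t c1 c2 # ks} \<union> continuations c1 ks \<union> continuations c2 ks"
| "continuations (While t c) ks = {While t c # ks} \<union> continuations c (While t c # ks)"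
| "continuations c ks = {c # ks}"

fun test_symbols :: "test \<Rightarrow> input_symbol \<Rightarrow> nat list \<Rightarrow> bool" where
  "test_symbols (TestInput Q) a ss = Q a"
| "test_symbols (TestTapes r s Q) a ss = Q (ss ! r) (ss ! s)"

definition idle :: "nat list \<Rightarrow> (nat \<times> head_move) list" where
  "idle ss = map (\<lambda>s. (s, Stay)) ss"

fun next_step :: "com list \<Rightarrow> input_symbol \<Rightarrow> nat list \<Rightarrow>
    com list \<times> head_move \<times> (nat \<times> head_move) list \<times> bool option" where
  "next_step [] a ss = ([], Stay, idle ss, None)"
| "next_step (Tape X f # ks) a ss =
    (ks, Stay, map (\<lambda>i. if i \<in> X then f (ss ! i) else (ss ! i, Stay)) [0..<length ss], None)"
| "next_step (Input m # ks) a ss = (ks, m, idle ss, None)"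
| "next_step (Output x # ks) a ss = (ks, Stay, idle ss, Some x)"
| "next_step (Seq c1 c2 # ks) a ss = (c1 # c2 # ks, Stay, idle ss, None)"
| "next_step (Cond t c1 c2 # ks) a ss =
    ((if test_symbols t a ss then c1 else c2) # ks, Stay, idle ss, None)"
| "next_step (While t c # ks) a ss =
    ((if test_symbols t a ss then c # While t c # ks else ks), Stay, idle ss, None)"

lemma finite_continuations: "finite (continuations c ks)"
  by (induction c ks rule: continuations.induct) auto

lemma continuations_self [simp]: "c # ks \<in> continuations c ks"
  by (cases c) auto

lemma continuations_closed:
  assumes "q \<in> continuations c ks"
  shows "fst (next_step q a ss) \<in> insert ks (continuations c ks)"
  using assms
  by (induction c ks arbitrary: q rule: continuations.induct) (fastforce split: if_splits)+

lemma continuations_ok: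
  assumes "q \<in> continuations c ks" "com_ok m B c" "\<forall>c \<in> set ks. com_ok m B c"
  shows "\<forall>c \<in> set q. com_ok m B c"
  using assms by (induction c ks arbitrary: q rule: continuations.induct) auto

lemma next_step_acts:
  assumes "\<forall>c \<in> set q. com_ok m B c" "set ss \<subseteq> {..<B}" "next_step q a ss = (q', mv, acts, out)"
  shows "length acts = length ss" "fst ` set acts \<subseteq> {..<B}"
proof -
  have "length (idle ss) = length ss \<and> fst ` set (idle ss) \<subseteq> {..<B}"
    using assms(2) by (auto simp: idle_def)
  moreover have "fst ` set (map (\<lambda>i. if i \<in> X then f (ss ! i) else (ss ! i, Stay)) [0..<length ss]) \<subseteq> {..<B}"
    if f: "\<forall>s < B. fst (f s) < B" for X f
  proof -
    have "fst (if i \<in> X then f (ss ! i) else (ss ! i, Stay)) < B" if "i < length ss" for i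
      using f assms(2) nth_mem[OF that] by (simp add: subset_iff)
    then show ?thesis by (simp only: set_map set_upt image_image image_subset_iff lessThan_iff ball_simps) simp
  qed
  ultimately have "length acts = length ss \<and> fst ` set acts \<subseteq> {..<B}"
    using assms(1,3)
    by (cases "(q, a, ss)" rule: next_step.cases)
      (simp_all only: next_step.simps prod.inject list.set com_ok.simps ball_simps insert_iff fst_conv snd_conv, simp_all, elim conjE, hypsubst, simp)
  then show "length acts = length ss" "fst ` set acts \<subseteq> {..<B}" by auto
qed

locale compiled =
  fixes c0 :: com and m B :: nat
  assumes ok: "com_ok m B c0" and B: "0 < B"
begin

definition "control = insert [] (continuations c0 [])"

definition encode :: "com list \<Rightarrow> nat" where
  "encode = (SOME e. bij_betw e control {0..<card control})"

definition decode :: "nat \<Rightarrow> com list" where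
  "decode = inv_into control encode"

lemma finite_control: "finite control"
  by (simp add: control_def finite_continuations)

lemma bij_encode: "bij_betw encode control {0..<card control}"
  unfolding encode_def using ex_bij_betw_finite_nat[OF finite_control] by (rule someI_ex)

lemma decode_encode [simp]: "q \<in> control \<Longrightarrow> decode (encode q) = q"
  unfolding decode_def using bij_encode by (simp add: bij_betw_def)

lemma encode_less [simp]: "q \<in> control \<Longrightarrow> encode q < card control"
  using bij_encode by (auto simp: bij_betw_def)

lemma decode_in [simp]: "i < card control \<Longrightarrow> decode i \<in> control"
  unfolding decode_def using bij_encode by (metis atLeastLessThan_iff bij_betw_def inv_into_into le0)

definition M :: turing_machine where
  "M = \<lparr>tm_tapes = m, tm_states = card control, tm_symbols = B, tm_start = encode [c0],
    tm_halt = encode [], tm_delta = \<lambda>q a ss. case next_step (decode q) a ss of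
      (q', r) \<Rightarrow> (encode q', r)\<rparr>"

lemma Nil_control [simp]: "[] \<in> control" and start_control [simp]: "[c0] \<in> control"
  by (simp_all add: control_def)

lemma next_control [simp]: "q \<in> control \<Longrightarrow> fst (next_step q a ss) \<in> control"
  using continuations_closed[of q c0 "[]"] by (auto simp: control_def)

lemma wf_M: "wf_tm M"
  unfolding wf_tm_def
proof (intro conjI allI impI; (elim conjE)?)
  fix q a ss q' mv acts out
  assume q: "q < tm_states M" and ss: "length ss = tm_tapes M" "set ss \<subseteq> {..<tm_symbols M}"
    and \<delta>: "tm_delta M q a ss = (q', mv, acts, out)"
  have q: "decode q \<in> control" using q by (simp add: M_def)
  obtain ks where ks: "next_step (decode q) a ss = (ks, mv, acts, out)" "q' = encode ks"
    using \<delta> by (auto simp: M_def split: prod.splits)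
  then show "q' < tm_states M"
    using next_control[OF q, of a ss] by (simp add: M_def)
  have "\<forall>c \<in> set (decode q). com_ok m B c"
    using q continuations_ok[OF _ ok, of _ "[]"] by (auto simp: control_def)
  from next_step_acts[OF this _ ks(1)] ss
  show "length acts = tm_tapes M" "fst ` set acts \<subseteq> {..<tm_symbols M}"
    by (auto simp: M_def)
qed (use B in \<open>simp_all add: M_def\<close>)

fun config :: "com list \<Rightarrow> memory \<Rightarrow> tm_config" where
  "config q (p, T, P, out) = \<lparr>cf_state = encode q, cf_input_pos = p,
    cf_work = map (\<lambda>i. (T i, P i)) [0..<m], cf_output = out\<rparr>"

definition heads_le :: "nat \<Rightarrow> tm_config \<Rightarrow> bool" where
  "heads_le b cf \<longleftrightarrow> (\<forall>(_, p) \<in> set (cf_work cf). p \<le> b)"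

lemma heads_le_config: "bounded b \<mu> \<Longrightarrow> heads_le b (config q \<mu>)"
  by (cases \<mu>) (auto simp: bounded_def heads_le_def)

lemma encode_eq_Nil: "q \<in> control \<Longrightarrow> encode q = encode [] \<longleftrightarrow> q = []"
  by (metis Nil_control decode_encode)

definition next_memory :: "bool list \<Rightarrow> memory \<Rightarrow> head_move \<Rightarrow> (nat \<times> head_move) list \<Rightarrow>
    bool option \<Rightarrow> memory" where
  "next_memory w \<mu> mv acts out = (case \<mu> of (p, T, P, os) \<Rightarrow>
    (min (length w + 1) (move_head mv p), \<lambda>i. (T i)(P i := fst (acts ! i)),
     \<lambda>i. move_head (snd (acts ! i)) (P i), os @ (case out of None \<Rightarrow> [] | Some b \<Rightarrow> [b])))"

lemma map2_nths: "length ys = n \<Longrightarrow> map2 f (map g [0..<n]) ys = map (\<lambda>i. f (g i) (ys ! i)) [0..<n]"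
  by (rule nth_equalityI) auto

lemma tm_step_config:
  assumes "q \<in> control" "q \<noteq> []"
    and "next_step q (input_symbol_at w (fst \<mu>)) (map (\<lambda>i. fst (snd \<mu>) i (fst (snd (snd \<mu>)) i)) [0..<m])
      = (q', mv, acts, out)" "length acts = m"
  shows "tm_step M w (config q \<mu>) = config q' (next_memory w \<mu> mv acts out)"
proof -
  obtain p T P os where \<mu>: "\<mu> = (p, T, P, os)" by (cases \<mu>) auto
  show ?thesis
    using assms encode_eq_Nil[OF assms(1)]
    by (simp add: \<mu> tm_step_def M_def comp_def next_memory_def map2_nths case_prod_beta)
qed

text \<open>A space bound concerns every intermediate configuration, hence it is carried along with
  the run and not just imposed on its endpoints.\<close>

definition steps :: "bool list \<Rightarrow> nat \<Rightarrow> tm_config \<Rightarrow> tm_config \<Rightarrow> bool" where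
  "steps w b x y \<longleftrightarrow> (\<exists>t. (tm_step M w ^^ t) x = y \<and> (\<forall>t' \<le> t. heads_le b ((tm_step M w ^^ t') x)))"

lemma steps_trans: "steps w b x y \<Longrightarrow> steps w b y z \<Longrightarrow> steps w b x z"
  unfolding steps_def
proof (elim exE conjE)
  fix t u
  assume t: "(tm_step M w ^^ t) x = y" "\<forall>t' \<le> t. heads_le b ((tm_step M w ^^ t') x)"
    and u: "(tm_step M w ^^ u) y = z" "\<forall>t' \<le> u. heads_le b ((tm_step M w ^^ t') y)"
  have eq: "(tm_step M w ^^ (t' + t)) x = (tm_step M w ^^ t') y" for t'
    using t(1) by (simp add: funpow_add)
  have "heads_le b ((tm_step M w ^^ t') x)" if "t' \<le> u + t" for t'
  proof (cases "t' \<le> t")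
    case False
    then show ?thesis using eq[of "t' - t"] u(2) that by auto
  qed (use t in blast)
  then show "\<exists>t. (tm_step M w ^^ t) x = z \<and> (\<forall>t' \<le> t. heads_le b ((tm_step M w ^^ t') x))"
    using eq[of u] u(1) by blast
qed

text \<open>Equality is demanded of the configurations and not of the memories, because for
  \<open>i\<close> beyond the first \<open>m\<close> tapes the term \<open>acts ! i\<close> in
  \<open>next_memory\<close> has no meaning.\<close>

lemma steps_single:
  assumes "q \<in> control" "q \<noteq> []"
    and "next_step q (input_symbol_at w (fst \<mu>)) (map (\<lambda>i. fst (snd \<mu>) i (fst (snd (snd \<mu>)) i)) [0..<m])
      = (q', mv, acts, out)" "length acts = m"
    and "config q' (next_memory w \<mu> mv acts out) = config q' \<mu>'" "bounded b \<mu>" "bounded b \<mu>'"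
  shows "steps w b (config q \<mu>) (config q' \<mu>')"
  unfolding steps_def
  using tm_step_config[OF assms(1-4)] heads_le_config[OF assms(6)] heads_le_config[OF assms(7)] assms(5)
  by (intro exI[of _ 1]) (auto simp: le_Suc_eq)

lemma next_memory_idle:
  assumes "fst \<mu> \<le> length w + 1"
  shows "config q (next_memory w \<mu> Stay (idle (map (\<lambda>i. fst (snd \<mu>) i (fst (snd (snd \<mu>)) i)) [0..<m])) None)
    = config q \<mu>"
  using assms by (cases \<mu>) (simp add: next_memory_def idle_def)

lemma length_idle [simp]: "length (idle ss) = length ss"
  by (simp add: idle_def)

lemma holds_test_symbols:
  assumes "\<forall>r s Q. t = TestTapes r s Q \<longrightarrow> r < m \<and> s < m"
  shows "test_symbols t (input_symbol_at w (fst \<mu>)) (map (\<lambda>i. fst (snd \<mu>) i (fst (snd (snd \<mu>)) i)) [0..<m])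
    = holds w t \<mu>"
  using assms by (cases \<mu>; cases t) auto

lemma exec_input_pos: "exec w b c \<mu> \<mu>' \<Longrightarrow> fst \<mu> \<le> length w + 1 \<Longrightarrow> fst \<mu>' \<le> length w + 1"
proof (induction rule: exec.induct)
  case (exec_Tape X f \<mu>)
  then show ?case by (cases \<mu>) auto
qed auto

abbreviation scanned :: "memory \<Rightarrow> nat list" where
  "scanned \<mu> \<equiv> map (\<lambda>i. fst (snd \<mu>) i (fst (snd (snd \<mu>)) i)) [0..<m]"

lemma steps_idle:
  assumes "q \<in> control" "q \<noteq> []" "bounded b \<mu>" "fst \<mu> \<le> length w + 1"
    and "next_step q (input_symbol_at w (fst \<mu>)) (scanned \<mu>) = (q', Stay, idle (scanned \<mu>), None)"
  shows "steps w b (config q \<mu>) (config q' \<mu>)"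
  by (rule steps_single[OF assms(1,2,5)]) (simp_all only: length_idle length_map length_upt
      diff_zero next_memory_idle assms)

text \<open>The list \<open>ks\<close> must be arbitrary in the induction: the first half of a
  sequence runs with the second half pushed on it, and a loop body with the loop itself.\<close>

lemma exec_steps:
  assumes "exec w b c \<mu> \<mu>'" "continuations c ks \<subseteq> control" "com_ok m B c" "ks \<in> control"
    and "bounded b \<mu>" "fst \<mu> \<le> length w + 1"
  shows "steps w b (config (c # ks) \<mu>) (config ks \<mu>')"
  using assms
proof (induction arbitrary: ks rule: exec.induct)
  case (exec_Tape X f \<mu>)
  obtain p T P os where \<mu>: "\<mu> = (p, T, P, os)" by (cases \<mu>) auto
  show ?case
    by (rule steps_single[OF _ _ next_step.simps(2)])
      (use exec_Tape in \<open>auto simp: \<mu> next_memory_def\<close>)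
next
  case (exec_Input mv p r)
  obtain T P os where r: "r = (T, P, os)" by (cases r) auto
  show ?case
    by (rule steps_single[OF _ _ next_step.simps(3)])
      (use exec_Input in \<open>auto simp: r next_memory_def idle_def bounded_def\<close>)
next
  case (exec_Output x p T P out)
  show ?case
    by (rule steps_single[OF _ _ next_step.simps(4)])
      (use exec_Output in \<open>auto simp: next_memory_def idle_def bounded_def\<close>)
next
  case (exec_Seq c1 \<mu> \<mu>' c2 \<mu>'')
  have "steps w b (config (Seq c1 c2 # ks) \<mu>) (config (c1 # c2 # ks) \<mu>)"
    using exec_Seq.prems by (intro steps_idle) auto
  moreover have "c2 # ks \<in> control" "c1 # c2 # ks \<in> control"
    using exec_Seq.prems by auto
  then have "steps w b (config (c1 # c2 # ks) \<mu>) (config (c2 # ks) \<mu>')"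
    using exec_Seq.prems by (intro exec_Seq.IH) auto
  moreover have "steps w b (config (c2 # ks) \<mu>') (config ks \<mu>'')"
    using exec_Seq.prems exec_bounded[OF exec_Seq.hyps(1)] exec_input_pos[OF exec_Seq.hyps(1)]
    by (intro exec_Seq.IH) auto
  ultimately show ?case using steps_trans by blast
next
  case (exec_Cond t \<mu> c1 c2 \<mu>')
  let ?c = "if holds w t \<mu> then c1 else c2"
  have "steps w b (config (Cond t c1 c2 # ks) \<mu>) (config (?c # ks) \<mu>)"
    using exec_Cond.prems holds_test_symbols[of t w \<mu>] by (intro steps_idle) auto
  moreover have "steps w b (config (?c # ks) \<mu>) (config ks \<mu>')"
    using exec_Cond.prems by (intro exec_Cond.IH) auto
  ultimately show ?case using steps_trans by blast
next
  case (exec_WhileF t \<mu> c)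
  then show ?case
    using holds_test_symbols[of t w \<mu>] by (intro steps_idle) auto
next
  case (exec_WhileT t \<mu> c \<mu>' \<mu>'')
  have "steps w b (config (While t c # ks) \<mu>) (config (c # While t c # ks) \<mu>)"
    using exec_WhileT.prems exec_WhileT.hyps(1) holds_test_symbols[of t w \<mu>]
    by (intro steps_idle) auto
  moreover have "steps w b (config (c # While t c # ks) \<mu>) (config (While t c # ks) \<mu>')"
    using exec_WhileT.prems by (intro exec_WhileT.IH) auto
  moreover have "steps w b (config (While t c # ks) \<mu>') (config ks \<mu>'')"
    using exec_WhileT.prems exec_bounded[OF exec_WhileT.hyps(2)] exec_input_pos[OF exec_WhileT.hyps(2)]
    by (intro exec_WhileT.IH) auto
  ultimately show ?case using steps_trans by blast
qed

lemma run_M: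
  assumes "exec w b c0 (0, \<lambda>_ _. 0, \<lambda>_. 0, []) (p, T, P, out)"
  shows "\<exists>t. cf_state (tm_run M w t) = tm_halt M \<and> cf_output (tm_run M w t) = out"
    and "heads_le b (tm_run M w t)"
proof -
  have init: "tm_init M = config [c0] (0, \<lambda>_ _. 0, \<lambda>_. 0, [])"
    by (simp add: tm_init_def M_def map_replicate_const)
  have "steps w b (config [c0] (0, \<lambda>_ _. 0, \<lambda>_. 0, [])) (config [] (p, T, P, out))"
    by (rule exec_steps[OF assms]) (auto simp: control_def bounded_def ok)
  then obtain t0 where t0: "tm_run M w t0 = config [] (p, T, P, out)"
    and hb: "\<forall>t \<le> t0. heads_le b (tm_run M w t)"
    unfolding steps_def tm_run_def init by blast
  show "\<exists>t. cf_state (tm_run M w t) = tm_halt M \<and> cf_output (tm_run M w t) = out"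
    using t0 by (intro exI[of _ t0]) (simp add: M_def)
  \<comment> \<open>A halted machine no longer changes, so the bound up to time \<open>t0\<close>
    holds at all times.\<close>
  have "tm_run M w (t + t0) = tm_run M w t0" for t
  proof (induction t)
    case (Suc t)
    have "tm_run M w (Suc t + t0) = tm_step M w (tm_run M w (t + t0))"
      by (simp add: tm_run_def)
    also have "\<dots> = tm_run M w t0"
      unfolding Suc t0 by (simp add: tm_step_def M_def)
    finally show ?case .
  qed simp
  from this[of "t - t0"] hb show "heads_le b (tm_run M w t)"
    by (cases "t \<le> t0") auto
qed

end

theorem logspace_computable_exec:
  assumes "com_ok m B c" "0 < B"
    and "\<And>w. \<exists>b p T P. exec w b c (0, \<lambda>_ _. 0, \<lambda>_. 0, []) (p, T, P, F w) \<and>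
      real b \<le> C * log 2 (real (length w) + 2)"
  shows "logspace_computable F"
proof -
  interpret compiled c m B
    using assms by unfold_locales
  show ?thesis
    unfolding logspace_computable_def
  proof (intro exI[of _ M] conjI exI[of _ C] allI wf_M)
    fix w
    show "\<exists>t. cf_state (tm_run M w t) = tm_halt M \<and> cf_output (tm_run M w t) = F w"
      using assms(3)[of w] run_M(1) by blast
    fix t
    obtain b p T P where b: "exec w b c (0, \<lambda>_ _. 0, \<lambda>_. 0, []) (p, T, P, F w)"
      "real b \<le> C * log 2 (real (length w) + 2)" using assms(3)[of w] by blast
    have "\<forall>(_, p) \<in> set (cf_work (tm_run M w t)). p \<le> b"
      using run_M(2)[OF b(1), of t] by (simp add: heads_le_def)
    with b(2) show "\<forall>(_, p) \<in> set (cf_work (tm_run M w t)). real p \<le> C * log 2 (real (length w) + 2)"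
      by fastforce
  qed
qed

section \<open>Registers\<close>

definition heads_at :: "nat set \<Rightarrow> nat \<Rightarrow> nat \<Rightarrow> nat" where
  "heads_at X q i = (if i \<in> X then q else 0)"

text \<open>Here \<open>X\<close> is a singleton for operations on one register and
  \<open>UNIV\<close> for the initial setup, in which all tapes run through the same contents. One
  analysis of \<open>sweep\<close> and \<open>clear\<close> serves both.\<close>

definition over :: "nat set \<Rightarrow> 'a \<Rightarrow> (nat \<Rightarrow> 'a) \<Rightarrow> nat \<Rightarrow> 'a" where
  "over X a f i = (if i \<in> X then a else f i)"

text \<open>
  A tape holding the digits \<open>ds\<close>, least significant digit first: the blank is \<open>0\<close>, the cell at
  position \<open>0\<close> is marked by \<open>1\<close>, and the digit \<open>a\<close> is represented by \<open>a + 2\<close>.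
\<close>

definition tape_of :: "nat list \<Rightarrow> nat \<Rightarrow> nat" where
  "tape_of ds j = (if j = 0 then 1 else if j \<le> length ds then ds ! (j - 1) + 2 else 0)"

definition "move X mv = Tape X (\<lambda>s. (s, mv))"
definition "return_heads X r = While (TestTapes r r (\<lambda>s _. s \<noteq> 1)) (move X MoveLeft)"
definition "skip = Tape {} (\<lambda>s. (s, Stay))"

lemma tape_action_over:
  "tape_action X f (p, over X \<tau> T, heads_at X q, os) =
    (p, over X (\<tau>(q := fst (f (\<tau> q)))) T, heads_at X (move_head (snd (f (\<tau> q))) q), os)"
  by (auto simp: over_def heads_at_def fun_eq_iff)

lemma tape_action_move:
  "tape_action X (\<lambda>s. (s, mv)) (p, T, heads_at X q, os) = (p, T, heads_at X (move_head mv q), os)"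
  by (auto simp: heads_at_def fun_eq_iff)

lemma bounded_heads_at [simp]: "q \<le> b \<Longrightarrow> bounded b (p, T, heads_at X q, os)"
  by (simp add: bounded_def heads_at_def)

lemma heads_at_0 [simp]: "heads_at X 0 = (\<lambda>_. 0)"
  by (auto simp: heads_at_def)

lemma heads_at_apply [simp]: "i \<in> X \<Longrightarrow> heads_at X q i = q"
  by (simp add: heads_at_def)

lemma over_apply [simp]: "i \<in> X \<Longrightarrow> over X a f i = a"
  by (simp add: over_def)

lemma exec_write:
  assumes "f (\<tau> q) = (a, mv)" "move_head mv q \<le> b"
  shows "exec w b (Tape X f) (p, over X \<tau> T, heads_at X q, os)
    (p, over X (\<tau>(q := a)) T, heads_at X (move_head mv q), os)"
  using exec_Tape[of b X f "(p, over X \<tau> T, heads_at X q, os)" w] assms by (simp only: tape_action_over) simp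

lemma exec_move:
  assumes "move_head mv q \<le> b"
  shows "exec w b (move X mv) (p, T, heads_at X q, os) (p, T, heads_at X (move_head mv q), os)"
  using exec_Tape[of b X "\<lambda>s. (s, mv)" "(p, T, heads_at X q, os)" w] assms
  by (simp only: tape_action_move move_def) simp

lemma exec_skip: "bounded b \<mu> \<Longrightarrow> exec w b skip \<mu> \<mu>"
  using exec_Tape[of b "{}" "\<lambda>s. (s, Stay)" \<mu> w] by (cases \<mu>) (simp add: skip_def)

lemma exec_return_heads:
  assumes "r \<in> X" "q \<le> b" "T r = tape_of ds"
  shows "exec w b (return_heads X r) (p, T, heads_at X q, os) (p, T, \<lambda>_. 0, os)"
  using assms(2)
proof (induction q)
  case 0
  show ?case
    unfolding return_heads_def heads_at_0 by (rule exec_WhileF) (simp add: assms tape_of_def)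
next
  case (Suc q)
  show ?case
    unfolding return_heads_def
  proof (rule exec_WhileT)
    show "holds w (TestTapes r r (\<lambda>s _. s \<noteq> 1)) (p, T, heads_at X (Suc q), os)"
      using assms by (simp add: tape_of_def)
    show "exec w b (move X MoveLeft) (p, T, heads_at X (Suc q), os) (p, T, heads_at X q, os)"
      using exec_move[of MoveLeft "Suc q"] Suc by simp
  qed (use Suc in \<open>simp add: return_heads_def\<close>)
qed

text \<open>If \<open>ds\<close> is empty, the write hits the first blank cell and lengthens the
  numeral; \<open>tl\<close> covers this case together with the replacement of a digit.\<close>

lemma tape_of_update:
  "(tape_of (xs @ ds))(Suc (length xs) := a + 2) = tape_of (xs @ a # tl ds)"
  by (cases ds) (auto simp: tape_of_def fun_eq_iff nth_append nth_Cons')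

lemma tape_of_at: "tape_of (xs @ d # ds) (Suc (length xs)) = d + 2"
  by (simp add: tape_of_def)

lemma tape_of_end: "tape_of ds (Suc (length ds)) = 0"
  by (simp add: tape_of_def)

text \<open>The symbol \<open>2\<close> is the digit \<open>0\<close>. Stopping at the blank clears
  a numeral, and stopping at the first digit that is not maximal propagates a carry.\<close>

definition "sweep X r Q = While (TestTapes r r (\<lambda>s _. Q s)) (Tape X (\<lambda>_. (2, MoveRight)))"

lemma exec_sweep:
  assumes "r \<in> X" "length xs + length ds + length es < b" "\<forall>d \<in> set ds. Q (d + 2)"
    and "if es = [] then \<not> Q 0 else \<not> Q (hd es + 2)"
  shows "exec w b (sweep X r Q) (p, over X (tape_of (xs @ ds @ es)) T, heads_at X (Suc (length xs)), os)
    (p, over X (tape_of (xs @ replicate (length ds) 0 @ es)) T, heads_at X (Suc (length xs + length ds)), os)"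
  using assms(2,3)
proof (induction ds arbitrary: xs)
  case Nil
  have "\<not> Q (tape_of (xs @ es) (Suc (length xs)))"
    using assms(4) tape_of_end[of xs] by (cases es) (auto simp: tape_of_at)
  then show ?case
    unfolding sweep_def by (simp add: exec_WhileF assms)
next
  case (Cons d ds)
  let ?\<tau> = "tape_of (xs @ (d # ds) @ es)"
  have "exec w b (Tape X (\<lambda>_. (2, MoveRight))) (p, over X ?\<tau> T, heads_at X (Suc (length xs)), os)
      (p, over X (tape_of ((xs @ [0]) @ ds @ es)) T, heads_at X (Suc (length (xs @ [0]))), os)"
    using exec_write[of "\<lambda>_. (2, MoveRight)" ?\<tau> "Suc (length xs)" 2 MoveRight b]
      tape_of_update[of xs "d # ds @ es" 0] Cons.prems
    by (simp add: numeral_2_eq_2)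
  moreover have "exec w b (sweep X r Q)
      (p, over X (tape_of ((xs @ [0]) @ ds @ es)) T, heads_at X (Suc (length (xs @ [0]))), os)
      (p, over X (tape_of (xs @ replicate (length (d # ds)) 0 @ es)) T,
        heads_at X (Suc (length xs + length (d # ds))), os)"
    using Cons.IH[of "xs @ [0]"] Cons.prems by simp
  ultimately show ?case
    unfolding sweep_def
    by (rule exec_WhileT[rotated]) (use assms(1) Cons.prems in \<open>simp add: tape_of_at\<close>)
qed

definition "clear X r = Seq (move X MoveRight) (Seq (sweep X r (\<lambda>s. s \<noteq> 0)) (return_heads X r))"

lemma exec_clear:
  assumes "r \<in> X" "length ds < b"
  shows "exec w b (clear X r) (p, over X (tape_of ds) T, \<lambda>_. 0, os)
    (p, over X (tape_of (replicate (length ds) 0)) T, \<lambda>_. 0, os)"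
  unfolding clear_def
proof (intro exec_Seq)
  show "exec w b (move X MoveRight) (p, over X (tape_of ds) T, \<lambda>_. 0, os)
      (p, over X (tape_of ds) T, heads_at X (Suc 0), os)"
    using exec_move[of MoveRight 0 b w X p _ os] assms by simp
  show "exec w b (sweep X r (\<lambda>s. s \<noteq> 0)) (p, over X (tape_of ds) T, heads_at X (Suc 0), os)
      (p, over X (tape_of (replicate (length ds) 0)) T, heads_at X (Suc (length ds)), os)"
    using exec_sweep[of r X "[]" ds "[]" b "\<lambda>s. s \<noteq> 0"] assms by simp
  show "exec w b (return_heads X r)
      (p, over X (tape_of (replicate (length ds) 0)) T, heads_at X (Suc (length ds)), os)
      (p, over X (tape_of (replicate (length ds) 0)) T, \<lambda>_. 0, os)"
    using assms by (intro exec_return_heads) auto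
qed

section \<open>Successor and comparison of numerals of fixed width\<close>

fun digs :: "nat \<Rightarrow> nat \<Rightarrow> nat \<Rightarrow> nat list" where
  "digs b 0 v = []"
| "digs b (Suc L) v = (v mod b) # digs b L (v div b)"

lemma length_digs [simp]: "length (digs b L v) = L"
  by (induction L arbitrary: v) auto

lemma digs_0: "digs b L 0 = replicate L 0"
  by (induction L) auto

lemma digs_inject: "u < b ^ L \<Longrightarrow> v < b ^ L \<Longrightarrow> digs b L u = digs b L v \<longleftrightarrow> u = v"
proof (induction L arbitrary: u v)
  case (Suc L)
  have "u div b < b ^ L" "v div b < b ^ L"
    using Suc.prems by (simp_all add: less_mult_imp_div_less mult.commute)
  then have "digs b (Suc L) u = digs b (Suc L) v \<longleftrightarrow> u mod b = v mod b \<and> u div b = v div b"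
    using Suc.IH by simp
  then show ?case by (metis mult_div_mod_eq)
qed simp

text \<open>Since \<open>Suc v < b ^ L\<close>, not all digits are maximal, so the carry is absorbed
  within the width \<open>L\<close>.\<close>

lemma digs_Suc:
  assumes "Suc v < b ^ L" "2 \<le> b"
  shows "\<exists>n d ds. digs b L v = replicate n (b - 1) @ d # ds \<and> d < b - 1 \<and>
    digs b L (Suc v) = replicate n 0 @ Suc d # ds"
  using assms(1)
proof (induction L arbitrary: v)
  case (Suc L)
  show ?case
  proof (cases "v mod b = b - 1")
    case True
    then have "Suc v mod b = 0" "Suc v div b = Suc (v div b)"
      using assms(2) by (simp_all add: mod_Suc div_Suc)
    moreover have "Suc (v div b) < b ^ L"
      using Suc.prems \<open>Suc v div b = Suc (v div b)\<close>
      by (metis less_mult_imp_div_less mult.commute power_Suc)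
    then obtain n d ds where "digs b L (v div b) = replicate n (b - 1) @ d # ds" "d < b - 1"
      "digs b L (Suc (v div b)) = replicate n 0 @ Suc d # ds"
      using Suc.IH by blast
    ultimately show ?thesis
      using True by (intro exI[of _ "Suc n"] exI[of _ d] exI[of _ ds]) simp
  next
    case False
    then have "v mod b < b - 1"
      using assms(2) pos_mod_bound[of "int b"] mod_less_divisor[of b v] by linarith
    moreover from this have "Suc v mod b = Suc (v mod b)" "Suc v div b = v div b"
      using assms(2) by (simp_all add: mod_Suc div_Suc)
    ultimately show ?thesis
      by (intro exI[of _ 0] exI[of _ "v mod b"] exI[of _ "digs b L (v div b)"]) simp
  qed
qed simp

text \<open>As digits are shifted by two, the maximal digit is the symbol \<open>b + 1\<close>. The
  guard \<open>s < b + 1\<close> holds whenever the register does not overflow; its purpose is that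
  the action maps the alphabet of \<open>b + 2\<close> symbols into itself for every
  argument.\<close>

definition "inc b r = Seq (move {r} MoveRight) (Seq (sweep {r} r (\<lambda>s. s = b - 1 + 2))
  (Seq (Tape {r} (\<lambda>s. (if s < b + 1 then s + 1 else s, MoveLeft))) (return_heads {r} r)))"

text \<open>Both heads advance together and stop at the first difference or at the blank. All
  numerals have the same width, so the head on \<open>r\<close> sees a blank exactly if the two
  registers agree.\<close>

definition "compare r s = Seq (move {r, s} MoveRight)
  (While (TestTapes r s (\<lambda>x y. x = y \<and> x \<noteq> 0)) (move {r, s} MoveRight))"

definition "if_eq r s c1 c2 = Seq (compare r s) (Cond (TestTapes r r (\<lambda>x _. x = 0))
  (Seq (return_heads {r, s} r) c1) (Seq (return_heads {r, s} r) c2))"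

text \<open>The result of a comparison is stored only in the positions of the heads. The test is
  therefore evaluated with displaced heads; the body first brings them home and ends with a new
  comparison.\<close>

definition "while_neq r s c = Seq (compare r s)
  (Seq (While (TestTapes r r (\<lambda>x _. x \<noteq> 0)) (Seq (return_heads {r, s} r) (Seq c (compare r s))))
    (return_heads {r, s} r))"

definition "home = While (TestInput (\<lambda>a. a \<noteq> LeftEnd)) (Input MoveLeft)"

lemma exec_home: "p \<le> length w + 1 \<Longrightarrow> exec w b home (p, T, P, os) (0, T, P, os)"
proof (induction p)
  case 0
  show ?case
    unfolding home_def by (rule exec_WhileF) (simp add: input_symbol_at_def)
next
  case (Suc p)
  have "exec w b (Input MoveLeft) (Suc p, T, P, os) (p, T, P, os)"
    using exec_Input[of w b MoveLeft "Suc p" "(T, P, os)"] Suc.prems by (simp add: min_def)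
  moreover have "exec w b home (p, T, P, os) (0, T, P, os)"
    using Suc by simp
  ultimately show ?case
    unfolding home_def by (rule exec_WhileT[rotated]) (simp add: input_symbol_at_def)
qed

type_synonym rstate = "nat \<times> (nat \<Rightarrow> nat) \<times> bool list"

locale register_machine =
  fixes w :: "bool list" and b L :: nat
  assumes b: "2 \<le> b"
begin

fun represent :: "rstate \<Rightarrow> memory" where
  "represent (p, R, os) = (p, \<lambda>i. tape_of (digs b L (R i)), \<lambda>_. 0, os)"

definition rexec :: "com \<Rightarrow> rstate \<Rightarrow> rstate \<Rightarrow> bool" where
  "rexec c \<sigma> \<sigma>' \<longleftrightarrow> exec w (L + 1) c (represent \<sigma>) (represent \<sigma>')"

lemma over_tape_of:
  "over {r} (tape_of (digs b L v)) (\<lambda>i. tape_of (digs b L (R i))) = (\<lambda>i. tape_of (digs b L ((R(r := v)) i)))"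
  by (auto simp: over_def fun_eq_iff)

lemma rexec_Seq: "rexec c1 \<sigma> \<sigma>' \<Longrightarrow> rexec c2 \<sigma>' \<sigma>'' \<Longrightarrow> rexec (Seq c1 c2) \<sigma> \<sigma>''"
  unfolding rexec_def by (rule exec_Seq)

lemma rexec_skip: "rexec skip \<sigma> \<sigma>"
  unfolding rexec_def by (rule exec_skip) (cases \<sigma>, simp add: bounded_def)

lemma rexec_clear: "rexec (clear {r} r) (p, R, os) (p, R(r := 0), os)"
  using exec_clear[of r "{r}" "digs b L (R r)" "L + 1" w p "\<lambda>i. tape_of (digs b L (R i))" os]
  unfolding rexec_def by (simp add: over_tape_of flip: digs_0[of b])

lemma rexec_inc:
  assumes "Suc (R r) < b ^ L"
  shows "rexec (inc b r) (p, R, os) (p, R(r := Suc (R r)), os)"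
proof -
  obtain n d ds where ds: "digs b L (R r) = replicate n (b - 1) @ d # ds" "d < b - 1"
    "digs b L (Suc (R r)) = replicate n 0 @ Suc d # ds"
    using digs_Suc[OF assms b] by blast
  have L: "L = n + Suc (length ds)"
    using length_digs[of b L "R r"] ds(1) by simp
  let ?T = "\<lambda>i. tape_of (digs b L (R i))"
  have T: "?T = over {r} (tape_of (replicate n (b - 1) @ d # ds)) ?T"
    by (auto simp: over_def fun_eq_iff ds(1))
  have "exec w (L + 1) (inc b r) (p, ?T, \<lambda>_. 0, os)
      (p, over {r} (tape_of (replicate n 0 @ Suc d # ds)) ?T, \<lambda>_. 0, os)"
    unfolding inc_def
  proof (intro exec_Seq)
    show "exec w (L + 1) (move {r} MoveRight) (p, ?T, \<lambda>_. 0, os)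
        (p, over {r} (tape_of (replicate n (b - 1) @ d # ds)) ?T, heads_at {r} (Suc 0), os)"
      using exec_move[of MoveRight 0 "L + 1" w "{r}" p ?T os] T by simp
    show "exec w (L + 1) (sweep {r} r (\<lambda>s. s = b - 1 + 2))
        (p, over {r} (tape_of (replicate n (b - 1) @ d # ds)) ?T, heads_at {r} (Suc 0), os)
        (p, over {r} (tape_of (replicate n 0 @ d # ds)) ?T, heads_at {r} (Suc n), os)"
      using exec_sweep[of r "{r}" "[]" "replicate n (b - 1)" "d # ds" "L + 1" "\<lambda>s. s = b - 1 + 2"] ds(2) L
      by simp
    have *: "(tape_of (replicate n 0 @ d # ds))(Suc n := Suc (Suc (Suc d))) = tape_of (replicate n 0 @ Suc d # ds)"
      using tape_of_update[of "replicate n 0" "d # ds" "Suc d"] by simp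
    have **: "tape_of (replicate n 0 @ d # ds) (Suc n) = Suc (Suc d)"
      using tape_of_at[of "replicate n 0" d ds] by simp
    show "exec w (L + 1) (Tape {r} (\<lambda>s. (if s < b + 1 then s + 1 else s, MoveLeft)))
        (p, over {r} (tape_of (replicate n 0 @ d # ds)) ?T, heads_at {r} (Suc n), os)
        (p, over {r} (tape_of (replicate n 0 @ Suc d # ds)) ?T, heads_at {r} n, os)"
      using exec_write[of "\<lambda>s. (if s < b + 1 then s + 1 else s, MoveLeft)" "tape_of (replicate n 0 @ d # ds)"
          "Suc n" "Suc (Suc (Suc d))" MoveLeft "L + 1" w "{r}" p ?T os] ds(2) L
      by (simp add: * ** del: fun_upd_apply)
    show "exec w (L + 1) (return_heads {r} r)
        (p, over {r} (tape_of (replicate n 0 @ Suc d # ds)) ?T, heads_at {r} n, os)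
        (p, over {r} (tape_of (replicate n 0 @ Suc d # ds)) ?T, \<lambda>_. 0, os)"
      by (rule exec_return_heads) (use L in auto)
  qed
  then show ?thesis
    unfolding rexec_def represent.simps ds(3)[symmetric] over_tape_of .
qed

lemma exec_compare:
  assumes "R r < b ^ L" "R s < b ^ L"
  defines "T \<equiv> \<lambda>i. tape_of (digs b L (R i))"
  shows "\<exists>q \<le> L + 1. exec w (L + 1) (compare r s) (p, T, \<lambda>_. 0, os) (p, T, heads_at {r, s} q, os) \<and>
    (T r q = 0 \<longleftrightarrow> R r = R s)"
proof -
  let ?W = "While (TestTapes r s (\<lambda>x y. x = y \<and> x \<noteq> 0)) (move {r, s} MoveRight)"
  let ?xs = "digs b L (R r)" and ?ys = "digs b L (R s)"
  \<comment> \<open>The comparison is generalised to a start at any position before which all digits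
    agree, and the induction is on the distance to the blank.\<close>
  have key: "\<exists>q' \<le> L + 1. exec w (L + 1) ?W (p, T, heads_at {r, s} q, os) (p, T, heads_at {r, s} q', os) \<and>
      (T r q' = 0 \<longleftrightarrow> ?xs = ?ys)"
    if "q \<le> L + 1" "1 \<le> q" "\<forall>j < q - 1. ?xs ! j = ?ys ! j" for q
    using that
  proof (induction "L + 1 - q" arbitrary: q)
    case 0
    then have q: "q = L + 1" by simp
    have "?xs = ?ys" using 0 by (auto intro: nth_equalityI)
    moreover have "T r q = 0" by (simp add: T_def tape_of_def q)
    moreover have "exec w (L + 1) ?W (p, T, heads_at {r, s} q, os) (p, T, heads_at {r, s} q, os)"
      by (rule exec_WhileF) (simp add: \<open>T r q = 0\<close>)
    ultimately show ?case using q by blast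
  next
    case (Suc n)
    have q: "q \<le> L" using Suc by simp
    have nz: "T r q = ?xs ! (q - 1) + 2" "T s q = ?ys ! (q - 1) + 2"
      using q Suc.prems by (auto simp: T_def tape_of_def)
    show ?case
    proof (cases "?xs ! (q - 1) = ?ys ! (q - 1)")
      case True
      have "\<forall>j < Suc q - 1. ?xs ! j = ?ys ! j"
      proof (intro allI impI)
        fix j assume "j < Suc q - 1"
        then have "j < q - 1 \<or> j = q - 1" by linarith
        then show "?xs ! j = ?ys ! j" using Suc.prems(3) True by auto
      qed
      then obtain q' where q': "q' \<le> L + 1" "T r q' = 0 \<longleftrightarrow> ?xs = ?ys"
        "exec w (L + 1) ?W (p, T, heads_at {r, s} (Suc q), os) (p, T, heads_at {r, s} q', os)"
      proof -
        have "n = L + 1 - Suc q" "Suc q \<le> L + 1" "1 \<le> Suc q" using Suc.hyps(2) q by auto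
        from Suc.hyps(1)[OF this \<open>\<forall>j < Suc q - 1. ?xs ! j = ?ys ! j\<close>] show ?thesis
          by (elim exE conjE) (rule that)
      qed
      have "exec w (L + 1) ?W (p, T, heads_at {r, s} q, os) (p, T, heads_at {r, s} q', os)"
      proof (rule exec_WhileT[OF _ _ q'(3)])
        show "exec w (L + 1) (move {r, s} MoveRight) (p, T, heads_at {r, s} q, os) (p, T, heads_at {r, s} (Suc q), os)"
          using exec_move[of MoveRight q "L + 1"] q by simp
      qed (use True nz in simp)
      then show ?thesis by (intro exI[of _ q'] conjI q')
    next
      case False
      then have "?xs \<noteq> ?ys" by auto
      moreover have "exec w (L + 1) ?W (p, T, heads_at {r, s} q, os) (p, T, heads_at {r, s} q, os)"
        by (rule exec_WhileF) (use False nz in simp)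
      ultimately show ?thesis using q nz by (intro exI[of _ q]) auto
    qed
  qed
  have "\<forall>j < 1 - 1. ?xs ! j = ?ys ! j" by simp
  from key[OF le_add2 order_refl this] obtain q where q: "q \<le> L + 1" "T r q = 0 \<longleftrightarrow> ?xs = ?ys"
    "exec w (L + 1) ?W (p, T, heads_at {r, s} 1, os) (p, T, heads_at {r, s} q, os)"
    by (elim exE conjE) (rule that)
  have "exec w (L + 1) (move {r, s} MoveRight) (p, T, \<lambda>_. 0, os) (p, T, heads_at {r, s} 1, os)"
    using exec_move[of MoveRight 0 "L + 1" w "{r, s}" p T os] by simp
  from exec_Seq[OF this q(3)] show ?thesis
    unfolding compare_def using q(1,2) digs_inject[OF assms(1,2)] by (intro exI[of _ q]) simp
qed

lemma rexec_if_eq: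
  assumes "R r < b ^ L" "R s < b ^ L" "rexec (if R r = R s then c1 else c2) (p, R, os) \<sigma>"
  shows "rexec (if_eq r s c1 c2) (p, R, os) \<sigma>"
proof -
  let ?T = "\<lambda>i. tape_of (digs b L (R i))"
  obtain q where q: "q \<le> L + 1" "?T r q = 0 \<longleftrightarrow> R r = R s"
    "exec w (L + 1) (compare r s) (p, ?T, \<lambda>_. 0, os) (p, ?T, heads_at {r, s} q, os)"
    using exec_compare[of R r s p os, OF assms(1,2)] by (elim exE conjE) (rule that)
  have "exec w (L + 1) (return_heads {r, s} r) (p, ?T, heads_at {r, s} q, os) (p, ?T, \<lambda>_. 0, os)"
    by (rule exec_return_heads) (use q in auto)
  then have "exec w (L + 1) (Seq (return_heads {r, s} r) (if R r = R s then c1 else c2))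
      (p, ?T, heads_at {r, s} q, os) (represent \<sigma>)"
    using assms(3) unfolding rexec_def by (auto intro: exec_Seq)
  then show ?thesis
    unfolding rexec_def if_eq_def represent.simps
    by (intro exec_Seq[OF q(3)] exec_Cond) (use q(2) in \<open>auto split: if_splits\<close>)
qed

text \<open>The states before the successive rounds are given as a sequence of known length
  \<open>n\<close>, which yields termination and the final state together.\<close>

lemma rexec_while_neq:
  assumes "\<And>j. j < n \<Longrightarrow> rexec c (p j, R j, os j) (p (Suc j), R (Suc j), os (Suc j))"
    and "\<And>j. j < n \<Longrightarrow> R j r \<noteq> R j s" "R n r = R n s"
    and "\<And>j. j \<le> n \<Longrightarrow> R j r < b ^ L \<and> R j s < b ^ L"
  shows "rexec (while_neq r s c) (p 0, R 0, os 0) (p n, R n, os n)"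
proof -
  let ?T = "\<lambda>j i. tape_of (digs b L (R j i))"
  let ?W = "While (TestTapes r r (\<lambda>x _. x \<noteq> 0)) (Seq (return_heads {r, s} r) (Seq c (compare r s)))"
  let ?Q = "\<lambda>j q. q \<le> L + 1 \<and>
      exec w (L + 1) (compare r s) (p j, ?T j, \<lambda>_. 0, os j) (p j, ?T j, heads_at {r, s} q, os j) \<and>
      (?T j r q = 0 \<longleftrightarrow> R j r = R j s)"
  define q where "q j = (SOME q. ?Q j q)" for j

  have Q: "?Q j (q j)" if "j \<le> n" for j
  proof -
    have "R j r < b ^ L" "R j s < b ^ L" using assms(4)[OF that] by simp_all
    from someI_ex[OF exec_compare[of "R j" r s "p j" "os j", OF this]] show ?thesis
      unfolding q_def .
  qed
  note q = Q[THEN conjunct1] Q[THEN conjunct2, THEN conjunct1] Q[THEN conjunct2, THEN conjunct2]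
  have ret: "exec w (L + 1) (return_heads {r, s} r) (p j, ?T j, heads_at {r, s} (q j), os j) (p j, ?T j, \<lambda>_. 0, os j)"
    if "j \<le> n" for j
    by (rule exec_return_heads[OF _ q(1)[OF that] refl]) simp
  have "exec w (L + 1) ?W (p j, ?T j, heads_at {r, s} (q j), os j) (p n, ?T n, heads_at {r, s} (q n), os n)"
    if "j \<le> n" for j
    using that
  proof (induction rule: inc_induct)
    case base
    show ?case
      by (rule exec_WhileF) (use q(3)[of n] assms(3) in simp)
  next
    case (step j)
    have le: "j \<le> n" "Suc j \<le> n" "j < n" using step.hyps by simp_all
    have c: "exec w (L + 1) c (p j, ?T j, \<lambda>_. 0, os j) (p (Suc j), ?T (Suc j), \<lambda>_. 0, os (Suc j))"
      using assms(1)[OF le(3)] unfolding rexec_def represent.simps .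
    have body: "exec w (L + 1) (Seq (return_heads {r, s} r) (Seq c (compare r s)))
        (p j, ?T j, heads_at {r, s} (q j), os j) (p (Suc j), ?T (Suc j), heads_at {r, s} (q (Suc j)), os (Suc j))"
      by (rule exec_Seq[OF ret[OF le(1)] exec_Seq[OF c q(2)[OF le(2)]]])
    have "holds w (TestTapes r r (\<lambda>x _. x \<noteq> 0)) (p j, ?T j, heads_at {r, s} (q j), os j)"
      using q(3)[OF le(1)] assms(2)[OF le(3)] by simp
    then show ?case by (rule exec_WhileT[OF _ body step.IH])
  qed
  from exec_Seq[OF q(2)[OF le0] exec_Seq[OF this[OF le0] ret[OF order_refl]]] show ?thesis
    unfolding rexec_def while_neq_def represent.simps .
qed

lemma rexec_Input: "rexec (Input mv) (p, R, os) (min (length w + 1) (move_head mv p), R, os)"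
  unfolding rexec_def represent.simps by (rule exec_Input)

lemma rexec_Output: "rexec (Output x) (p, R, os) (p, R, os @ [x])"
  unfolding rexec_def represent.simps by (rule exec_Output)

lemma rexec_Cond_input:
  assumes "rexec (if Q (input_symbol_at w p) then c1 else c2) (p, R, os) \<sigma>"
  shows "rexec (Cond (TestInput Q) c1 c2) (p, R, os) \<sigma>"
  using assms unfolding rexec_def represent.simps by (intro exec_Cond) simp

lemma rexec_While_input_False:
  assumes "\<not> Q (input_symbol_at w p)"
  shows "rexec (While (TestInput Q) c) (p, R, os) (p, R, os)"
  using assms unfolding rexec_def represent.simps by (intro exec_WhileF) simp

lemma rexec_While_input_True:
  assumes "Q (input_symbol_at w p)" "rexec c (p, R, os) \<sigma>" "rexec (While (TestInput Q) c) \<sigma> \<sigma>'"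
  shows "rexec (While (TestInput Q) c) (p, R, os) \<sigma>'"
  using assms(2,3) unfolding rexec_def represent.simps
  by (rule exec_WhileT[rotated]) (simp add: assms(1))

lemma rexec_home: "p \<le> length w + 1 \<Longrightarrow> rexec home (p, R, os) (0, R, os)"
  unfolding rexec_def represent.simps by (rule exec_home)

end

section \<open>Arithmetic expressions in logarithmic space\<close>

text \<open>A binary successor on all tapes: the symbol \<open>3\<close> is the digit
  \<open>1\<close>. In contrast to \<open>inc\<close> it may write on a blank cell, and this is how
  the width of the registers comes about.\<close>

definition "grow = Seq (move UNIV MoveRight) (Seq (sweep UNIV 0 (\<lambda>s. s = 3))
  (Seq (Tape UNIV (\<lambda>_. (3, MoveLeft))) (return_heads UNIV 0)))"

text \<open>All tapes count the input positions in binary, which fixes their common width.\<close>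

definition "setup_tapes = Seq (Tape UNIV (\<lambda>_. (1, Stay))) (Seq grow
  (Seq (While (TestInput (\<lambda>a. a \<noteq> RightEnd)) (Seq (Input MoveRight) grow))
  (Seq home (clear UNIV 0))))"

definition bits :: "nat \<Rightarrow> nat list" where
  "bits n = map of_bool (binary_digits n)"

lemma bits_Suc:
  "\<exists>m ds. bits n = replicate m 1 @ ds \<and> (ds = [] \<or> hd ds \<noteq> 1) \<and>
    bits (Suc n) = replicate m 0 @ 1 # tl ds"
proof (induction n rule: binary_digits.induct)
  case (1 n)
  have step: "bits k = of_bool (odd k) # bits (k div 2)" if "k \<noteq> 0" for k
    using that binary_digits.simps[of k] by (simp add: bits_def)
  have 0: "bits 0 = []" by (simp add: bits_def binary_digits.simps)
  show ?case
  proof (cases "even n")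
    case True
    then have "bits (Suc n) = 1 # bits (n div 2)"
      using step[of "Suc n"] by simp
    moreover have "bits n = [] \<and> n = 0 \<or> bits n = 0 # bits (n div 2)"
      using step[of n] True 0 by auto
    ultimately show ?thesis
      using 0 by (intro exI[of _ 0] exI[of _ "bits n"]) auto
  next
    case False
    then have "n \<noteq> 0" by (auto intro: ccontr)
    from 1[OF this] obtain m ds where "bits (n div 2) = replicate m 1 @ ds" "ds = [] \<or> hd ds \<noteq> 1"
      "bits (Suc (n div 2)) = replicate m 0 @ 1 # tl ds" by blast
    then show ?thesis
      using step[of n] step[of "Suc n"] False \<open>n \<noteq> 0\<close>
      by (intro exI[of _ "Suc m"] exI[of _ ds]) simp
  qed
qed

abbreviation (input) counting :: "nat \<Rightarrow> nat \<Rightarrow> bool list \<Rightarrow> memory" where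
  "counting p n os \<equiv> (p, \<lambda>_. tape_of (bits n), \<lambda>_. 0, os)"

lemma exec_grow:
  assumes "length (bits (Suc n)) < b"
  shows "exec w b grow (counting p n os)
    (counting p (Suc n) os)"
proof -
  obtain m ds where ds: "bits n = replicate m 1 @ ds" "ds = [] \<or> hd ds \<noteq> 1"
    "bits (Suc n) = replicate m 0 @ 1 # tl ds"
    using bits_Suc by blast
  have b: "m + length ds < b" "Suc m < b"
    using assms ds(3) by (cases ds; simp)+
  have UNIV: "over UNIV \<tau> T = (\<lambda>_. \<tau>)" for \<tau> and T :: "nat \<Rightarrow> nat \<Rightarrow> nat"
    by (simp add: over_def fun_eq_iff)
  have sw: "if ds = [] then (0::nat) \<noteq> 3 else hd ds + 2 \<noteq> 3"
    using ds(2) by auto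
  show ?thesis
    unfolding grow_def
  proof (intro exec_Seq)
    show "exec w b (move UNIV MoveRight) (counting p n os)
        (p, \<lambda>_. tape_of (bits n), heads_at UNIV 1, os)"
      using exec_move[of MoveRight 0 b w UNIV p _ os] b by simp
    show "exec w b (sweep UNIV 0 (\<lambda>s. s = 3)) (p, \<lambda>_. tape_of (bits n), heads_at UNIV 1, os)
        (p, \<lambda>_. tape_of (replicate m 0 @ ds), heads_at UNIV (Suc m), os)"
      using exec_sweep[of 0 UNIV "[]" "replicate m 1" ds b "\<lambda>s. s = 3" w p _ os] b ds sw by (simp add: UNIV)
    show "exec w b (Tape UNIV (\<lambda>_. (3, MoveLeft)))
        (p, \<lambda>_. tape_of (replicate m 0 @ ds), heads_at UNIV (Suc m), os)
        (p, \<lambda>_. tape_of (bits (Suc n)), heads_at UNIV m, os)"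
      using exec_write[of "\<lambda>_. (3, MoveLeft)" "tape_of (replicate m 0 @ ds)" "Suc m" 3 MoveLeft b w UNIV p _ os]
        tape_of_update[of "replicate m 0" ds 1] b ds(3)
      by (simp add: UNIV numeral_3_eq_3)
    show "exec w b (return_heads UNIV 0) (p, \<lambda>_. tape_of (bits (Suc n)), heads_at UNIV m, os)
        (counting p (Suc n) os)"
      using b by (intro exec_return_heads) auto
  qed
qed

lemma length_bits_mono: "m \<le> n \<Longrightarrow> length (bits m) \<le> length (bits n)"
proof (induction n)
  case (Suc n)
  have "length (bits n) \<le> length (bits (Suc n))"
    using bits_Suc[of n] by (auto simp: le_diff_conv Suc_diff_le)
  then show ?case using Suc by (cases "m = Suc n") auto
qed simp

lemma less_power_length_bits: "n < 2 ^ length (bits n)"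
proof (induction n rule: binary_digits.induct)
  case (1 n)
  show ?case
  proof (cases "n = 0")
    case False
    then have "length (bits n) = Suc (length (bits (n div 2)))"
      using binary_digits.simps[of n] by (simp add: bits_def)
    then show ?thesis using 1[OF False] by simp
  qed simp
qed

lemma power_length_bits_le: "n \<noteq> 0 \<Longrightarrow> 2 ^ length (bits n) \<le> 2 * n"
proof (induction n rule: binary_digits.induct)
  case (1 n)
  have len: "length (bits n) = Suc (length (bits (n div 2)))"
    using 1 binary_digits.simps[of n] by (simp add: bits_def)
  show ?case
  proof (cases "n div 2 = 0")
    case True
    then show ?thesis using 1 len by (simp add: bits_def binary_digits.simps)
  next
    case False
    have "2 ^ length (bits n) \<le> 2 * (2 * (n div 2))"
      using 1(1)[OF 1(2) False] len by simp
    then show ?thesis by linarith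
  qed
qed

lemma exec_setup_tapes:
  assumes "L = length (bits (length w + 2))"
  shows "exec w (L + 1) setup_tapes (0, \<lambda>_ _. 0, \<lambda>_. 0, [])
    (0, \<lambda>_. tape_of (replicate L 0), \<lambda>_. 0, [])"
proof -
  have grow: "exec w (L + 1) grow (counting p n [])
      (counting p (Suc n) [])" if "n \<le> length w + 1" for n p
    using that length_bits_mono[of "Suc n" "length w + 2"] assms by (intro exec_grow) simp
  let ?W = "While (TestInput (\<lambda>a. a \<noteq> RightEnd)) (Seq (Input MoveRight) grow)"
  \<comment> \<open>The \<open>grow\<close> before the loop accounts for position \<open>0\<close>,
    so the counter is one ahead of the input head and ends at \<open>length w + 2\<close>.\<close>
  have loop: "exec w (L + 1) ?W (counting p (Suc p) [])
      (counting (length w + 1) (length w + 2) [])" if "p \<le> length w + 1" for p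
    using that
  proof (induction rule: inc_induct)
    case base
    show ?case
      using exec_WhileF[of w "TestInput (\<lambda>a. a \<noteq> RightEnd)"] by (simp add: input_symbol_at_def)
  next
    case (step p)
    have "exec w (L + 1) (Input MoveRight) (counting p (Suc p) [])
        (counting (Suc p) (Suc p) [])"
      using exec_Input[of w "L + 1" MoveRight p "(\<lambda>_. tape_of (bits (Suc p)), \<lambda>_. 0, [])"] step.hyps
      by (simp add: min_absorb2)
    from exec_Seq[OF this grow] step.hyps
    have "exec w (L + 1) (Seq (Input MoveRight) grow) (counting p (Suc p) [])
        (counting (Suc p) (Suc (Suc p)) [])" by simp
    from exec_WhileT[OF _ this step.IH] show ?case
      using step.hyps by (simp add: input_symbol_at_def)
  qed
  have UNIV: "over UNIV \<tau> T = (\<lambda>_. \<tau>)" for \<tau> and T :: "nat \<Rightarrow> nat \<Rightarrow> nat"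
    by (simp add: over_def fun_eq_iff)
  have bits0: "bits 0 = []" by (simp add: bits_def binary_digits.simps)
  show ?thesis
    unfolding setup_tapes_def
  proof (intro exec_Seq)
    show "exec w (L + 1) (Tape UNIV (\<lambda>_. (1, Stay))) (0, \<lambda>_ _. 0, \<lambda>_. 0, [])
        (counting 0 0 [])"
    proof -
      have "(\<lambda>_. 0)(0 := 1) = tape_of []" by (auto simp: tape_of_def fun_eq_iff)
      then show ?thesis
        using exec_write[of "\<lambda>_. (1, Stay)" "\<lambda>_. 0" 0 1 Stay "L + 1" w UNIV 0 "\<lambda>_ _. 0" "[]"]
        by (simp add: UNIV bits0)
    qed
    show "exec w (L + 1) grow (counting 0 0 []) (counting 0 (Suc 0) [])"
      by (rule grow) simp
    show "exec w (L + 1) ?W (counting 0 (Suc 0) [])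
      (counting (length w + 1) (length w + 2) [])"
      by (rule loop) simp
    show "exec w (L + 1) home (counting (length w + 1) (length w + 2) [])
      (counting 0 (length w + 2) [])"
      by (rule exec_home) simp
    show "exec w (L + 1) (clear UNIV 0) (counting 0 (length w + 2) [])
      (0, \<lambda>_. tape_of (replicate L 0), \<lambda>_. 0, [])"
      using exec_clear[of 0 UNIV "bits (length w + 2)" "L + 1" w 0 _ "[]"] assms by (simp add: UNIV)
  qed
qed

datatype exp = Const nat | Var nat | Add exp exp | Eq exp exp | Sum nat exp exp
  | Iter nat nat exp exp exp | At exp input_symbol | Len

text \<open>The cap \<open>c\<close> in \<open>Iter x l n c e\<close> keeps all values polynomial in the input length.\<close>

fun eval :: "bool list \<Rightarrow> (nat \<Rightarrow> nat) \<Rightarrow> exp \<Rightarrow> nat" where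
  "eval w env (Const n) = n"
| "eval w env (Var v) = env v"
| "eval w env (Add a b) = eval w env a + eval w env b"
| "eval w env (Eq a b) = of_bool (eval w env a = eval w env b)"
| "eval w env (Sum v a b) = (\<Sum>x < eval w env a. eval w (env(v := x)) b)"
| "eval w env (Iter x l n c e) =
    rec_nat 0 (\<lambda>i a. min (eval w env c) (eval w (env(x := a, l := i)) e)) (eval w env n)"
| "eval w env (At a y) = of_bool (input_symbol_at w (eval w env a) = y)"
| "eval w env Len = length w + 1"

text \<open>Values are at most \<open>ub w ^ deg g e\<close> if the variables are at most
  \<open>ub w ^ g\<close>. A constant \<open>n\<close> gets degree \<open>n\<close> because
  \<open>n \<le> 2 ^ n\<close> and \<open>ub w\<close> is at least \<open>2\<close>. The degree does
  not depend on \<open>w\<close>, so the base of the registers can be fixed before the input is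
  known.\<close>

fun deg :: "nat \<Rightarrow> exp \<Rightarrow> nat" where
  "deg g (Const n) = n"
| "deg g (Var v) = g"
| "deg g (Add a b) = Suc (max (deg g a) (deg g b))"
| "deg g (Eq a b) = max (deg g a) (deg g b)"
| "deg g (Sum v a b) = deg g a + deg (max g (deg g a)) b"
| "deg g (Iter x l n c e) =
    max (max (deg g n) (deg g c)) (deg (max g (max (deg g n) (deg g c))) e)"
| "deg g (At a y) = deg g a"
| "deg g Len = 1"

definition ub :: "bool list \<Rightarrow> nat" where
  "ub w = length w + 2"

lemma ub_ge [simp]: "1 \<le> ub w" "Suc 0 \<le> ub w" "2 \<le> ub w" "0 < ub w"
  by (simp_all add: ub_def)

lemma power_max: "1 \<le> u \<Longrightarrow> u ^ max a b = max (u ^ a) ((u::nat) ^ b)"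
  by (cases a b rule: le_cases) (simp_all add: max.absorb1 max.absorb2 power_increasing)

lemma power_ub_max: "x \<le> ub w ^ max a b \<longleftrightarrow> x \<le> ub w ^ a \<or> x \<le> ub w ^ b"
  by (simp add: power_max le_max_iff_disj)

lemma one_le_power_ub: "Suc 0 \<le> ub w ^ n"
  using one_le_power[of "ub w" n] by simp

lemma rec_nat_le: "rec_nat 0 (\<lambda>i a. min c (f i a)) n \<le> (c::nat)"
  by (cases n) auto

lemma eval_le: "(\<And>v. env v \<le> ub w ^ g) \<Longrightarrow> eval w env e \<le> ub w ^ deg g e"
proof (induction e arbitrary: env g)
  case (Const n)
  have "n \<le> 2 ^ n" by (rule less_imp_le[OF less_exp])
  also have "\<dots> \<le> ub w ^ n" by (rule power_mono) auto
  finally show ?case by simp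
next
  case (Add a b)
  have "eval w env a \<le> ub w ^ max (deg g a) (deg g b)"
    "eval w env b \<le> ub w ^ max (deg g a) (deg g b)"
    using Add by (auto simp: power_ub_max)
  then have "eval w env (Add a b) \<le> 2 * ub w ^ max (deg g a) (deg g b)" by simp
  also have "\<dots> \<le> ub w * ub w ^ max (deg g a) (deg g b)"
    by (rule mult_right_mono) auto
  finally show ?case by simp
next
  case (Eq a b)
  show ?case using one_le_power_ub[of w "deg g (Eq a b)"] by simp
next
  case (Sum v a b)
  have a: "eval w env a \<le> ub w ^ deg g a" using Sum by blast
  have b: "eval w (env(v := x)) b \<le> ub w ^ deg (max g (deg g a)) b" if "x < eval w env a" for x
  proof (rule Sum.IH(2))
    fix u
    have "x \<le> ub w ^ deg g a" using a that by linarith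
    then show "(env(v := x)) u \<le> ub w ^ max g (deg g a)"
      using Sum.prems[of u] by (auto simp: power_ub_max)
  qed
  have "eval w env (Sum v a b) \<le> (\<Sum>x < eval w env a. ub w ^ deg (max g (deg g a)) b)"
    unfolding eval.simps by (rule sum_mono) (simp add: b)
  also have "\<dots> \<le> ub w ^ deg g a * ub w ^ deg (max g (deg g a)) b"
    using a by simp
  finally show ?case by (simp add: power_add)
next
  case (Iter x l n c e)
  have "eval w env c \<le> ub w ^ deg g c" using Iter by blast
  then have "eval w env (Iter x l n c e) \<le> ub w ^ deg g c"
    unfolding eval.simps by (rule order.trans[OF rec_nat_le])
  then show ?case by (auto simp: power_ub_max)
next
  case (At a y)
  show ?case using one_le_power_ub[of w "deg g (At a y)"] by simp
next
  case Len
  show ?case by (simp add: ub_def)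
qed simp

definition "for_loop b i s c = Seq (while_neq i s (Seq c (inc b i))) (clear {i} i)"

fun repeat :: "nat \<Rightarrow> com \<Rightarrow> com" where
  "repeat 0 c = skip"
| "repeat (Suc n) c = Seq c (repeat n c)"

text \<open>
  \<open>compile b loc t s e\<close> adds the value of \<open>e\<close> to the register \<open>t\<close>. The variable \<open>v\<close> is stored
  in the register \<open>loc v\<close>, and the registers from \<open>s\<close> on are free; they contain \<open>0\<close> before and after.
\<close>

fun compile :: "nat \<Rightarrow> (nat \<Rightarrow> nat) \<Rightarrow> nat \<Rightarrow> nat \<Rightarrow> exp \<Rightarrow> com" where
  "compile b loc t s (Const n) = repeat n (inc b t)"
| "compile b loc t s (Var v) = for_loop b s (loc v) (inc b t)"
| "compile b loc t s (Add a1 a2) = Seq (compile b loc t s a1) (compile b loc t s a2)"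
| "compile b loc t s (Eq a1 a2) =
    Seq (compile b loc s (s + 2) a1) (Seq (compile b loc (s + 1) (s + 2) a2)
    (Seq (if_eq s (s + 1) (inc b t) skip) (Seq (clear {s} s) (clear {s + 1} (s + 1)))))"
| "compile b loc t s (Sum v a e) =
    Seq (compile b loc s (s + 2) a)
    (Seq (for_loop b (s + 1) s (compile b (loc(v := s + 1)) t (s + 2) e)) (clear {s} s))"
| "compile b loc t s (Iter x l n c e) =
    Seq (compile b loc s (s + 6) n) (Seq (compile b loc (s + 1) (s + 6) c)
    (Seq (for_loop b (s + 2) s (Seq (compile b (loc(x := s + 3, l := s + 2)) (s + 4) (s + 6) e)
      (Seq (clear {s + 3} (s + 3))
      (Seq (for_loop b (s + 5) (s + 4) (if_eq (s + 3) (s + 1) skip (inc b (s + 3)))) (clear {s + 4} (s + 4))))))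
    (Seq (for_loop b (s + 4) (s + 3) (inc b t))
    (Seq (clear {s} s) (Seq (clear {s + 1} (s + 1)) (clear {s + 3} (s + 3)))))))"
| "compile b loc t s (At a y) =
    Seq (compile b loc s (s + 2) a) (Seq (for_loop b (s + 1) s (Input MoveRight))
    (Seq (Cond (TestInput (\<lambda>z. z = y)) (inc b t) skip) (Seq home (clear {s} s))))"
| "compile b loc t s Len =
    Seq (While (TestInput (\<lambda>a. a \<noteq> RightEnd)) (Seq (Input MoveRight) (inc b t))) home"

context register_machine
begin

lemma rexec_eq: "rexec c \<sigma> \<sigma>'' \<Longrightarrow> \<sigma>'' = \<sigma>' \<Longrightarrow> rexec c \<sigma> \<sigma>'"
  by simp

lemma rexec_for_loop:
  assumes "\<And>j. j < n \<Longrightarrow> rexec c (p j, (R j)(i := j), os j) (p (Suc j), (R (Suc j))(i := j), os (Suc j))"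
    and "\<And>j. j \<le> n \<Longrightarrow> R j s = n" "\<And>j. j \<le> n \<Longrightarrow> R j i = 0" "i \<noteq> s" "n < b ^ L"
  shows "rexec (for_loop b i s c) (p 0, R 0, os 0) (p n, R n, os n)"
proof -
  have *: "rexec (Seq c (inc b i)) (p j, (R j)(i := j), os j)
      (p (Suc j), (R (Suc j))(i := Suc j), os (Suc j))" if "j < n" for j
    by (rule rexec_eq[OF rexec_Seq[OF assms(1)[OF that] rexec_inc]]) (use that assms(5) in simp_all)
  have "rexec (while_neq i s (Seq c (inc b i))) (p 0, (R 0)(i := 0), os 0) (p n, (R n)(i := n), os n)"
    by (rule rexec_while_neq[where R = "\<lambda>j. (R j)(i := j)"]) (use * assms in auto)
  from rexec_Seq[OF this rexec_clear[where r = i]] show ?thesis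
    unfolding for_loop_def using assms(3)[of 0] assms(3)[of n] by (simp add: fun_upd_idem)
qed

lemma rexec_add:
  assumes "R i = 0" "i \<noteq> r" "i \<noteq> t" "r \<noteq> t" "R t + R r < b ^ L"
  shows "rexec (for_loop b i r (inc b t)) (p, R, os) (p, R(t := R t + R r), os)"
proof -
  have "rexec (inc b t) (p, R(t := R t + j, i := j), os) (p, R(t := R t + Suc j, i := j), os)"
    if "j < R r" for j
    using rexec_inc[of "R(t := R t + j, i := j)" t p os] that assms by (simp add: fun_upd_twist)
  then show ?thesis
    using rexec_for_loop[of "R r" "inc b t" "\<lambda>_. p" "\<lambda>j. R(t := R t + j)" i "\<lambda>_. os" r] assms
    by simp
qed

lemma rexec_repeat_inc:
  "R t + n < b ^ L \<Longrightarrow> rexec (repeat n (inc b t)) (p, R, os) (p, R(t := R t + n), os)"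
proof (induction n arbitrary: R)
  case 0
  then show ?case using rexec_skip by simp
next
  case (Suc n)
  have "rexec (inc b t) (p, R, os) (p, R(t := Suc (R t)), os)"
    using Suc.prems by (intro rexec_inc) simp
  show ?case
    unfolding repeat.simps
    by (rule rexec_eq, rule rexec_Seq[OF \<open>rexec (inc b t) (p, R, os) _\<close> Suc.IH])
      (use Suc.prems in \<open>auto simp: fun_eq_iff\<close>)
qed

text \<open>The minimum is found by counting up to \<open>R r\<close>: each round increments
  \<open>x\<close>, except when \<open>x\<close> has already reached the cap.\<close>

lemma rexec_cap:
  assumes "R i = 0" "R x = 0" "i \<noteq> x" "i \<noteq> r" "i \<noteq> c" "x \<noteq> r" "x \<noteq> c" "R r < b ^ L" "R c < b ^ L"
  shows "rexec (for_loop b i r (if_eq x c skip (inc b x))) (p, R, os) (p, R(x := min (R c) (R r)), os)"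
proof -
  let ?R = "\<lambda>j. R(x := min (R c) j)"
  have "rexec (if_eq x c skip (inc b x)) (p, (?R j)(i := j), os) (p, (?R (Suc j))(i := j), os)"
    if j: "j < R r" for j
  proof (rule rexec_if_eq)
    have x: "((?R j)(i := j)) x = min (R c) j" and c: "((?R j)(i := j)) c = R c"
      using assms by simp_all
    show "((?R j)(i := j)) x < b ^ L" "((?R j)(i := j)) c < b ^ L"
      unfolding x c using assms by simp_all
    show "rexec (if ((?R j)(i := j)) x = ((?R j)(i := j)) c then skip else inc b x)
        (p, (?R j)(i := j), os) (p, (?R (Suc j))(i := j), os)"
    proof (cases "R c \<le> j")
      case True
      then have "min (R c) j = R c" "min (R c) (Suc j) = R c" by simp_all
      then show ?thesis unfolding x c using rexec_skip by simp
    next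
      case False
      then have m: "min (R c) j = j" "min (R c) (Suc j) = Suc j" by simp_all
      have "rexec (inc b x) (p, (?R j)(i := j), os) (p, (?R (Suc j))(i := j), os)"
        by (rule rexec_eq, rule rexec_inc, unfold x m) (use assms False in \<open>auto simp: fun_eq_iff\<close>)
      then show ?thesis unfolding x c m using False assms by simp
    qed
  qed
  then have "rexec (for_loop b i r (if_eq x c skip (inc b x))) (p, ?R 0, os) (p, ?R (R r), os)"
    by (rule rexec_for_loop[where p = "\<lambda>_. p" and os = "\<lambda>_. os" and R = ?R]) (use assms in auto)
  then show ?thesis using assms by (simp add: fun_upd_idem)
qed

lemma rexec_len:
  assumes "R t + length w + 1 < b ^ L"
  shows "rexec (While (TestInput (\<lambda>a. a \<noteq> RightEnd)) (Seq (Input MoveRight) (inc b t)))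
    (0, R, os) (length w + 1, R(t := R t + length w + 1), os)"
proof -
  let ?W = "While (TestInput (\<lambda>a. a \<noteq> RightEnd)) (Seq (Input MoveRight) (inc b t))"
  have "rexec ?W (p, R(t := R t + p), os) (length w + 1, R(t := R t + (length w + 1)), os)"
    if "p \<le> length w + 1" for p
    using that
  proof (induction rule: inc_induct)
    case base
    show ?case by (rule rexec_While_input_False) (simp add: input_symbol_at_def)
  next
    case (step p)
    have "rexec (Input MoveRight) (p, R(t := R t + p), os) (Suc p, R(t := R t + p), os)"
      by (rule rexec_eq[OF rexec_Input]) (use step.hyps in simp)
    moreover have "rexec (inc b t) (Suc p, R(t := R t + p), os) (Suc p, R(t := R t + Suc p), os)"
      using rexec_inc[of "R(t := R t + p)" t] step.hyps assms by simp
    ultimately have "rexec (Seq (Input MoveRight) (inc b t)) (p, R(t := R t + p), os) (Suc p, R(t := R t + Suc p), os)"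
      by (rule rexec_Seq)
    show ?case
      by (rule rexec_While_input_True[OF _ \<open>rexec (Seq _ _) _ _\<close> step.IH])
        (use step.hyps in \<open>simp add: input_symbol_at_def\<close>)
  qed
  from this[of 0] show ?thesis by simp
qed

lemma rexec_moves:
  assumes "R i = 0" "i \<noteq> s" "R s < b ^ L"
  shows "rexec (for_loop b i s (Input MoveRight)) (0, R, os) (min (length w + 1) (R s), R, os)"
proof -
  have "rexec (Input MoveRight) (min (length w + 1) j, R(i := j), os)
      (min (length w + 1) (Suc j), R(i := j), os)" for j
    by (rule rexec_eq[OF rexec_Input]) (simp add: min_def)
  then show ?thesis
    using rexec_for_loop[of "R s" "Input MoveRight" "min (length w + 1)" "\<lambda>_. R" i "\<lambda>_. os" s] assms
    by simp
qed

lemma input_symbol_at_min: "input_symbol_at w (min (length w + 1) p) = input_symbol_at w p"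
  by (simp add: input_symbol_at_def min_def)

lemma less_of_power_le: "ub w ^ n < b ^ L \<Longrightarrow> x \<le> ub w ^ m \<Longrightarrow> m \<le> n \<Longrightarrow> x < b ^ L"
proof -
  assume "ub w ^ n < b ^ L" "x \<le> ub w ^ m" "m \<le> n"
  moreover from this have "ub w ^ m \<le> ub w ^ n"
    by (intro power_increasing) auto
  ultimately show "x < b ^ L" by linarith
qed

text \<open>The correctness of compilation for \<open>e\<close> enters as an assumption. Thus the
  lemma can be used on the induction hypotheses of \<open>rexec_compile\<close> and, later, on that
  lemma itself. It specialises them to a cleared target register above all variables.\<close>

lemma rexec_free:
  assumes IH: "\<And>R t s g. (\<And>v. R (loc v) \<le> ub w ^ g) \<Longrightarrow> ub w ^ deg g e < b ^ L \<Longrightarrow>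
      R t + eval w (\<lambda>v. R (loc v)) e < b ^ L \<Longrightarrow> t < s \<Longrightarrow> (\<And>v. loc v < s) \<Longrightarrow> (\<And>v. loc v \<noteq> t) \<Longrightarrow>
      (\<And>r. s \<le> r \<Longrightarrow> R r = 0) \<Longrightarrow>
      rexec (compile b loc t s e) (0, R, os) (0, R(t := R t + eval w (\<lambda>v. R (loc v)) e), os)"
    and R: "\<And>v. R (loc v) \<le> ub w ^ g" and deg: "ub w ^ d < b ^ L" "deg g e \<le> d"
    and t: "t < s" "R t = 0" "\<And>v. loc v < t" "\<And>r. s \<le> r \<Longrightarrow> R r = 0"
  shows "rexec (compile b loc t s e) (0, R, os) (0, R(t := eval w (\<lambda>v. R (loc v)) e), os)"
proof -
  have e: "eval w (\<lambda>v. R (loc v)) e < b ^ L"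
    by (rule less_of_power_le[OF deg(1) _ deg(2)], rule eval_le, rule R)
  have d: "ub w ^ deg g e < b ^ L"
    by (rule less_of_power_le[OF deg(1) order_refl deg(2)])
  have "rexec (compile b loc t s e) (0, R, os) (0, R(t := R t + eval w (\<lambda>v. R (loc v)) e), os)"
    by (rule IH[where g = g]) (use R d e t(1,2,4) less_trans[OF t(3) t(1)] less_imp_neq[OF t(3)] in simp_all)
  then show ?thesis using t(2) by simp
qed

lemma rexec_compile:
  assumes "\<And>v. R (loc v) \<le> ub w ^ g" "ub w ^ deg g e < b ^ L"
    and "R t + eval w (\<lambda>v. R (loc v)) e < b ^ L" "t < s"
    and "\<And>v. loc v < s" "\<And>v. loc v \<noteq> t" "\<And>r. s \<le> r \<Longrightarrow> R r = 0"
  shows "rexec (compile b loc t s e) (0, R, os) (0, R(t := R t + eval w (\<lambda>v. R (loc v)) e), os)"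
  using assms
proof (induction e arbitrary: R loc t s g)
  case (Const n)
  show ?case
    unfolding compile.simps eval.simps by (rule rexec_repeat_inc) (use Const in simp)
next
  case (Var v)
  show ?case
    unfolding compile.simps eval.simps
    by (rule rexec_add) (use Var.prems(3,4,7) Var.prems(5)[of v] Var.prems(6)[of v] in auto)
next
  case (Add a1 a2)
  have "rexec (compile b loc t s a1) (0, R, os) (0, R(t := R t + eval w (\<lambda>v. R (loc v)) a1), os)"
    using Add.prems less_of_power_le[OF Add.prems(2), of "ub w ^ deg g a1" "deg g a1"]
    by (intro Add.IH(1)[where g = g]) auto
  moreover let ?R = "R(t := R t + eval w (\<lambda>v. R (loc v)) a1)"
  have env: "(\<lambda>v. ?R (loc v)) = (\<lambda>v. R (loc v))" using Add.prems(6) by auto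
  have "rexec (compile b loc t s a2) (0, ?R, os) (0, ?R(t := ?R t + eval w (\<lambda>v. ?R (loc v)) a2), os)"
    by (rule Add.IH(2)[where g = g], unfold env)
      (use Add.prems less_of_power_le[OF Add.prems(2), of "ub w ^ deg g a2" "deg g a2"] in auto)
  ultimately have "rexec (compile b loc t s (Add a1 a2)) (0, R, os)
      (0, ?R(t := ?R t + eval w (\<lambda>v. R (loc v)) a2), os)"
    unfolding compile.simps env by (rule rexec_Seq)
  then show ?case
    by (rule rexec_eq) (auto simp: fun_eq_iff)
next
  case (Eq a1 a2)
  let ?env = "\<lambda>v. R (loc v)"
  let ?a = "eval w ?env a1" and ?b = "eval w ?env a2"
  have le: "?a < b ^ L" "?b < b ^ L"
    using eval_le[of ?env w g a1] eval_le[of ?env w g a2] Eq.prems(1) less_of_power_le[OF Eq.prems(2)] by auto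
  have loc: "loc v \<noteq> s" "loc v \<noteq> Suc s" "loc v < s + 2" for v
    using Eq.prems(5)[of v] by auto
  let ?R1 = "R(s := ?a)" and ?R2 = "R(s := ?a, s + 1 := ?b)"
  have 1: "rexec (compile b loc s (s + 2) a1) (0, R, os) (0, ?R1, os)"
    by (rule rexec_free[OF Eq.IH(1), where g = g and d = "deg g (Eq a1 a2)"]) (use Eq.prems in auto)
  have env: "(\<lambda>v. ?R1 (loc v)) = ?env" using loc by auto
  have "rexec (compile b loc (s + 1) (s + 2) a2) (0, ?R1, os) (0, ?R1(s + 1 := eval w (\<lambda>v. ?R1 (loc v)) a2), os)"
    by (rule rexec_free[OF Eq.IH(2), where g = g and d = "deg g (Eq a1 a2)"])
      (use Eq.prems loc less_SucI[OF Eq.prems(5)] in auto)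
  then have 2: "rexec (compile b loc (s + 1) (s + 2) a2) (0, ?R1, os) (0, ?R2, os)"
    unfolding env .
  have 3: "rexec (if_eq s (s + 1) (inc b t) skip) (0, ?R2, os)
      (0, ?R2(t := R t + of_bool (?a = ?b)), os)"
  proof (rule rexec_if_eq)
    show "rexec (if ?R2 s = ?R2 (s + 1) then inc b t else skip) (0, ?R2, os)
      (0, ?R2(t := R t + of_bool (?a = ?b)), os)"
      using rexec_inc[of ?R2 t 0 os] rexec_skip[of "(0, ?R2, os)"] Eq.prems(3,4)
      by (auto simp: fun_upd_idem)
  qed (use le in auto)
  show ?case
    unfolding compile.simps
    by (rule rexec_eq, rule rexec_Seq[OF 1], rule rexec_Seq[OF 2], rule rexec_Seq[OF 3],
        rule rexec_Seq[OF rexec_clear], rule rexec_clear) (use Eq.prems in \<open>auto simp: fun_eq_iff\<close>)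
next
  case (Sum v a e)
  let ?env = "\<lambda>v. R (loc v)"
  let ?a = "eval w ?env a"
  have le: "?a \<le> ub w ^ deg g a"
    by (rule eval_le) (rule Sum.prems)
  then have aL: "?a < b ^ L"
    using less_of_power_le[OF Sum.prems(2)] by simp
  have loc: "loc v \<noteq> s" "loc v \<noteq> Suc s" "loc v < s + 2" for v
    using Sum.prems(5)[of v] by auto
  have 1: "rexec (compile b loc s (s + 2) a) (0, R, os) (0, R(s := ?a), os)"
    by (rule rexec_free[OF Sum.IH(1), where g = g and d = "deg g (Sum v a e)"]) (use Sum.prems in auto)
  let ?f = "\<lambda>x. eval w (?env(v := x)) e"
  let ?S = "\<lambda>j. R(s := ?a, t := R t + (\<Sum>x<j. ?f x))"
  let ?loc = "loc(v := s + 1)"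
  have body: "rexec (compile b ?loc t (s + 2) e) (0, (?S j)(s + 1 := j), os) (0, (?S (Suc j))(s + 1 := j), os)"
    if j: "j < ?a" for j
  proof -
    let ?R = "(?S j)(s + 1 := j)"
    have env: "(\<lambda>u. ?R (?loc u)) = ?env(v := j)"
      using loc Sum.prems(6) by (auto simp: fun_eq_iff)
    \<comment> \<open>The summands accumulate directly in \<open>t\<close>, so overflow has to be
      excluded for each partial sum; all are bounded by the full sum.\<close>
    have "(\<Sum>x<Suc j. ?f x) \<le> (\<Sum>x<?a. ?f x)"
      using j by (intro sum_mono2) auto
    then have bnd: "?R t + ?f j < b ^ L"
      using Sum.prems(3,4) by simp
    have "rexec (compile b ?loc t (s + 2) e) (0, ?R, os) (0, ?R(t := ?R t + eval w (\<lambda>u. ?R (?loc u)) e), os)"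
    proof (rule Sum.IH(2)[where g = "max g (deg g a)"])
      show "?R (?loc u) \<le> ub w ^ max g (deg g a)" for u
        using fun_cong[OF env, of u] Sum.prems(1)[of u] le j by (auto simp: power_ub_max)
      show "ub w ^ deg (max g (deg g a)) e < b ^ L"
        using less_of_power_le[OF Sum.prems(2), of _ "deg (max g (deg g a)) e"] by simp
      show "?R t + eval w (\<lambda>u. ?R (?loc u)) e < b ^ L"
        unfolding env by (rule bnd)
    qed (use Sum.prems loc in auto)
    then show ?thesis
      unfolding env by (rule rexec_eq) (use Sum.prems(4) in \<open>auto simp: fun_eq_iff\<close>)
  qed
  have "rexec (for_loop b (s + 1) s (compile b ?loc t (s + 2) e)) (0, ?S 0, os) (0, ?S ?a, os)"
    by (rule rexec_for_loop[where p = "\<lambda>_. 0" and os = "\<lambda>_. os" and R = ?S])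
      (use Sum.prems aL body in auto)
  then have 2: "rexec (for_loop b (s + 1) s (compile b ?loc t (s + 2) e)) (0, R(s := ?a), os) (0, ?S ?a, os)"
    using Sum.prems(4) by (simp add: fun_upd_idem)
  show ?case
    unfolding compile.simps
    by (rule rexec_eq, rule rexec_Seq[OF 1], rule rexec_Seq[OF 2], rule rexec_clear)
      (use Sum.prems in \<open>auto simp: fun_eq_iff\<close>)
next
  case (Iter x l n c e)
  let ?env = "\<lambda>v. R (loc v)"
  let ?n = "eval w ?env n" and ?c = "eval w ?env c"
  have le: "?n \<le> ub w ^ deg g n" "?c \<le> ub w ^ deg g c"
    by (rule eval_le, rule Iter.prems)+
  then have nL: "?n < b ^ L" and cL: "?c < b ^ L"
    using less_of_power_le[OF Iter.prems(2)] by auto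
  have loc: "loc v < s" "loc v \<noteq> s" "loc v \<noteq> Suc s" "loc v < s + 6" for v
    using Iter.prems(5)[of v] by auto
  have 1: "rexec (compile b loc s (s + 6) n) (0, R, os) (0, R(s := ?n), os)"
    by (rule rexec_free[OF Iter.IH(1), where g = g and d = "deg g (Iter x l n c e)"]) (use Iter.prems in auto)
  let ?R1 = "R(s := ?n)" and ?R2 = "R(s := ?n, s + 1 := ?c)"
  have env: "(\<lambda>v. ?R1 (loc v)) = ?env" using loc by auto
  have "rexec (compile b loc (s + 1) (s + 6) c) (0, ?R1, os) (0, ?R1(s + 1 := eval w (\<lambda>v. ?R1 (loc v)) c), os)"
    by (rule rexec_free[OF Iter.IH(2), where g = g and d = "deg g (Iter x l n c e)"])
      (use Iter.prems loc less_SucI[OF Iter.prems(5)] in auto)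
  then have 2: "rexec (compile b loc (s + 1) (s + 6) c) (0, ?R1, os) (0, ?R2, os)"
    unfolding env .
  let ?f = "\<lambda>i a. eval w (?env(x := a, l := i)) e"
  let ?it = "rec_nat 0 (\<lambda>i a. min ?c (?f i a))"
  \<comment> \<open>The register \<open>s\<close> holds the number of rounds, \<open>s + 1\<close>
    the cap, \<open>s + 2\<close> the round counter, \<open>s + 3\<close> the accumulator,
    \<open>s + 4\<close> the new value of \<open>e\<close>, and \<open>s + 5\<close> the counter
    used for copying it back under the cap.\<close>
  let ?S = "\<lambda>j. ?R2(s + 3 := ?it j)"
  let ?loc = "loc(x := s + 3, l := s + 2)"
  let ?g = "max g (max (deg g n) (deg g c))"
  have it: "?it j \<le> ?c" for j by (rule rec_nat_le)
  let ?body = "Seq (compile b ?loc (s + 4) (s + 6) e) (Seq (clear {s + 3} (s + 3))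
      (Seq (for_loop b (s + 5) (s + 4) (if_eq (s + 3) (s + 1) skip (inc b (s + 3)))) (clear {s + 4} (s + 4))))"
  have body: "rexec ?body (0, (?S j)(s + 2 := j), os) (0, (?S (Suc j))(s + 2 := j), os)"
    if j: "j < ?n" for j
  proof -
    let ?R = "(?S j)(s + 2 := j)"
    have env: "(\<lambda>u. ?R (?loc u)) = ?env(x := ?it j, l := j)"
    proof
      fix u show "?R (?loc u) = (?env(x := ?it j, l := j)) u"
        using loc(1)[of u] by auto
    qed
    have bnd: "(?env(x := ?it j, l := j)) u \<le> ub w ^ ?g" for u
    proof -
      have "?it j \<le> ub w ^ deg g c" "j \<le> ub w ^ deg g n"
        using it[of j] le j by linarith+
      then show ?thesis
        using Iter.prems(1)[of u] by (auto simp: power_ub_max)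
    qed
    have "?f j (?it j) \<le> ub w ^ deg ?g e"
      by (rule eval_le) (rule bnd)
    then have fL: "?f j (?it j) < b ^ L"
      by (rule less_of_power_le[OF Iter.prems(2)]) simp
    have "rexec (compile b ?loc (s + 4) (s + 6) e) (0, ?R, os)
        (0, ?R(s + 4 := ?R (s + 4) + eval w (\<lambda>u. ?R (?loc u)) e), os)"
    proof (rule Iter.IH(3)[where g = ?g])
      show "?R (?loc u) \<le> ub w ^ ?g" for u
        using bnd[of u] fun_cong[OF env, of u] by (simp only:)
      show "ub w ^ deg ?g e < b ^ L"
        using less_of_power_le[OF Iter.prems(2), of _ "deg ?g e"] by simp
      show "?R (s + 4) + eval w (\<lambda>u. ?R (?loc u)) e < b ^ L"
        unfolding env using fL Iter.prems(7)[of "s + 4"] by simp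
      show "?loc u < s + 6" "?loc u \<noteq> s + 4" for u
        using loc(1)[of u] by auto
    qed (use Iter.prems in auto)
    then have b1: "rexec (compile b ?loc (s + 4) (s + 6) e) (0, ?R, os) (0, ?R(s + 4 := ?f j (?it j)), os)"
      unfolding env by (rule rexec_eq) (use Iter.prems(7)[of "s + 4"] in simp)
    let ?R3 = "?R(s + 4 := ?f j (?it j), s + 3 := 0)"
    have b3: "rexec (for_loop b (s + 5) (s + 4) (if_eq (s + 3) (s + 1) skip (inc b (s + 3)))) (0, ?R3, os)
        (0, ?R3(s + 3 := min (?R3 (s + 1)) (?R3 (s + 4))), os)"
      by (rule rexec_cap) (use Iter.prems(7) fL cL in auto)
    show ?thesis
      by (rule rexec_eq, rule rexec_Seq[OF b1], rule rexec_Seq[OF rexec_clear], rule rexec_Seq[OF b3],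
          rule rexec_clear) (use Iter.prems(7)[of "s + 4"] in \<open>auto simp: fun_eq_iff\<close>)
  qed
  have "rexec (for_loop b (s + 2) s ?body) (0, ?S 0, os) (0, ?S ?n, os)"
    by (rule rexec_for_loop[where p = "\<lambda>_. 0" and os = "\<lambda>_. os" and R = ?S], rule body)
      (use Iter.prems(7) nL in simp_all)
  moreover have "?S 0 = ?R2"
    using Iter.prems(7)[of "s + 3"] by (auto simp: fun_eq_iff)
  ultimately have 3: "rexec (for_loop b (s + 2) s ?body) (0, ?R2, os) (0, ?S ?n, os)"
    by (simp only:)
  have 4: "rexec (for_loop b (s + 4) (s + 3) (inc b t)) (0, ?S ?n, os)
      (0, (?S ?n)(t := (?S ?n) t + (?S ?n) (s + 3)), os)"
    by (rule rexec_add) (use Iter.prems(3,4,7) in auto)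
  show ?case
    unfolding compile.simps
    by (rule rexec_eq, rule rexec_Seq[OF 1], rule rexec_Seq[OF 2], rule rexec_Seq[OF 3],
        rule rexec_Seq[OF 4], rule rexec_Seq[OF rexec_clear], rule rexec_Seq[OF rexec_clear], rule rexec_clear)
      (use Iter.prems in \<open>auto simp: fun_eq_iff\<close>)
next
  case (At a y)
  let ?env = "\<lambda>v. R (loc v)"
  let ?a = "eval w ?env a"
  have "?a \<le> ub w ^ deg g a"
    by (rule eval_le) (rule At.prems)
  then have aL: "?a < b ^ L"
    using less_of_power_le[OF At.prems(2)] by simp
  have loc: "loc v \<noteq> s" "loc v < s + 2" for v
    using At.prems(5)[of v] by auto
  have 1: "rexec (compile b loc s (s + 2) a) (0, R, os) (0, R(s := ?a), os)"
    by (rule rexec_free[OF At.IH, where g = g and d = "deg g (At a y)"]) (use At.prems in auto)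
  let ?p = "min (length w + 1) ?a"
  have "rexec (for_loop b (s + 1) s (Input MoveRight)) (0, R(s := ?a), os)
      (min (length w + 1) ((R(s := ?a)) s), R(s := ?a), os)"
    by (rule rexec_moves) (use At.prems aL in auto)
  then have 2: "rexec (for_loop b (s + 1) s (Input MoveRight)) (0, R(s := ?a), os) (?p, R(s := ?a), os)"
    by simp
  have 3: "rexec (Cond (TestInput (\<lambda>z. z = y)) (inc b t) skip) (?p, R(s := ?a), os)
      (?p, R(s := ?a, t := R t + eval w ?env (At a y)), os)"
  proof (rule rexec_Cond_input, unfold input_symbol_at_min)
    show "rexec (if input_symbol_at w ?a = y then inc b t else skip) (?p, R(s := ?a), os)
        (?p, R(s := ?a, t := R t + eval w ?env (At a y)), os)"
      using rexec_inc[of "R(s := ?a)" t ?p os] rexec_skip[of "(?p, R(s := ?a), os)"] At.prems(3,4)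
      by (auto simp: fun_upd_idem)
  qed
  show ?case
    unfolding compile.simps
    by (rule rexec_eq, rule rexec_Seq[OF 1], rule rexec_Seq[OF 2], rule rexec_Seq[OF 3],
        rule rexec_Seq[OF rexec_home], simp, rule rexec_clear)
      (use At.prems in \<open>auto simp: fun_eq_iff\<close>)
next
  case Len
  show ?case
    unfolding compile.simps
    by (rule rexec_eq, rule rexec_Seq[OF rexec_len], use Len in simp, rule rexec_home) (auto simp: fun_eq_iff)
qed

end

section \<open>Output by nested bounded loops\<close>

datatype cmd = Emit exp | For nat exp cmd | Then cmd cmd

fun outputs :: "bool list \<Rightarrow> (nat \<Rightarrow> nat) \<Rightarrow> cmd \<Rightarrow> bool list" where
  "outputs w env (Emit e) = [eval w env e \<noteq> 0]"
| "outputs w env (For v e c) = concat (map (\<lambda>x. outputs w (env(v := x)) c) [0..<eval w env e])"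
| "outputs w env (Then c1 c2) = outputs w env c1 @ outputs w env c2"

fun cmd_deg :: "nat \<Rightarrow> cmd \<Rightarrow> nat" where
  "cmd_deg g (Emit e) = deg g e"
| "cmd_deg g (For v e c) = max (deg g e) (cmd_deg (max g (deg g e)) c)"
| "cmd_deg g (Then c1 c2) = max (cmd_deg g c1) (cmd_deg g c2)"

fun compile_cmd :: "nat \<Rightarrow> (nat \<Rightarrow> nat) \<Rightarrow> nat \<Rightarrow> cmd \<Rightarrow> com" where
  "compile_cmd b loc s (Emit e) = Seq (compile b loc s (s + 2) e)
    (Seq (if_eq s (s + 1) (Output False) (Output True)) (clear {s} s))"
| "compile_cmd b loc s (For v e c) = Seq (compile b loc s (s + 2) e)
    (Seq (for_loop b (s + 1) s (compile_cmd b (loc(v := s + 1)) (s + 2) c)) (clear {s} s))"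
| "compile_cmd b loc s (Then c1 c2) = Seq (compile_cmd b loc s c1) (compile_cmd b loc s c2)"

context register_machine
begin

lemma rexec_compile_cmd:
  assumes "\<And>v. R (loc v) \<le> ub w ^ g" "ub w ^ cmd_deg g c < b ^ L"
    and "\<And>v. loc v < s" "\<And>r. s \<le> r \<Longrightarrow> R r = 0"
  shows "rexec (compile_cmd b loc s c) (0, R, os) (0, R, os @ outputs w (\<lambda>v. R (loc v)) c)"
  using assms
proof (induction c arbitrary: R loc s g os)
  case (Emit e)
  let ?env = "\<lambda>v. R (loc v)"
  let ?a = "eval w ?env e"
  have "?a \<le> ub w ^ deg g e"
    by (rule eval_le) (rule Emit.prems)
  then have aL: "?a < b ^ L"
    using less_of_power_le[OF Emit.prems(2)] by simp
  have loc: "loc v \<noteq> s" "loc v < s + 2" for v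
    using Emit.prems(3)[of v] by auto
  have 1: "rexec (compile b loc s (s + 2) e) (0, R, os) (0, R(s := ?a), os)"
    by (rule rexec_free[OF rexec_compile, where g = g and d = "cmd_deg g (Emit e)"]) (use Emit.prems in auto)
  have 2: "rexec (if_eq s (s + 1) (Output False) (Output True)) (0, R(s := ?a), os)
      (0, R(s := ?a), os @ [?a \<noteq> 0])"
    by (rule rexec_if_eq)
      (use aL Emit.prems(4)[of "s + 1"] rexec_Output[of False] rexec_Output[of True] b in auto)
  show ?case
    unfolding compile_cmd.simps
    by (rule rexec_eq, rule rexec_Seq[OF 1], rule rexec_Seq[OF 2], rule rexec_clear)
      (use Emit.prems(4) in \<open>auto simp: fun_eq_iff\<close>)
next
  case (For v e c)
  let ?env = "\<lambda>v. R (loc v)"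
  let ?a = "eval w ?env e"
  have le: "?a \<le> ub w ^ deg g e"
    by (rule eval_le) (rule For.prems)
  then have aL: "?a < b ^ L"
    using less_of_power_le[OF For.prems(2)] by simp
  have loc: "loc v \<noteq> s" "loc v \<noteq> Suc s" "loc v < s + 2" for v
    using For.prems(3)[of v] by auto
  have 1: "rexec (compile b loc s (s + 2) e) (0, R, os) (0, R(s := ?a), os)"
    by (rule rexec_free[OF rexec_compile, where g = g and d = "cmd_deg g (For v e c)"]) (use For.prems in auto)
  let ?loc = "loc(v := s + 1)"
  let ?o = "\<lambda>j. os @ concat (map (\<lambda>x. outputs w (?env(v := x)) c) [0..<j])"
  have body: "rexec (compile_cmd b ?loc (s + 2) c) (0, (R(s := ?a))(s + 1 := j), ?o j)
      (0, (R(s := ?a))(s + 1 := j), ?o (Suc j))" if j: "j < ?a" for j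
  proof -
    let ?R = "R(s := ?a, s + 1 := j)"
    have env: "(\<lambda>u. ?R (?loc u)) = ?env(v := j)"
      using loc by (auto simp: fun_eq_iff)
    have "rexec (compile_cmd b ?loc (s + 2) c) (0, ?R, ?o j) (0, ?R, ?o j @ outputs w (\<lambda>u. ?R (?loc u)) c)"
    proof (rule For.IH[where g = "max g (deg g e)"])
      show "?R (?loc u) \<le> ub w ^ max g (deg g e)" for u
      proof -
        have "j \<le> ub w ^ deg g e" using le j by linarith
        then have "(?env(v := j)) u \<le> ub w ^ max g (deg g e)"
          using For.prems(1)[of u] by (auto simp: power_ub_max)
        then show ?thesis using fun_cong[OF env, of u] by (simp only:)
      qed
      show "ub w ^ cmd_deg (max g (deg g e)) c < b ^ L"
        using less_of_power_le[OF For.prems(2), of _ "cmd_deg (max g (deg g e)) c"] by simp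
    qed (use For.prems loc in auto)
    then show ?thesis unfolding env by simp
  qed
  have "rexec (for_loop b (s + 1) s (compile_cmd b ?loc (s + 2) c)) (0, R(s := ?a), ?o 0) (0, R(s := ?a), ?o ?a)"
    by (rule rexec_for_loop[where p = "\<lambda>_. 0" and os = ?o and R = "\<lambda>_. R(s := ?a)"])
      (use For.prems(4) aL body in auto)
  then have 2: "rexec (for_loop b (s + 1) s (compile_cmd b ?loc (s + 2) c)) (0, R(s := ?a), os) (0, R(s := ?a), ?o ?a)"
    by simp
  show ?case
    unfolding compile_cmd.simps
    by (rule rexec_eq, rule rexec_Seq[OF 1], rule rexec_Seq[OF 2], rule rexec_clear)
      (use For.prems(4) in \<open>auto simp: fun_eq_iff\<close>)
next
  case (Then c1 c2)
  have "ub w ^ cmd_deg g c1 < b ^ L" "ub w ^ cmd_deg g c2 < b ^ L"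
    using less_of_power_le[OF Then.prems(2), of _ "cmd_deg g c1"]
      less_of_power_le[OF Then.prems(2), of _ "cmd_deg g c2"] by auto
  then show ?case
    unfolding compile_cmd.simps
    using rexec_Seq[OF Then.IH(1)[where g = g] Then.IH(2)[where g = g]] Then.prems by simp
qed

end

section \<open>The tape alphabet and the number of tapes of a compiled program\<close>

lemma com_ok_mono: "com_ok m B c \<Longrightarrow> m \<le> m' \<Longrightarrow> com_ok m' B c"
  by (induction c) (auto dest: order.strict_trans2)

lemma test_tapes_bounded: "\<exists>n. \<forall>r s Q. t = TestTapes r s Q \<longrightarrow> r < n \<and> s < n"
proof (cases t)
  case (TestTapes r s Q)
  then show ?thesis by (intro exI[of _ "Suc (max r s)"]) auto
qed simp

text \<open>This is the condition on the alphabet alone. The number of tapes can be chosen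
  afterwards, as a program contains only finitely many tests.\<close>

fun ok_symbols :: "nat \<Rightarrow> com \<Rightarrow> bool" where
  "ok_symbols B (Tape X f) \<longleftrightarrow> (\<forall>s < B. fst (f s) < B)"
| "ok_symbols B (Input _) \<longleftrightarrow> True"
| "ok_symbols B (Output _) \<longleftrightarrow> True"
| "ok_symbols B (Seq c1 c2) \<longleftrightarrow> ok_symbols B c1 \<and> ok_symbols B c2"
| "ok_symbols B (Cond t c1 c2) \<longleftrightarrow> ok_symbols B c1 \<and> ok_symbols B c2"
| "ok_symbols B (While t c) \<longleftrightarrow> ok_symbols B c"

lemma ok_symbols_com_ok: "ok_symbols B c \<Longrightarrow> \<exists>m. com_ok m B c"
proof (induction c)
  case (Seq c1 c2)
  then obtain m1 m2 where "com_ok m1 B c1" "com_ok m2 B c2" by auto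
  then have "com_ok (max m1 m2) B (Seq c1 c2)" by (simp add: com_ok_mono)
  then show ?case ..
next
  case (Cond t c1 c2)
  then obtain m1 m2 where m: "com_ok m1 B c1" "com_ok m2 B c2" by auto
  from test_tapes_bounded[of t] obtain n
    where n: "\<forall>r s Q. t = TestTapes r s Q \<longrightarrow> r < n \<and> s < n" ..
  have "com_ok (max n (max m1 m2)) B (Cond t c1 c2)"
    using n com_ok_mono[OF m(1)] com_ok_mono[OF m(2)] by (simp add: less_max_iff_disj)
  then show ?case ..
next
  case (While t c)
  then obtain m where m: "com_ok m B c" by auto
  from test_tapes_bounded[of t] obtain n
    where n: "\<forall>r s Q. t = TestTapes r s Q \<longrightarrow> r < n \<and> s < n" ..
  have "com_ok (max n m) B (While t c)"
    using n com_ok_mono[OF m] by (simp add: less_max_iff_disj)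
  then show ?case ..
qed auto

lemma ok_symbols_setup: "2 \<le> b \<Longrightarrow> ok_symbols (b + 2) setup_tapes"
  by (auto simp: setup_tapes_def grow_def move_def sweep_def return_heads_def home_def clear_def)

lemma ok_symbols_basic:
  assumes "2 \<le> b"
  shows "ok_symbols (b + 2) skip" "ok_symbols (b + 2) (inc b r)" "ok_symbols (b + 2) (clear X r)"
    "ok_symbols (b + 2) home"
  using assms by (auto simp: skip_def inc_def clear_def home_def move_def sweep_def return_heads_def)

lemma ok_symbols_if_eq: "ok_symbols B (if_eq r s c1 c2) \<longleftrightarrow> ok_symbols B c1 \<and> ok_symbols B c2"
  by (auto simp: if_eq_def compare_def move_def return_heads_def)

lemma ok_symbols_for_loop: "2 \<le> b \<Longrightarrow> ok_symbols (b + 2) (for_loop b r s c) \<longleftrightarrow> ok_symbols (b + 2) c"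
  using ok_symbols_basic
  by (auto simp: for_loop_def while_neq_def compare_def move_def return_heads_def)

lemma ok_symbols_repeat: "ok_symbols B skip \<Longrightarrow> ok_symbols B c \<Longrightarrow> ok_symbols B (repeat n c)"
  by (induction n) auto

lemma ok_symbols_compile: "2 \<le> b \<Longrightarrow> ok_symbols (b + 2) (compile b loc t s e)"
  by (induction e arbitrary: loc t s)
    (simp_all only: compile.simps ok_symbols.simps ok_symbols_basic ok_symbols_if_eq
      ok_symbols_for_loop ok_symbols_repeat simp_thms)

lemma ok_symbols_compile_cmd: "2 \<le> b \<Longrightarrow> ok_symbols (b + 2) (compile_cmd b loc s c)"
  by (induction c arbitrary: loc s)
    (simp_all only: compile_cmd.simps ok_symbols_compile ok_symbols.simps ok_symbols_basic
      ok_symbols_if_eq ok_symbols_for_loop simp_thms)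

theorem logspace_computable_outputs: "logspace_computable (\<lambda>w. outputs w (\<lambda>_. 0) c)"
proof -
  \<comment> \<open>With base \<open>2 ^ C\<close> a register of \<open>L\<close> digits holds all
    numbers below \<open>(2 ^ L) ^ C\<close>, and \<open>2 ^ L\<close> exceeds
    \<open>length w + 2\<close>. The successor makes the base at least \<open>2\<close> even if the
    degree is \<open>0\<close>.\<close>
  define C where "C = Suc (cmd_deg 0 c)"
  define b where "b = (2::nat) ^ C"
  define prog where "prog = Seq setup_tapes (compile_cmd b (\<lambda>_. 0) 1 c)"
  have b: "2 \<le> b" unfolding b_def C_def by simp
  then have "ok_symbols (b + 2) prog"
    unfolding prog_def using ok_symbols_setup ok_symbols_compile_cmd by simp
  then obtain m where m: "com_ok m (b + 2) prog" using ok_symbols_com_ok by blast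
  show ?thesis
  proof (rule logspace_computable_exec[OF m, where C = 3])
    fix w :: "bool list"
    define L where "L = length (bits (length w + 2))"
    interpret register_machine w b L
      using b by unfold_locales
    have "(length w + 2) ^ cmd_deg 0 c \<le> (length w + 2) ^ C"
      unfolding C_def by (rule power_increasing) auto
    also have "\<dots> < (2 ^ L) ^ C"
      unfolding L_def C_def by (rule power_strict_mono[OF less_power_length_bits]) auto
    also have "\<dots> = b ^ L"
      by (simp add: b_def mult.commute flip: power_mult)
    finally have "ub w ^ cmd_deg 0 c < b ^ L" by (simp only: ub_def)
    then have "rexec (compile_cmd b (\<lambda>_. 0) 1 c) (0, \<lambda>_. 0, [])
        (0, \<lambda>_. 0, [] @ outputs w (\<lambda>_. 0) c)"
      by (intro rexec_compile_cmd[where g = 0]) auto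
    then have "exec w (L + 1) (compile_cmd b (\<lambda>_. 0) 1 c) (0, \<lambda>_. tape_of (replicate L 0), \<lambda>_. 0, [])
        (0, \<lambda>_. tape_of (replicate L 0), \<lambda>_. 0, outputs w (\<lambda>_. 0) c)"
      by (simp add: rexec_def digs_0)
    from exec_Seq[OF exec_setup_tapes[OF L_def] this]
    have "exec w (L + 1) prog (0, \<lambda>_ _. 0, \<lambda>_. 0, [])
        (0, \<lambda>_. tape_of (replicate L 0), \<lambda>_. 0, outputs w (\<lambda>_. 0) c)"
      unfolding prog_def .
    \<comment> \<open>With \<open>n = length w\<close>, the estimate
      \<open>2 ^ L \<le> 2 * (n + 2)\<close> bounds \<open>L\<close> by one plus the logarithm of
      \<open>n + 2\<close>. That logarithm is at least \<open>1\<close>, so it also pays for the two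
      additional units.\<close>
    moreover have "real (L + 1) \<le> 3 * log 2 (real (length w) + 2)"
    proof -
      have "2 ^ L \<le> 2 * (length w + 2)"
        unfolding L_def by (rule power_length_bits_le) simp
      then have "(2::real) ^ L \<le> 2 * (real (length w) + 2)"
        by (metis (mono_tags, opaque_lifting) numeral_power_le_of_nat_cancel_iff of_nat_add of_nat_mult of_nat_numeral)
      then have "log 2 (2 ^ L) \<le> log 2 (2 * (real (length w) + 2))"
        by (subst log_le_cancel_iff) auto
      then have "real L \<le> 1 + log 2 (real (length w) + 2)"
        by (subst (asm) log_mult) (simp_all add: log_nat_power)
      moreover have "1 \<le> log 2 (real (length w) + 2)"
        by (simp add: le_log_iff)
      ultimately show ?thesis unfolding of_nat_add of_nat_1 by linarith
    qed
    ultimately show "\<exists>b p T P. exec w b prog (0, \<lambda>_ _. 0, \<lambda>_. 0, []) (p, T, P, outputs w (\<lambda>_. 0) c) \<and>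
        real b \<le> 3 * log 2 (real (length w) + 2)" by blast
  qed simp
qed

section \<open>Reading and writing numbers\<close>

fun max_var :: "exp \<Rightarrow> nat" where
  "max_var (Const n) = 0"
| "max_var (Var v) = Suc v"
| "max_var (Add a b) = max (max_var a) (max_var b)"
| "max_var (Eq a b) = max (max_var a) (max_var b)"
| "max_var (Sum v a b) = max (max_var a) (max_var b)"
| "max_var (Iter x l n c e) = max (max (max_var n) (max_var c)) (max_var e)"
| "max_var (At a y) = max_var a"
| "max_var Len = 0"

lemma eval_cong: "(\<And>v. v < max_var e \<Longrightarrow> env v = env' v) \<Longrightarrow> eval w env e = eval w env' e"
proof (induction e arbitrary: env env')
  case (Sum v a b)
  have "eval w env a = eval w env' a"
    by (rule Sum.IH(1)) (use Sum.prems in simp)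
  moreover have "eval w (env(v := x)) b = eval w (env'(v := x)) b" for x
    by (rule Sum.IH(2)) (use Sum.prems in simp)
  ultimately show ?case by simp
next
  case (Iter x l n c e)
  have "eval w env n = eval w env' n"
    by (rule Iter.IH(1)) (use Iter.prems in simp)
  moreover have "eval w env c = eval w env' c"
    by (rule Iter.IH(2)) (use Iter.prems in simp)
  moreover have "eval w (env(x := a, l := i)) e = eval w (env'(x := a, l := i)) e" for a i
    by (rule Iter.IH(3)) (use Iter.prems in simp)
  ultimately show ?case by simp
next
  case (Add a b)
  have "eval w env a = eval w env' a" "eval w env b = eval w env' b"
    by (rule Add.IH, use Add.prems in simp)+
  then show ?case by simp
next
  case (Eq a b)
  have "eval w env a = eval w env' a" "eval w env b = eval w env' b"
    by (rule Eq.IH, use Eq.prems in simp)+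
  then show ?case by simp
next
  case (At a y)
  have "eval w env a = eval w env' a"
    by (rule At.IH, use At.prems in simp)
  then show ?case by simp
qed simp_all

lemma eval_fresh [simp]: "max_var e \<le> v \<Longrightarrow> eval w (env(v := x)) e = eval w env e"
  by (rule eval_cong) auto

definition Mul :: "exp \<Rightarrow> exp \<Rightarrow> exp" where
  "Mul a b = Sum (max_var b) a b"

text \<open>A bounded sum of truth values counts solutions. Order, difference and quotient are all
  obtained in this way, each as the size of a set below a known bound. The bound variable is chosen
  fresh for the expressions in its scope.\<close>

definition Leq :: "exp \<Rightarrow> exp \<Rightarrow> exp" where
  "Leq a b = Sum (max_var a) (Add b (Const 1)) (Eq (Var (max_var a)) a)"

definition Sub :: "exp \<Rightarrow> exp \<Rightarrow> exp" where
  "Sub a b = Sum (max_var b) a (Leq b (Var (max_var b)))"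

definition Div :: "exp \<Rightarrow> exp \<Rightarrow> exp" where
  "Div a b = (let v = max (max_var a) (max_var b) in
    Sum v a (Leq (Mul (Add (Var v) (Const 1)) b) a))"

definition Mod :: "exp \<Rightarrow> exp \<Rightarrow> exp" where
  "Mod a b = Sub a (Mul b (Div a b))"

definition All :: "nat \<Rightarrow> exp \<Rightarrow> exp \<Rightarrow> exp" where
  "All v a b = Eq (Sum v a (Eq b (Const 0))) (Const 0)"

lemma eval_Mul [simp]: "eval w env (Mul a b) = eval w env a * eval w env b"
  by (simp add: Mul_def)

lemma sum_of_bool: "(\<Sum>x<(n::nat). of_bool (P x)) = card {x. x < n \<and> P x}"
  by (simp add: sum_of_bool_eq Int_def)

lemma eval_Leq [simp]: "eval w env (Leq a b) = of_bool (eval w env a \<le> eval w env b)"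
proof -
  have "eval w env (Leq a b) = (\<Sum>x < Suc (eval w env b). of_bool (x = eval w env a))"
    by (simp add: Leq_def)
  also have "\<dots> = card {x. x < Suc (eval w env b) \<and> x = eval w env a}"
    by (rule sum_of_bool)
  also have "{x. x < Suc (eval w env b) \<and> x = eval w env a} =
      (if eval w env a \<le> eval w env b then {eval w env a} else {})" by auto
  finally show ?thesis by simp
qed

lemma eval_Sub [simp]: "eval w env (Sub a b) = eval w env a - eval w env b"
proof -
  have "eval w env (Sub a b) = (\<Sum>x < eval w env a. of_bool (eval w env b \<le> x))"
    by (simp add: Sub_def)
  also have "\<dots> = card {x. x < eval w env a \<and> eval w env b \<le> x}"
    by (rule sum_of_bool)
  also have "{x. x < eval w env a \<and> eval w env b \<le> x} = {eval w env b..<eval w env a}" by auto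
  finally show ?thesis by simp
qed

lemma eval_Div [simp]: "eval w env b \<noteq> 0 \<Longrightarrow> eval w env (Div a b) = eval w env a div eval w env b"
proof -
  assume b: "eval w env b \<noteq> 0"
  have "eval w env (Div a b) = (\<Sum>x < eval w env a. of_bool ((x + 1) * eval w env b \<le> eval w env a))"
    by (simp add: Div_def Let_def)
  also have "\<dots> = card {x. x < eval w env a \<and> (x + 1) * eval w env b \<le> eval w env a}"
    by (rule sum_of_bool)
  also have "{x. x < eval w env a \<and> (x + 1) * eval w env b \<le> eval w env a} = {..<eval w env a div eval w env b}"
  proof -
    have "(x + 1) * eval w env b \<le> eval w env a \<longleftrightarrow> x < eval w env a div eval w env b" for x
      using b less_eq_div_iff_mult_less_eq[of "eval w env b" "x + 1" "eval w env a"] by auto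
    moreover have "x < eval w env a" if "x < eval w env a div eval w env b" for x
      using that div_le_dividend[of "eval w env a" "eval w env b"] by linarith
    ultimately show ?thesis by auto
  qed
  finally show ?thesis by simp
qed

lemma eval_Mod [simp]: "eval w env b \<noteq> 0 \<Longrightarrow> eval w env (Mod a b) = eval w env a mod eval w env b"
  by (simp add: Mod_def minus_mult_div_eq_mod)

lemma eval_All [simp]: "eval w env (All v a b) = of_bool (\<forall>x < eval w env a. eval w (env(v := x)) b \<noteq> 0)"
  by (auto simp: All_def)

text \<open>The code alternates between markers and digits, and both can be \<open>True\<close>.
  Whether a position holds a digit is therefore determined only by a scan from the left end: it does
  iff the preceding position holds a marker \<open>True\<close>.\<close>

primrec in_digit :: "bool list \<Rightarrow> nat \<Rightarrow> bool" where
  "in_digit w 0 = False"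
| "in_digit w (Suc p) = (\<not> in_digit w p \<and> input_symbol_at w p = Bit True)"

text \<open>The fixed variables \<open>0\<close> and \<open>1\<close> cannot capture anything in
  \<open>e\<close>, because the number of rounds is evaluated outside their scope.\<close>

definition "In_digit e = Iter 0 1 e (Const 1) (Mul (Eq (Var 0) (Const 0)) (At (Var 1) (Bit True)))"

lemma eval_In_digit [simp]: "eval w env (In_digit e) = of_bool (in_digit w (eval w env e))"
proof -
  have "rec_nat 0 (\<lambda>i a. min 1 (of_bool (a = 0) * of_bool (input_symbol_at w i = Bit True))) n
      = (of_bool (in_digit w n) :: nat)" for n
    by (induction n) auto
  then show ?thesis by (simp add: In_digit_def)
qed

definition token_end :: "bool list \<Rightarrow> nat \<Rightarrow> bool" where
  "token_end w p \<longleftrightarrow> \<not> in_digit w p \<and> input_symbol_at w p = Bit False"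

definition "Token_end e = Mul (Eq (In_digit e) (Const 0)) (At e (Bit False))"

lemma eval_Token_end [simp]: "eval w env (Token_end e) = of_bool (token_end w (eval w env e))"
  by (simp add: Token_end_def token_end_def)

definition tokens_before :: "bool list \<Rightarrow> nat \<Rightarrow> nat" where
  "tokens_before w p = (\<Sum>q<p. of_bool (token_end w q))"

definition "Tokens_before e = Sum 0 e (Token_end (Var 0))"

lemma eval_Tokens_before [simp]: "eval w env (Tokens_before e) = tokens_before w (eval w env e)"
  by (simp add: Tokens_before_def tokens_before_def)

text \<open>A Horner step, restricted to the digits of the number with index \<open>j\<close>. The
  least significant digit comes first, so Horner's scheme runs from right to left, which is the
  order of \<open>foldr\<close>.\<close>

definition digit_step :: "nat \<Rightarrow> bool list \<Rightarrow> nat \<Rightarrow> nat \<Rightarrow> nat \<Rightarrow> nat" where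
  "digit_step C w j p a = min C
    (if in_digit w p \<and> tokens_before w p = j then 2 * a + of_bool (input_symbol_at w p = Bit True) else a)"

text \<open>The cap \<open>C\<close> will be larger than the numbers in a correct input.\<close>

definition token_value :: "nat \<Rightarrow> bool list \<Rightarrow> nat \<Rightarrow> nat" where
  "token_value C w j = foldr (digit_step C w j) [1..<length w + 1] 0"

text \<open>\<open>Iter\<close> counts upwards, so round \<open>i\<close> treats the position
  \<open>length w - i\<close>. The last round visits position \<open>0\<close>, which holds no digit
  and leaves the value unchanged.\<close>

definition Value :: "exp \<Rightarrow> exp" where
  "Value e = (let x = max_var e; p = Sub (Sub Len (Const 1)) (Var (Suc x)) in
    Iter x (Suc x) Len Len (Add (Var x)
      (Mul (Mul (In_digit p) (Eq (Tokens_before p) e)) (Add (Var x) (At p (Bit True))))))"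

lemma rec_nat_foldr:
  "k \<le> n \<Longrightarrow> rec_nat z (\<lambda>i a. f (n - 1 - i) a) k = foldr f [n - k..<n] z"
proof (induction k)
  case (Suc k)
  have "[n - Suc k..<n] = (n - Suc k) # [n - k..<n]"
    using Suc.prems by (simp add: upt_conv_Cons Suc_diff_Suc)
  then show ?case using Suc by simp
qed simp

lemma eval_Value [simp]: "eval w env (Value e) = token_value (length w + 1) w (eval w env e)"
proof -
  let ?C = "length w + 1" and ?j = "eval w env e"
  have "eval w env (Value e) = rec_nat 0 (\<lambda>i a. digit_step ?C w ?j (length w + 1 - 1 - i) a) (length w + 1)"
    unfolding Value_def Let_def digit_step_def eval.simps
    by (rule arg_cong[where f = "\<lambda>f. rec_nat 0 f _"]) (auto simp: fun_eq_iff)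
  also have "\<dots> = foldr (digit_step ?C w ?j) [0..<length w + 1] 0"
    using rec_nat_foldr[of "length w + 1" "length w + 1" 0 "digit_step ?C w ?j"] by simp
  also have "[0..<length w + 1] = 0 # [1..<length w + 1]"
    by (simp add: upt_conv_Cons del: upt_Suc)
  also have "foldr (digit_step ?C w ?j) (0 # [1..<length w + 1]) 0 = min ?C (token_value ?C w ?j)"
    by (simp add: digit_step_def token_value_def del: upt_Suc)
  also have "\<dots> = token_value ?C w ?j"
    unfolding token_value_def by (cases "[1..<length w + 1]") (auto simp: digit_step_def simp del: upt_Suc)
  finally show ?thesis .
qed

text \<open>A digit \<open>False\<close> in front of a number \<open>0\<close> would be a leading
  zero, which \<open>encode_nat\<close> never writes. Rejecting it makes the accepted words exactly
  the codes.\<close>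

fun parse :: "bool list \<Rightarrow> nat list option" where
  "parse [] = Some []"
| "parse (False # w) = map_option (Cons 0) (parse w)"
| "parse [True] = None"
| "parse (True # b # w) = (case parse w of
     Some (n # ns) \<Rightarrow> if n = 0 \<and> \<not> b then None else Some ((2 * n + of_bool b) # ns)
   | _ \<Rightarrow> None)"

lemma encode_nat_0: "encode_nat 0 = [False]"
  by (simp add: encode_nat_def binary_digits.simps)

lemma encode_nat_double:
  "n \<noteq> 0 \<or> b \<Longrightarrow> encode_nat (2 * n + of_bool b) = True # b # encode_nat n"
  by (subst encode_nat_def, subst binary_digits.simps) (auto simp: encode_nat_def)

lemma parse_encode_nats: "parse (encode_nats ns) = Some ns"
proof (induction ns)
  case Nil
  show ?case by (simp add: encode_nats_def)
next
  case (Cons n ns)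
  have "parse (encode_nat n @ encode_nats ns) = Some (n # ns)"
  proof (induction n rule: less_induct)
    case (less n)
    show ?case
    proof (cases "n = 0")
      case True
      then show ?thesis using Cons by (simp add: encode_nat_0)
    next
      case False
      define m where "m = n div 2"
      have n: "n = 2 * m + of_bool (odd n)" "m < n" "m \<noteq> 0 \<or> odd n"
        using False by (auto simp: m_def)
      have "encode_nat n = True # odd n # encode_nat m"
        using encode_nat_double[OF n(3)] n(1) by simp
      then show ?thesis using less[OF n(2)] n by auto
    qed
  qed
  then show ?case by (simp add: encode_nats_def)
qed

lemma encode_parse: "parse w = Some ns \<Longrightarrow> encode_nats ns = w"
proof (induction w arbitrary: ns rule: parse.induct)
  case (2 w)
  then show ?case by (auto simp: encode_nats_def encode_nat_0)
next
  case (4 b w)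
  then obtain n ms where n: "parse w = Some (n # ms)" "n \<noteq> 0 \<or> b" "ns = (2 * n + of_bool b) # ms"
    by (auto split: option.splits list.splits if_splits)
  then show ?case using 4(1)[OF n(1)] encode_nat_double[OF n(2)] by (simp add: encode_nats_def)
qed (auto simp: encode_nats_def)

lemma encode_nats_inject: "encode_nats ns = encode_nats ms \<longleftrightarrow> ns = ms"
  using parse_encode_nats by (metis option.inject)

section \<open>Reading a word by positions agrees with parsing it\<close>

lemma input_symbol_at_Cons: "1 \<le> p \<Longrightarrow> input_symbol_at (b # w) (Suc p) = input_symbol_at w p"
  by (auto simp: input_symbol_at_def nth_Cons')

lemma input_symbol_at_1: "input_symbol_at (b # w) (Suc 0) = Bit b"
  by (simp add: input_symbol_at_def)

lemma input_symbol_at_0: "input_symbol_at w 0 = LeftEnd"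
  by (simp add: input_symbol_at_def)

lemma in_digit_1: "\<not> in_digit w (Suc 0)"
  by (simp add: input_symbol_at_0)

text \<open>After a closing \<open>False\<close>, as after a marker with its digit, the scan is in
  its initial state. Hence the notions defined by positions reappear for the rest of the word,
  shifted by one or two. Position \<open>0\<close> is exempt, since the rest alone shows the end
  marker there.\<close>

lemma in_digit_False: "1 \<le> p \<Longrightarrow> in_digit (False # w) (Suc p) = in_digit w p"
proof (induction p)
  case (Suc p)
  show ?case
  proof (cases p)
    case 0
    then show ?thesis by (simp add: input_symbol_at_0 input_symbol_at_1)
  next
    case (Suc q)
    then have "in_digit (False # w) (Suc p) = in_digit w p" using Suc.IH by simp
    then show ?thesis using Suc input_symbol_at_Cons[of p False w] by simp
  qed
qed simp

lemma in_digit_True: "1 \<le> p \<Longrightarrow> in_digit (True # b # w) (Suc (Suc p)) = in_digit w p"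
proof (induction p)
  case (Suc p)
  show ?case
  proof (cases p)
    case 0
    then show ?thesis by (simp add: input_symbol_at_0 input_symbol_at_1)
  next
    case (Suc q)
    then have "in_digit (True # b # w) (Suc (Suc p)) = in_digit w p" using Suc.IH by simp
    then show ?thesis
      using Suc input_symbol_at_Cons[of "Suc p" True "b # w"] input_symbol_at_Cons[of p b w] by simp
  qed
qed simp

lemma in_digit_True_2: "in_digit (True # w) (Suc (Suc 0))"
  by (simp add: input_symbol_at_0 input_symbol_at_1)

lemma token_end_False: "1 \<le> p \<Longrightarrow> token_end (False # w) (Suc p) = token_end w p"
  using in_digit_False[of p w] input_symbol_at_Cons[of p False w] by (simp add: token_end_def)

lemma token_end_True: "1 \<le> p \<Longrightarrow> token_end (True # b # w) (Suc (Suc p)) = token_end w p"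
  using in_digit_True[of p b w] input_symbol_at_Cons[of "Suc p" True "b # w"]
    input_symbol_at_Cons[of p b w] by (simp add: token_end_def)

lemma token_end_0: "\<not> token_end w 0"
  by (simp add: token_end_def input_symbol_at_0)

lemma tokens_before_Suc: "tokens_before w (Suc p) = tokens_before w p + of_bool (token_end w p)"
  by (simp add: tokens_before_def)

lemma tokens_before_0: "tokens_before w 0 = 0"
  by (simp add: tokens_before_def)

lemma tokens_before_False: "1 \<le> p \<Longrightarrow> tokens_before (False # w) (Suc p) = Suc (tokens_before w p)"
proof (induction p)
  case (Suc p)
  show ?case
  proof (cases p)
    case 0
    have "token_end (False # w) (Suc 0)"
      by (simp add: token_end_def input_symbol_at_0 input_symbol_at_1)
    then show ?thesis using 0 by (simp add: tokens_before_Suc tokens_before_0 token_end_0)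
  next
    case (Suc q)
    then show ?thesis
      using Suc.IH token_end_False[of p w] tokens_before_Suc[of _ "Suc p"] tokens_before_Suc[of w p] by simp
  qed
qed simp

lemma tokens_before_True_2: "tokens_before (True # w) (Suc (Suc 0)) = 0"
  by (simp add: tokens_before_Suc tokens_before_0 token_end_def input_symbol_at_0 input_symbol_at_1)

lemma tokens_before_True: "1 \<le> p \<Longrightarrow> tokens_before (True # b # w) (Suc (Suc p)) = tokens_before w p"
proof (induction p)
  case (Suc p)
  show ?case
  proof (cases p)
    case 0
    have "\<not> token_end (True # b # w) (Suc (Suc 0))"
      using in_digit_True_2 by (simp add: token_end_def)
    then show ?thesis
      using 0 tokens_before_True_2[of "b # w"] tokens_before_Suc[of "True # b # w" "Suc (Suc 0)"]
      by (simp add: tokens_before_Suc[of w] tokens_before_0 token_end_0)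
  next
    case (Suc q)
    then show ?thesis
      using Suc.IH token_end_True[of p b w] tokens_before_Suc[of _ "Suc (Suc p)"] tokens_before_Suc[of w p] by simp
  qed
qed simp

text \<open>A local form of being a code, which can be checked by a bounded quantifier. The last
  symbol has to close a number, and a digit \<open>False\<close> must be followed by a further
  marker, that is, it is not the leading digit.\<close>

definition well_formed :: "bool list \<Rightarrow> bool" where
  "well_formed w \<longleftrightarrow> token_end w (length w) \<and>
    (\<forall>p < length w + 1. in_digit w p \<and> input_symbol_at w p = Bit False \<longrightarrow>
      input_symbol_at w (Suc p) = Bit True)"

lemma all_shift: "(\<forall>p < Suc n. P p) \<longleftrightarrow> P 0 \<and> (\<forall>p < n. P (Suc p))"
  using less_Suc_eq_0_disj by auto

lemma well_formed_False: "w \<noteq> [] \<Longrightarrow> well_formed (False # w) \<longleftrightarrow> well_formed w"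
proof -
  assume w: "w \<noteq> []"
  let ?P = "\<lambda>w p. in_digit w p \<and> input_symbol_at w p = Bit False \<longrightarrow> input_symbol_at w (Suc p) = Bit True"
  have *: "?P (False # w) (Suc (Suc p)) \<longleftrightarrow> ?P w (Suc p)" for p
    using in_digit_False[of "Suc p" w] input_symbol_at_Cons[of "Suc p" False w]
      input_symbol_at_Cons[of "Suc (Suc p)" False w] by simp
  \<comment> \<open>The positions \<open>0\<close> and \<open>1\<close> never hold a digit, so the
    condition is vacuous there and the remaining positions are those of \<open>w\<close>
    shifted.\<close>
  have "(\<forall>p < length (False # w) + 1. ?P (False # w) p) \<longleftrightarrow> (\<forall>p < length w. ?P (False # w) (Suc (Suc p)))"
    using in_digit_1[of "False # w"] by (simp only: list.size add_Suc_right add_0_right One_nat_def all_shift in_digit.simps(1) simp_thms)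
  also have "\<dots> \<longleftrightarrow> (\<forall>p < length w + 1. ?P w p)"
    by (simp only: * Suc_eq_plus1[symmetric] all_shift in_digit.simps(1) simp_thms)
  finally show ?thesis
    unfolding well_formed_def using token_end_False[of "length w" w] w by (simp add: Suc_le_eq)
qed

lemma well_formed_True:
  "w \<noteq> [] \<Longrightarrow> well_formed (True # b # w) \<longleftrightarrow> well_formed w \<and> (b \<or> hd w)"
proof -
  assume w: "w \<noteq> []"
  let ?P = "\<lambda>w p. in_digit w p \<and> input_symbol_at w p = Bit False \<longrightarrow> input_symbol_at w (Suc p) = Bit True"
  let ?w = "True # b # w"
  have *: "?P ?w (Suc (Suc (Suc p))) \<longleftrightarrow> ?P w (Suc p)" for p
    using in_digit_True[of "Suc p" b w] input_symbol_at_Cons[of "Suc p" b w]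
      input_symbol_at_Cons[of "Suc (Suc p)" b w] input_symbol_at_Cons[of "Suc (Suc p)" True "b # w"]
      input_symbol_at_Cons[of "Suc (Suc (Suc p))" True "b # w"] by simp
  obtain c u where c: "w = c # u" using w by (cases w) auto
  have 2: "?P ?w (Suc (Suc 0)) \<longleftrightarrow> b \<or> hd w"
    using in_digit_True_2[of "b # w"] by (auto simp: c input_symbol_at_def)
  have "(\<forall>p < length ?w + 1. ?P ?w p) \<longleftrightarrow> (b \<or> hd w) \<and> (\<forall>p < length w. ?P ?w (Suc (Suc (Suc p))))"
    using in_digit_1[of ?w] 2
    by (simp only: list.size add_Suc_right add_0_right One_nat_def all_shift in_digit.simps(1) simp_thms)
  also have "\<dots> \<longleftrightarrow> (b \<or> hd w) \<and> (\<forall>p < length w + 1. ?P w p)"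
    by (simp only: * Suc_eq_plus1[symmetric] all_shift in_digit.simps(1) simp_thms)
  finally show ?thesis
    unfolding well_formed_def using token_end_True[of "length w" b w] w by (auto simp: Suc_le_eq)
qed

text \<open>The first symbol decides whether the first number is \<open>0\<close>. This translates
  the test for a leading zero in \<open>parse\<close> into the local test of
  \<open>well_formed\<close>.\<close>

lemma parse_hd: "parse w = Some ns \<Longrightarrow> w \<noteq> [] \<Longrightarrow> ns \<noteq> [] \<and> (hd ns = 0 \<longleftrightarrow> \<not> hd w)"
  by (induction w arbitrary: ns rule: parse.induct) (auto split: option.splits list.splits if_splits)

lemma well_formed_iff_parse: "w \<noteq> [] \<Longrightarrow> well_formed w \<longleftrightarrow> parse w \<noteq> None"
proof (induction w rule: parse.induct)
  case (2 w)
  show ?case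
  proof (cases "w = []")
    case True
    then show ?thesis
      by (auto simp: well_formed_def token_end_def less_Suc_eq input_symbol_at_0 input_symbol_at_1)
  next
    case False
    then show ?thesis using 2 well_formed_False by simp
  qed
next
  case 3
  show ?case by (simp add: well_formed_def token_end_def input_symbol_at_1)
next
  case (4 b w)
  show ?case
  proof (cases "w = []")
    case True
    then show ?thesis
      using in_digit_True_2[of "[b]"] by (simp add: well_formed_def token_end_def)
  next
    case False
    then have "well_formed (True # b # w) \<longleftrightarrow> parse w \<noteq> None \<and> (b \<or> hd w)"
      using 4 well_formed_True by simp
    also have "\<dots> \<longleftrightarrow> parse (True # b # w) \<noteq> None"
      using parse_hd[of w] False by (auto split: option.splits list.splits)
    finally show ?thesis .
  qed
qed simp

lemma tokens_before_parse: "parse w = Some ns \<Longrightarrow> tokens_before w (Suc (length w)) = length ns"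
proof (induction w arbitrary: ns rule: parse.induct)
  case 1
  then show ?case by (simp add: tokens_before_Suc tokens_before_0 token_end_0)
next
  case (2 w)
  then show ?case using tokens_before_False[of "Suc (length w)" w] by auto
next
  case (4 b w)
  then obtain n ms where n: "parse w = Some (n # ms)" "ns = (2 * n + of_bool b) # ms"
    by (auto split: option.splits list.splits if_splits)
  then show ?case using 4(1)[OF n(1)] tokens_before_True[of "Suc (length w)" b w] by simp
qed simp

lemma foldr_map_Suc:
  "(\<And>p a. m \<le> p \<Longrightarrow> f (Suc p) a = g p a) \<Longrightarrow> foldr f [Suc m..<Suc n] z = foldr g [m..<n] z"
proof -
  assume *: "\<And>p a. m \<le> p \<Longrightarrow> f (Suc p) a = g p a"
  have "foldr f [Suc m..<Suc n] z = foldr (f \<circ> Suc) [m..<n] z"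
    by (simp only: map_Suc_upt[symmetric] foldr_map)
  also have "\<dots> = foldr g [m..<n] z"
    by (rule foldr_cong) (auto simp: *)
  finally show ?thesis .
qed

lemma token_value_le: "token_value C w j \<le> C"
  unfolding token_value_def by (cases "[1..<length w + 1]") (auto simp: digit_step_def simp del: upt_Suc)

lemma token_value_False: "token_value C (False # w) (Suc j) = token_value C w j"
proof -
  have "[1..<length (False # w) + 1] = Suc 0 # [Suc 1..<Suc (length w + 1)]"
    by (simp add: upt_conv_Cons del: upt_Suc)
  moreover have "foldr (digit_step C (False # w) (Suc j)) [Suc 1..<Suc (length w + 1)] 0 = token_value C w j"
    unfolding token_value_def
    by (rule foldr_map_Suc)
      (simp add: digit_step_def in_digit_False tokens_before_False input_symbol_at_Cons del: in_digit.simps)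
  ultimately show ?thesis
    using token_value_le[of C w j] in_digit_1[of "False # w"]
    by (simp add: token_value_def[of C "False # w"] digit_step_def del: upt_Suc in_digit.simps)
qed

lemma token_value_False_0: "token_value C (False # w) 0 = 0"
proof -
  have *: "tokens_before (False # w) p = 0 \<Longrightarrow> p \<le> 1" for p
    using tokens_before_False[of "p - 1" w] by (cases p; cases "p - 1") auto
  have "\<not> (in_digit (False # w) p \<and> tokens_before (False # w) p = 0)" for p
    using *[of p] in_digit_1[of "False # w"] by (cases p; cases "p - 1") auto
  then have "digit_step C (False # w) 0 p 0 = 0" for p
    unfolding digit_step_def by (simp only: if_False min_0R)
  then have "foldr (digit_step C (False # w) 0) ps 0 = 0" for ps
    by (induction ps) auto
  then show ?thesis unfolding token_value_def .
qed

lemma token_value_True: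
  "token_value C (True # b # w) j =
    (if j = 0 then min C (2 * token_value C w 0 + of_bool b) else token_value C w j)"
proof -
  let ?w = "True # b # w"
  have "[1..<length ?w + 1] = Suc 0 # Suc (Suc 0) # [Suc (Suc 1)..<Suc (Suc (length w + 1))]"
    by (simp add: upt_conv_Cons del: upt_Suc)
  moreover have "foldr (digit_step C ?w j) [Suc (Suc 1)..<Suc (Suc (length w + 1))] 0 = token_value C w j"
  proof -
    have "foldr (digit_step C ?w j) [Suc (Suc 1)..<Suc (Suc (length w + 1))] 0 =
        foldr (\<lambda>p. digit_step C ?w j (Suc p)) [Suc 1..<Suc (length w + 1)] 0"
      by (rule foldr_map_Suc) simp
    also have "\<dots> = token_value C w j"
      unfolding token_value_def
      by (rule foldr_map_Suc)
        (simp add: digit_step_def in_digit_True tokens_before_True input_symbol_at_Cons del: in_digit.simps)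
    finally show ?thesis .
  qed
  moreover have "input_symbol_at ?w (Suc (Suc 0)) = Bit b"
    by (simp add: input_symbol_at_def)
  ultimately show ?thesis
    using token_value_le[of C w j] in_digit_1[of ?w] in_digit_True_2[of "b # w"] tokens_before_True_2[of "b # w"]
    by (simp add: token_value_def[of C ?w] digit_step_def del: upt_Suc in_digit.simps)
qed

text \<open>Capping in every Horner step amounts to capping once at the end, because
  \<open>min C (2 * min C n + c) = min C (2 * n + c)\<close>.\<close>

lemma token_value_parse:
  "parse w = Some ns \<Longrightarrow> j < length ns \<Longrightarrow> token_value C w j = min C (ns ! j)"
proof (induction w arbitrary: ns j rule: parse.induct)
  case (2 w)
  then obtain ms where "parse w = Some ms" "ns = 0 # ms" by auto
  then show ?case
    using 2 by (cases j) (simp_all add: token_value_False token_value_False_0)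
next
  case (4 b w)
  then obtain n ms where n: "parse w = Some (n # ms)" "ns = (2 * n + of_bool b) # ms"
    by (auto split: option.splits list.splits if_splits)
  have "token_value C w j = min C ((n # ms) ! j)"
    using 4(1)[OF n(1)] 4(3) n(2) by simp
  then show ?case
    using n by (cases j) (auto simp: token_value_True min_def)
qed simp_all

definition "Well_formed = Mul (Token_end (Sub Len (Const 1)))
  (All 0 Len (Eq (Mul (Mul (In_digit (Var 0)) (At (Var 0) (Bit False)))
    (Eq (At (Add (Var 0) (Const 1)) (Bit True)) (Const 0))) (Const 0)))"

lemma eval_Well_formed [simp]: "eval w env Well_formed = of_bool (well_formed w)"
  by (auto simp: Well_formed_def well_formed_def)

section \<open>Writing numbers in binary\<close>

lemma binary_digits_conv: "binary_digits v = map (\<lambda>q. odd (v div 2 ^ q)) [0..<length (binary_digits v)]"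
proof (induction v rule: binary_digits.induct)
  case (1 v)
  show ?case
  proof (cases "v = 0")
    case True
    then show ?thesis by (simp add: binary_digits.simps)
  next
    case False
    let ?n = "length (binary_digits (v div 2))"
    have bd: "binary_digits v = odd v # binary_digits (v div 2)"
      using False binary_digits.simps[of v] by simp
    have "binary_digits (v div 2) = map (\<lambda>q. odd (v div 2 div 2 ^ q)) [0..<?n]"
      using 1[OF False] .
    also have "\<dots> = map (\<lambda>q. odd (v div 2 ^ q)) (map Suc [0..<?n])"
      by (simp add: div_mult2_eq)
    finally have "binary_digits v = map (\<lambda>q. odd (v div 2 ^ q)) (0 # map Suc [0..<?n])"
      using bd by simp
    also have "0 # map Suc [0..<?n] = [0..<length (binary_digits v)]"
      by (simp only: map_Suc_upt bd list.size add_Suc_right add_0_right) (simp add: upt_conv_Cons del: upt_Suc)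
    finally show ?thesis .
  qed
qed

lemma length_binary_digits_less: "q < length (binary_digits v) \<longleftrightarrow> 2 ^ q \<le> v"
proof
  assume q: "q < length (binary_digits v)"
  then have "v \<noteq> 0" using binary_digits.simps[of 0] by (cases "v = 0") auto
  then have "2 ^ length (binary_digits v) \<le> 2 * v"
    using power_length_bits_le[of v] by (simp add: bits_def)
  moreover have "(2::nat) ^ Suc q \<le> 2 ^ length (binary_digits v)"
    using q by (intro power_increasing) auto
  ultimately show "2 ^ q \<le> v" by simp
next
  assume "2 ^ q \<le> v"
  also have "v < 2 ^ length (binary_digits v)"
    using less_power_length_bits[of v] by (simp add: bits_def)
  finally show "q < length (binary_digits v)"
    by (simp add: power_strict_increasing_iff)
qed

text \<open>\<open>Iter\<close> starts from \<open>0\<close>, so it produces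
  \<open>2 ^ q - 1\<close> by doubling and adding one. If the cap is a number \<open>v\<close>, the
  result is exact for \<open>2 ^ q \<le> v\<close> and exceeds \<open>v\<close> otherwise; both the
  length and the digits of \<open>v\<close> can be read off from it.\<close>

definition Power2 :: "exp \<Rightarrow> exp \<Rightarrow> exp" where
  "Power2 q c = Add (Const 1) (Iter 0 1 q c (Add (Add (Var 0) (Var 0)) (Const 1)))"

lemma eval_Power2 [simp]: "eval w env (Power2 q c) = 1 + min (eval w env c) (2 ^ eval w env q - 1)"
proof -
  have step: "1 \<le> z \<Longrightarrow> min c (min c (z - 1) + min c (z - 1) + 1) = min c (2 * z - 1)" for c z :: nat
    by arith
  have "rec_nat 0 (\<lambda>i a. min c (a + a + 1)) n = min c (2 ^ n - 1)" for c n :: nat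
  proof (induction n)
    case (Suc n)
    show ?case
      unfolding old.nat.simps Suc power_Suc by (rule step) simp
  qed simp
  then show ?thesis by (simp add: Power2_def)
qed

definition emit_nat :: "exp \<Rightarrow> cmd" where
  "emit_nat e = (let q = max_var e in
    Then (For q (Sum q e (Leq (Power2 (Var q) e) e))
      (Then (Emit (Const 1)) (Emit (Mod (Div e (Power2 (Var q) e)) (Const 2)))))
    (Emit (Const 0)))"

lemma outputs_emit_nat [simp]: "outputs w env (emit_nat e) = encode_nat (eval w env e)"
proof -
  let ?v = "eval w env e"
  let ?q = "max_var e"
  have le: "1 + min ?v (2 ^ q - 1) \<le> ?v \<longleftrightarrow> 2 ^ q \<le> ?v" for q
  proof -
    have "1 \<le> z \<Longrightarrow> 1 + min v (z - 1) \<le> v \<longleftrightarrow> z \<le> v" for v z :: nat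
      by arith
    then show ?thesis by simp
  qed
  have "eval w env (Sum ?q e (Leq (Power2 (Var ?q) e) e)) = (\<Sum>q<?v. of_bool (2 ^ q \<le> ?v))"
    by (simp add: le[simplified])
  also have "\<dots> = card {q. q < ?v \<and> 2 ^ q \<le> ?v}" by (rule sum_of_bool)
  \<comment> \<open>The number of binary digits is the number of powers of two up to
    \<open>?v\<close>. Their exponents are below \<open>?v\<close>, which supplies the bound of the
    sum.\<close>
  also have "{q. q < ?v \<and> 2 ^ q \<le> ?v} = {..<length (binary_digits ?v)}"
    by (auto simp: length_binary_digits_less intro: less_le_trans[OF less_exp])
  finally have len: "eval w env (Sum ?q e (Leq (Power2 (Var ?q) e) e)) = length (binary_digits ?v)"
    by simp
  have digit: "eval w (env(?q := q)) (Mod (Div e (Power2 (Var ?q) e)) (Const 2)) = ?v div 2 ^ q mod 2"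
    if "q < length (binary_digits ?v)" for q
  proof -
    have "2 ^ q \<le> ?v" using that length_binary_digits_less by blast
    then have "1 + min ?v (2 ^ q - 1) = 2 ^ q"
      by (simp add: min_absorb2)
    then have "eval w (env(?q := q)) (Power2 (Var ?q) e) = 2 ^ q" by simp
    then show ?thesis by simp
  qed
  have "outputs w env (emit_nat e) =
      concat (map (\<lambda>q. [True, eval w (env(?q := q)) (Mod (Div e (Power2 (Var ?q) e)) (Const 2)) \<noteq> 0])
        [0..<length (binary_digits ?v)]) @ [False]"
    unfolding emit_nat_def Let_def outputs.simps len by simp
  also have "map (\<lambda>q. [True, eval w (env(?q := q)) (Mod (Div e (Power2 (Var ?q) e)) (Const 2)) \<noteq> 0])
        [0..<length (binary_digits ?v)] = map (\<lambda>b. [True, b]) (binary_digits ?v)"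
    by (subst (2) binary_digits_conv) (auto simp: digit odd_iff_mod_2_eq_one simp del: eval.simps)
  finally show ?thesis by (simp add: encode_nat_def)
qed

section \<open>Lexicographic enumeration of tuples\<close>

lemma length_concat_blocks:
  "(\<And>y. y \<in> set ys \<Longrightarrow> length (g y) = n) \<Longrightarrow> length (concat (map g ys)) = length ys * n"
  by (induction ys) auto

lemma nth_concat_blocks:
  "(\<And>y. y \<in> set ys \<Longrightarrow> length (g y) = n) \<Longrightarrow> i < length ys \<Longrightarrow> t < n \<Longrightarrow>
    concat (map g ys) ! (i * n + t) = g (ys ! i) ! t"
proof (induction ys arbitrary: i)
  case (Cons y ys)
  then show ?case
    by (cases i) (auto simp: nth_append add.assoc)
qed simp

lemma tuples_Suc: "tuples (Suc d) k = concat (map (\<lambda>x. map (Cons x) (tuples d k)) [1..<Suc k])"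
  by (simp add: tuples_def)

lemma length_tuples: "length (tuples d k) = k ^ d"
proof (induction d)
  case 0
  show ?case by (simp add: tuples_def)
next
  case (Suc d)
  show ?case
    unfolding tuples_Suc by (subst length_concat_blocks[where n = "k ^ d"]) (simp_all add: Suc)
qed

lemma set_tuples: "set (tuples d k) = {xs. length xs = d \<and> set xs \<subseteq> {1..k}}"
proof (induction d)
  case (Suc d)
  show ?case
    unfolding tuples_Suc by (auto simp: Suc length_Suc_conv image_iff subset_iff less_Suc_eq_le simp del: upt_Suc)
qed (auto simp: tuples_def)

text \<open>The rank in lexicographic order of a tuple with entries counted from \<open>0\<close>:
  the value of a base \<open>k\<close> numeral with the leading digit first.\<close>

definition position :: "nat \<Rightarrow> nat \<Rightarrow> (nat \<Rightarrow> nat) \<Rightarrow> nat" where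
  "position d k e = (\<Sum>j<d. e j * k ^ (d - 1 - j))"

lemma position_Suc: "position (Suc d) k e = e 0 * k ^ d + position d k (\<lambda>j. e (Suc j))"
  by (simp add: position_def sum.lessThan_Suc_shift del: sum.lessThan_Suc)

lemma position_less: "(\<And>j. j < d \<Longrightarrow> e j < k) \<Longrightarrow> position d k e < k ^ d"
proof (induction d arbitrary: e)
  case (Suc d)
  have "position d k (\<lambda>j. e (Suc j)) < k ^ d" using Suc by simp
  then have "position (Suc d) k e < e 0 * k ^ d + k ^ d" by (simp add: position_Suc)
  also have "\<dots> = Suc (e 0) * k ^ d" by simp
  also have "\<dots> \<le> k * k ^ d" by (rule mult_le_mono1) (use Suc.prems[of 0] in simp)
  finally show ?case by simp
qed (simp add: position_def)

lemma nth_tuples_position: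
  "(\<And>j. j < d \<Longrightarrow> e j < k) \<Longrightarrow> tuples d k ! position d k e = map (\<lambda>j. e j + 1) [0..<d]"
proof (induction d arbitrary: e)
  case 0
  show ?case by (simp add: tuples_def position_def)
next
  case (Suc d)
  let ?e = "\<lambda>j. e (Suc j)"
  have "tuples (Suc d) k ! position (Suc d) k e = map (Cons ([1..<Suc k] ! e 0)) (tuples d k) ! position d k ?e"
    unfolding tuples_Suc position_Suc
    by (rule nth_concat_blocks) (use Suc.prems Suc.prems[of 0] position_less[of d ?e k] in \<open>auto simp: length_tuples simp del: upt_Suc\<close>)
  also have "\<dots> = (e 0 + 1) # map (\<lambda>j. e (Suc j) + 1) [0..<d]"
    using Suc.prems position_less[of d ?e k] Suc.IH[of ?e] by (simp add: length_tuples del: upt_Suc)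
  also have "\<dots> = map (\<lambda>j. e j + 1) [0..<Suc d]"
    by (simp add: upt_conv_Cons map_Suc_upt[symmetric] del: upt_Suc map_Suc_upt)
  finally show ?case .
qed

lemma position_digits:
  "t < k ^ d \<Longrightarrow> position d k (\<lambda>j. t div k ^ (d - 1 - j) mod k) = t"
proof (induction d arbitrary: t)
  case 0
  then show ?case by (simp add: position_def)
next
  case (Suc d)
  have k: "0 < k" using Suc.prems by (cases k) auto
  have "t div k ^ d < k" using Suc.prems k by (simp add: less_mult_imp_div_less mult.commute)
  moreover have "position d k (\<lambda>j. t div k ^ (Suc d - 1 - Suc j) mod k) =
      position d k (\<lambda>j. (t mod k ^ d) div k ^ (d - 1 - j) mod k)"
    unfolding position_def
  proof (rule sum.cong[OF refl])
    fix j assume j: "j \<in> {..<d}"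
    define m where "m = d - 1 - j"
    have d: "d = m + Suc j" using j by (simp add: m_def)
    \<comment> \<open>The part of \<open>t\<close> above \<open>k ^ d\<close> is a multiple of
      \<open>k ^ (m + 1)\<close>. Division by \<open>k ^ m\<close> leaves a multiple of
      \<open>k\<close>, which disappears modulo \<open>k\<close>.\<close>
    have "t = k ^ m * k * (k ^ j * (t div k ^ d)) + t mod k ^ d"
      using mult_div_mod_eq[of "k ^ d" t] by (simp add: d power_add algebra_simps)
    then have "t div k ^ m = (k ^ m * (k * (k ^ j * (t div k ^ d))) + t mod k ^ d) div k ^ m"
      by (simp only: mult.assoc)
    also have "\<dots> = k * (k ^ j * (t div k ^ d)) + t mod k ^ d div k ^ m"
      using k by simp
    finally have "t div k ^ m mod k = t mod k ^ d div k ^ m mod k" by simp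
    moreover have "Suc d - 1 - Suc j = m" by (simp add: m_def)
    ultimately show "t div k ^ (Suc d - 1 - Suc j) mod k * k ^ (d - 1 - j) =
        t mod k ^ d div k ^ (d - 1 - j) mod k * k ^ (d - 1 - j)"
      by (simp add: m_def)
  qed
  moreover have "position d k (\<lambda>j. (t mod k ^ d) div k ^ (d - 1 - j) mod k) = t mod k ^ d"
    using Suc.IH[of "t mod k ^ d"] k by simp
  ultimately show ?case
    using div_mult_mod_eq[of t "k ^ d"] by (simp add: position_Suc)
qed

lemma nth_tuples:
  assumes "t < k ^ d"
  shows "tuples d k ! t = map (\<lambda>j. t div k ^ (d - 1 - j) mod k + 1) [0..<d]"
proof (cases "k = 0 \<and> d \<noteq> 0")
  case True
  then show ?thesis using assms by (simp add: power_0_left)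
next
  case False
  then have "tuples d k ! position d k (\<lambda>j. t div k ^ (d - 1 - j) mod k) =
      map (\<lambda>j. t div k ^ (d - 1 - j) mod k + 1) [0..<d]"
    by (intro nth_tuples_position) auto
  then show ?thesis using position_digits[OF assms] by simp
qed

section \<open>Instances as lists of numbers\<close>

definition FT_list :: "nat \<Rightarrow> nat \<Rightarrow> nat \<Rightarrow> (ft_var \<Rightarrow> nat) \<Rightarrow> nat list" where
  "FT_list d h k x = [h, k] @
    concat (map (\<lambda>i. map (\<lambda>xs. x (Fn (Suc i) xs)) (tuples d k)) [0..<num_nodes d (h - 1)]) @
    map (\<lambda>i. x (Leaf (Suc (num_nodes d (h - 1) + i)))) [0..<num_nodes d h - num_nodes d (h - 1)]"

definition hatFT_list :: "nat \<Rightarrow> nat \<Rightarrow> nat \<Rightarrow> (hat_var \<Rightarrow> nat) \<Rightarrow> nat list" where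
  "hatFT_list d h k x = [h, k] @ map (\<lambda>xs. x (HatFn xs)) (tuples d k) @
    map (\<lambda>i. x (HatLeaf (Suc (num_nodes d (h - 1) + i)))) [0..<num_nodes d h - num_nodes d (h - 1)]"

lemma sorted_internal_nodes: "sorted_list_of_set (internal_nodes d h) = map Suc [0..<num_nodes d (h - 1)]"
  unfolding internal_nodes_def map_Suc_upt by (simp add: atLeastLessThanSuc_atLeastAtMost[symmetric] del: upt_Suc)

lemma sorted_leaves:
  "sorted_list_of_set (leaves d h) =
    map (\<lambda>i. Suc (num_nodes d (h - 1) + i)) [0..<num_nodes d h - num_nodes d (h - 1)]"
proof -
  have "sorted_list_of_set (leaves d h) = [Suc (num_nodes d (h - 1))..<Suc (num_nodes d h)]"
    unfolding leaves_def by (simp add: atLeastLessThanSuc_atLeastAtMost[symmetric] del: upt_Suc)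
  also have "\<dots> = map (\<lambda>i. Suc (num_nodes d (h - 1) + i)) [0..<num_nodes d h - num_nodes d (h - 1)]"
    by (rule nth_equalityI) (simp_all del: upt_Suc)
  finally show ?thesis .
qed

lemma encode_FT_list: "encode_FT d h k x = encode_nats (FT_list d h k x)"
  unfolding encode_FT_def FT_list_def sorted_internal_nodes sorted_leaves by (simp add: comp_def)

lemma encode_hatFT_list: "encode_hatFT d h k x = encode_nats (hatFT_list d h k x)"
  unfolding encode_hatFT_def hatFT_list_def sorted_leaves by (simp add: comp_def)

lemma length_FT_list:
  "length (FT_list d h k x) =
    2 + num_nodes d (h - 1) * k ^ d + (num_nodes d h - num_nodes d (h - 1))"
  unfolding FT_list_def by (simp add: length_concat_blocks[where n = "k ^ d"] length_tuples)

lemma FT_list_0: "FT_list d h k x ! 0 = h" and FT_list_1: "FT_list d h k x ! Suc 0 = k"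
  by (simp_all add: FT_list_def)

lemma FT_list_Fn:
  assumes "i < num_nodes d (h - 1)" "t < k ^ d"
  shows "FT_list d h k x ! (2 + (i * k ^ d + t)) = x (Fn (Suc i) (tuples d k ! t))"
proof -
  let ?n = "num_nodes d (h - 1)"
  let ?c = "concat (map (\<lambda>i. map (\<lambda>xs. x (Fn (Suc i) xs)) (tuples d k)) [0..<?n])"
  have "i * k ^ d + t < Suc i * k ^ d" using assms(2) by simp
  also have "\<dots> \<le> ?n * k ^ d" using assms(1) by (intro mult_right_mono) auto
  also have "\<dots> = length ?c"
    by (simp add: length_concat_blocks[where n = "k ^ d"] length_tuples)
  finally have "FT_list d h k x ! (2 + (i * k ^ d + t)) = ?c ! (i * k ^ d + t)"
    unfolding FT_list_def by (simp add: nth_append)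
  also have "\<dots> = map (\<lambda>xs. x (Fn (Suc ([0..<?n] ! i)) xs)) (tuples d k) ! t"
    by (rule nth_concat_blocks) (use assms in \<open>auto simp: length_tuples\<close>)
  finally show ?thesis using assms by (simp add: length_tuples)
qed

lemma FT_list_Leaf:
  assumes "i < num_nodes d h - num_nodes d (h - 1)"
  shows "FT_list d h k x ! (2 + num_nodes d (h - 1) * k ^ d + i) = x (Leaf (Suc (num_nodes d (h - 1) + i)))"
proof -
  let ?c = "concat (map (\<lambda>i. map (\<lambda>xs. x (Fn (Suc i) xs)) (tuples d k)) [0..<num_nodes d (h - 1)])"
  have "length ?c = num_nodes d (h - 1) * k ^ d"
    by (simp add: length_concat_blocks[where n = "k ^ d"] length_tuples)
  then show ?thesis
    using assms unfolding FT_list_def by (simp add: nth_append)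
qed

text \<open>The list contains the value of every variable, and outside the variables an extensional
  assignment is fixed. A word in the target language therefore has only one reading as an
  instance.\<close>

lemma hatFT_list_inject:
  assumes "hatFT_list d h k x = hatFT_list d h' k' x'"
    and "x \<in> hatFT_vars d h k \<rightarrow>\<^sub>E S" "x' \<in> hatFT_vars d h' k' \<rightarrow>\<^sub>E S'"
  shows "h = h' \<and> k = k' \<and> x = x'"
proof -
  have hk: "h' = h" "k' = k" using assms(1) by (simp_all add: hatFT_list_def)
  have eq: "map (\<lambda>xs. x (HatFn xs)) (tuples d k) = map (\<lambda>xs. x' (HatFn xs)) (tuples d k)"
    "map (\<lambda>i. x (HatLeaf i)) (sorted_list_of_set (leaves d h)) =
     map (\<lambda>i. x' (HatLeaf i)) (sorted_list_of_set (leaves d h))"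
    using assms(1) unfolding hatFT_list_def hk sorted_leaves by simp_all
  have "x v = x' v" if "v \<in> hatFT_vars d h k" for v
  proof -
    have "finite (leaves d h)" by (simp add: leaves_def)
    then show ?thesis
      using that eq by (auto simp: hatFT_vars_def map_eq_conv set_tuples)
  qed
  then have "x = x'"
    using assms(2,3) unfolding hk by (intro extensionalityI[of x "hatFT_vars d h k"]) (auto simp: PiE_iff)
  then show ?thesis using hk by simp
qed

section \<open>The reduction\<close>

definition Nodes :: "nat \<Rightarrow> exp \<Rightarrow> exp" where
  "Nodes d e = Iter 0 1 e Len (Add (Mul (Const d) (Var 0)) (Const 1))"

lemma eval_Nodes [simp]:
  assumes "0 < d"
  shows "eval w env (Nodes d e) = min (length w + 1) (num_nodes d (eval w env e))"
proof -
  \<comment> \<open>Capping before the step does no harm, since \<open>d\<close> is positive: once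
    \<open>a\<close> exceeds \<open>C\<close>, both sides equal \<open>C\<close>.\<close>
  have step: "min C (d * min C a + 1) = min C (d * a + 1)" for C a :: nat
  proof (cases "a \<le> C")
    case False
    have "C \<le> d * C" "C \<le> d * a" "min C a = C" using assms False by (cases d; simp)+
    then have "C \<le> d * min C a + 1" "C \<le> d * a + 1" by linarith+
    then show ?thesis by (simp only: min_absorb1)
  qed simp
  have "rec_nat 0 (\<lambda>i a. min C (d * a + 1)) n = min C (num_nodes d n)" for C n
  proof (induction n)
    case (Suc n)
    show ?case unfolding old.nat.simps Suc step num_nodes_Suc ..
  qed (simp add: num_nodes_def)
  from this[of "length w + 1"] show ?thesis by (simp add: Nodes_def del: min_Suc_Suc)
qed

fun Power :: "exp \<Rightarrow> nat \<Rightarrow> exp" where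
  "Power e 0 = Const 1"
| "Power e (Suc n) = Mul e (Power e n)"

lemma eval_Power [simp]: "eval w env (Power e n) = eval w env e ^ n"
  by (induction n) auto

fun Conj :: "exp list \<Rightarrow> exp" where
  "Conj [] = Const 1"
| "Conj (e # es) = Mul e (Conj es)"

lemma eval_Conj: "(\<And>j. eval w env (e j) = of_bool (P j)) \<Longrightarrow>
  eval w env (Conj (map e js)) = of_bool (\<forall>j \<in> set js. P j)"
  by (induction js) auto

fun Total :: "exp list \<Rightarrow> exp" where
  "Total [] = Const 0"
| "Total (e # es) = Add e (Total es)"

lemma eval_Total: "eval w env (Total (map e js)) = (\<Sum>j\<leftarrow>js. eval w env (e j))"
  by (induction js) auto

abbreviation (input) "height_exp \<equiv> Value (Const 0)"
abbreviation (input) "arity_exp \<equiv> Value (Const 1)"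
abbreviation (input) "inner_exp d \<equiv> Nodes d (Sub height_exp (Const 1))"
abbreviation (input) "nodes_exp d \<equiv> Nodes d height_exp"
abbreviation (input) "hat_arity_exp d \<equiv> Mul (nodes_exp d) arity_exp"

text \<open>
  The variable \<open>10\<close> holds the position of a table entry or of a leaf, the variable \<open>11\<close> an internal
  node (counted from \<open>0\<close>).
\<close>

definition digit_exp :: "nat \<Rightarrow> nat \<Rightarrow> exp" where
  "digit_exp d j = Mod (Div (Var 10) (Power (hat_arity_exp d) (d - 1 - j))) (hat_arity_exp d)"

text \<open>The digit \<open>j\<close> is the tuple entry minus one, so its quotient by
  \<open>k\<close> is the coded node minus one. The child number \<open>j\<close> of the node
  \<open>Suc i\<close> is \<open>d * i + j + 2\<close>, which explains the constant
  \<open>j + 1\<close>.\<close>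

definition match_exp :: "nat \<Rightarrow> exp" where
  "match_exp d = Conj (map (\<lambda>j. Eq (Div (digit_exp d j) arity_exp)
    (Add (Mul (Const d) (Var 11)) (Const (j + 1)))) [0..<d])"

definition position_exp :: "nat \<Rightarrow> exp" where
  "position_exp d = Total (map (\<lambda>j. Mul (Mod (digit_exp d j) arity_exp) (Power arity_exp (d - 1 - j))) [0..<d])"

text \<open>Distinct nodes have distinct lists of children, so at most one summand survives and the
  sum acts as a search for the parent. The value is \<open>0\<close> exactly if there is none. The
  offset \<open>2\<close> skips the entries for \<open>h\<close> and \<open>k\<close>.\<close>

definition entry_exp :: "nat \<Rightarrow> exp" where
  "entry_exp d = Sum 11 (inner_exp d) (Mul (match_exp d) (Add (Mul (Var 11) arity_exp)
    (Value (Add (Const 2) (Add (Mul (Var 11) (Power arity_exp d)) (position_exp d))))))"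

definition leaf_exp :: "nat \<Rightarrow> exp" where
  "leaf_exp d = Add (Mul (Add (inner_exp d) (Var 10)) arity_exp)
    (Value (Add (Add (Const 2) (Mul (inner_exp d) (Power arity_exp d))) (Var 10)))"

text \<open>With \<open>a\<close> internal nodes and \<open>b\<close> nodes in total, the list has
  \<open>2 + a * k ^ d + (b - a)\<close> entries; the equation has \<open>a\<close> added on both
  sides to avoid the subtraction. The caps on \<open>a\<close> and \<open>b\<close> turn out to be
  inactive when it holds.\<close>

definition valid_exp :: "nat \<Rightarrow> exp" where
  "valid_exp d = Conj [Well_formed, Leq (Const 2) height_exp, Leq (Const 2) arity_exp,
    Eq (Add (Tokens_before Len) (inner_exp d))
      (Add (Const 2) (Add (Mul (inner_exp d) (Power arity_exp d)) (nodes_exp d))),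
    All 10 (Sub (Tokens_before Len) (Const 2))
      (Mul (Leq (Const 1) (Value (Add (Const 2) (Var 10))))
        (Leq (Value (Add (Const 2) (Var 10))) arity_exp))]"

text \<open>The outer loop is a conditional: it runs once on a code of an instance and not at all
  otherwise, leaving the empty output. The summand \<open>Eq (entry_exp d) (Const 0)\<close> turns a
  missing parent into the default value \<open>1\<close>.\<close>

definition reduction :: "nat \<Rightarrow> cmd" where
  "reduction d = For 12 (valid_exp d)
    (Then (emit_nat height_exp) (Then (emit_nat (hat_arity_exp d))
    (Then (For 10 (Power (hat_arity_exp d) d) (emit_nat (Add (entry_exp d) (Eq (entry_exp d) (Const 0)))))
    (For 10 (Sub (nodes_exp d) (inner_exp d)) (emit_nat (leaf_exp d))))))"

section \<open>Correctness of the reduction\<close>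

lemma length_encode_nats: "length ns \<le> length (encode_nats ns)"
  by (induction ns) (auto simp: encode_nats_def encode_nat_def)

lemma height_le_num_nodes: "0 < d \<Longrightarrow> h \<le> num_nodes d h"
proof (induction h)
  case (Suc h)
  then have "h \<le> d * num_nodes d h" by (cases d) auto
  then show ?case by (simp add: num_nodes_Suc)
qed simp

lemma position_tuple: "t < k ^ d \<Longrightarrow> position d k (\<lambda>j. tuples d k ! t ! j - 1) = t"
proof -
  assume t: "t < k ^ d"
  have "position d k (\<lambda>j. tuples d k ! t ! j - 1) = position d k (\<lambda>j. t div k ^ (d - 1 - j) mod k)"
    unfolding position_def by (rule sum.cong) (simp_all add: nth_tuples[OF t])
  then show ?thesis using position_digits[OF t] by simp
qed

context
  fixes d :: nat
  assumes d: "2 \<le> d"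
begin

text \<open>The list has one entry per leaf and \<open>k ^ d\<close> entries per internal node.
  Hence the number of nodes, and with it \<open>h\<close>, as well as \<open>k\<close> are below the
  length of the input, and none of these numbers is affected by its cap.\<close>

lemma FT_list_bounds:
  assumes "2 \<le> h" "2 \<le> k"
  shows "num_nodes d h < length (FT_list d h k x)" "k < length (FT_list d h k x)"
    "length (FT_list d h k x) + num_nodes d (h - 1) = 2 + (num_nodes d (h - 1) * k ^ d + num_nodes d h)"
proof -
  let ?a = "num_nodes d (h - 1)" and ?b = "num_nodes d h"
  have le: "?a \<le> ?b" by (rule num_nodes_mono) simp
  have "?a * 1 \<le> ?a * k ^ d" using assms by (intro mult_le_mono2) simp
  then show "?b < length (FT_list d h k x)" unfolding length_FT_list using le by linarith
  have "k \<le> k ^ d" using d assms by (intro self_le_power) auto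
  moreover have "1 * k ^ d \<le> ?a * k ^ d"
    using num_nodes_pos[of "h - 1" d] assms by (intro mult_le_mono1) (simp add: Suc_le_eq)
  ultimately show "k < length (FT_list d h k x)" unfolding length_FT_list by linarith
  show "length (FT_list d h k x) + ?a = 2 + (?a * k ^ d + ?b)"
    using le by (simp add: length_FT_list)
qed

lemma FT_list_entries:
  assumes "2 \<le> h" "x \<in> FT_vars d h k \<rightarrow>\<^sub>E {1..k}" "2 + j < length (FT_list d h k x)"
  shows "FT_list d h k x ! (2 + j) \<in> {1..k}"
proof -
  let ?rest = "drop 2 (FT_list d h k x)"
  have "x (Fn (Suc i) xs) \<in> {1..k}" if "i < num_nodes d (h - 1)" "xs \<in> set (tuples d k)" for i xs
    by (rule PiE_mem[OF assms(2)]) (use that in \<open>auto simp: FT_vars_def internal_nodes_def set_tuples\<close>)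
  moreover have "x (Leaf (Suc (num_nodes d (h - 1) + i))) \<in> {1..k}"
    if "i < num_nodes d h - num_nodes d (h - 1)" for i
    by (rule PiE_mem[OF assms(2)]) (use that in \<open>auto simp: FT_vars_def leaves_def\<close>)
  ultimately have "set ?rest \<subseteq> {1..k}"
    by (auto simp: FT_list_def simp del: atLeastAtMost_iff)
  moreover have "FT_list d h k x ! (2 + j) = ?rest ! j" "j < length ?rest"
    using assms(3) by simp_all
  ultimately show ?thesis using nth_mem by (metis subsetD)
qed

lemma valid_instance:
  assumes "eval w env (valid_exp d) \<noteq> 0"
  shows "\<exists>h k x. 2 \<le> h \<and> 2 \<le> k \<and> x \<in> FT_vars d h k \<rightarrow>\<^sub>E {1..k} \<and> w = encode_FT d h k x"
proof -
  let ?C = "length w + 1"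
  define h where "h = token_value ?C w 0"
  define k where "k = token_value ?C w 1"
  define T where "T = tokens_before w ?C"
  let ?a = "num_nodes d (h - 1)" and ?b = "num_nodes d h"
  have wf: "well_formed w" and h2: "2 \<le> h" and k2: "2 \<le> k"
    and eq: "T + min ?C ?a = 2 + (min ?C ?a * k ^ d + min ?C ?b)"
    and entries: "\<And>j. j < T - 2 \<Longrightarrow> token_value ?C w (2 + j) \<in> {1..k}"
    using assms d unfolding valid_exp_def h_def k_def T_def
    by (auto simp: Suc_le_eq split: if_splits)
  have "w \<noteq> []" using wf by (auto simp: well_formed_def token_end_0)
  then obtain ns where ns: "parse w = Some ns"
    using wf well_formed_iff_parse by blast
  have w: "w = encode_nats ns" using encode_parse[OF ns] by simp
  have T: "T = length ns"
    using tokens_before_parse[OF ns] by (simp add: T_def)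
  have TC: "T < ?C" using length_encode_nats[of ns] w T by simp
  have ab: "?a \<le> ?b" by (rule num_nodes_mono) simp
  \<comment> \<open>Since \<open>k ^ d\<close> is positive, the length equation gives
    \<open>min ?C ?b < T\<close>, while \<open>T\<close> is below the cap \<open>?C\<close>. So
    neither number of nodes was truncated, and then \<open>h\<close> and \<open>k\<close> were not
    truncated either.\<close>
  have "min ?C ?a * 1 \<le> min ?C ?a * k ^ d" using k2 by (intro mult_le_mono2) simp
  then have "min ?C ?b < T" using eq by linarith
  then have b: "min ?C ?b = ?b" and bT: "?b < T" using TC by linarith+
  then have a: "min ?C ?a = ?a" using ab by linarith
  have a1: "1 \<le> ?a" using num_nodes_pos[of "h - 1" d] h2 by simp
  have "h \<le> ?b" using height_le_num_nodes[of d h] d by simp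
  then have hC: "h < ?C" using bT TC by linarith
  have "k \<le> k ^ d" using d k2 by (intro self_le_power) auto
  moreover have "1 * k ^ d \<le> ?a * k ^ d" using a1 by (rule mult_le_mono1)
  ultimately have kC: "k < T" using eq ab unfolding a b by linarith
  have T2: "0 < T" "1 < T" using kC k2 by linarith+
  have h: "ns ! 0 = h"
    using token_value_parse[OF ns, of 0 ?C] hC T2 unfolding h_def T by (auto simp: min_def split: if_splits)
  have k: "ns ! 1 = k"
    using token_value_parse[OF ns, of 1 ?C] kC TC T2 unfolding k_def T by (auto simp: min_def split: if_splits)
  have entry: "ns ! (2 + j) \<in> {1..k}" if "2 + j < T" for j
  proof -
    have "j < T - 2" using that by simp
    from entries[OF this] show ?thesis
      using token_value_parse[OF ns, of "2 + j" ?C] that kC TC unfolding T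
      by (auto simp: min_def split: if_splits)
  qed
  have len: "T = 2 + ?a * k ^ d + (?b - ?a)"
    using eq ab unfolding a b by simp
  \<comment> \<open>This inverts \<open>FT_list\<close>: the block of node \<open>i\<close> starts
    at \<open>2 + (i - 1) * k ^ d\<close> and is ordered by rank, and the first leaf
    \<open>Suc ?a\<close> comes directly after all blocks.\<close>
  define x where "x = restrict (\<lambda>v. case v of
      Fn i xs \<Rightarrow> ns ! (2 + ((i - 1) * k ^ d + position d k (\<lambda>j. xs ! j - 1)))
    | Leaf i \<Rightarrow> ns ! (2 + (?a * k ^ d + (i - Suc ?a)))) (FT_vars d h k)"
  have x_Fn: "x (Fn (Suc i) (tuples d k ! t)) = ns ! (2 + (i * k ^ d + t))" if "i < ?a" "t < k ^ d" for i t
  proof -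
    have "tuples d k ! t \<in> set (tuples d k)" using that by (simp add: length_tuples)
    then have "Fn (Suc i) (tuples d k ! t) \<in> FT_vars d h k"
      using that unfolding set_tuples FT_vars_def internal_nodes_def by auto
    then show ?thesis unfolding x_def using position_tuple[OF that(2)] by simp
  qed
  have x_Leaf: "x (Leaf (Suc (?a + i))) = ns ! (2 + (?a * k ^ d + i))" if "i < ?b - ?a" for i
    using that unfolding x_def by (simp add: FT_vars_def leaves_def)
  have "x \<in> FT_vars d h k \<rightarrow>\<^sub>E {1..k}"
    unfolding x_def
  proof (rule restrict_PiE_iff[THEN iffD2], rule ballI)
    fix v assume v: "v \<in> FT_vars d h k"
    show "(case v of Fn i xs \<Rightarrow> ns ! (2 + ((i - 1) * k ^ d + position d k (\<lambda>j. xs ! j - 1)))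
      | Leaf i \<Rightarrow> ns ! (2 + (?a * k ^ d + (i - Suc ?a)))) \<in> {1..k}"
    proof (cases v)
      case (Fn i xs)
      have i: "1 \<le> i" "i \<le> ?a" and xs: "length xs = d" "set xs \<subseteq> {1..k}"
        using v Fn by (auto simp: FT_vars_def internal_nodes_def)
      have "xs ! j - 1 < k" if "j < d" for j
      proof -
        have "xs ! j \<in> {1..k}" using xs that nth_mem by blast
        then show ?thesis by auto
      qed
      then have "position d k (\<lambda>j. xs ! j - 1) < k ^ d" by (rule position_less)
      then have "(i - 1) * k ^ d + position d k (\<lambda>j. xs ! j - 1) < (i - 1) * k ^ d + k ^ d" by simp
      also have "\<dots> = i * k ^ d" using i(1) by (cases i) auto
      also have "\<dots> \<le> ?a * k ^ d" using i(2) by simp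
      finally show ?thesis using entry len Fn by simp
    next
      case (Leaf i)
      then have "Suc ?a \<le> i" "i \<le> ?b" using v by (auto simp: FT_vars_def leaves_def)
      then have "2 + (?a * k ^ d + (i - Suc ?a)) < T" unfolding len by linarith
      from entry[OF this] show ?thesis unfolding Leaf by (simp only: ft_var.case)
    qed
  qed
  moreover have "FT_list d h k x = ns"
  proof (rule nth_equalityI)
    show "length (FT_list d h k x) = length ns"
      using len T by (simp add: length_FT_list)
    fix p assume p: "p < length (FT_list d h k x)"
    consider "p = 0" | "p = 1" | (2) q where "p = 2 + q"
      using le_Suc_ex[of 2 p] by (cases "p < 2") (auto simp: less_2_cases_iff)
    then show "FT_list d h k x ! p = ns ! p"
    proof cases
      case (2 q)
      show ?thesis
      proof (cases "q < ?a * k ^ d")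
        case True
        define i t where "i = q div k ^ d" and "t = q mod k ^ d"
        have q: "q = i * k ^ d + t" by (simp only: i_def t_def div_mult_mod_eq)
        have "t < k ^ d" using k2 by (simp add: t_def)
        moreover have "i < ?a" using True by (simp add: i_def less_mult_imp_div_less)
        ultimately show ?thesis
          using FT_list_Fn[of i d h t k x] x_Fn[of i t] unfolding 2 q by simp
      next
        case False
        define i where "i = q - ?a * k ^ d"
        have q: "q = ?a * k ^ d + i" using False by (simp add: i_def)
        have "i < ?b - ?a" using p 2 q by (simp add: length_FT_list)
        then show ?thesis
          using FT_list_Leaf[of i d h k x] x_Leaf[of i] unfolding 2 q by (simp add: add.assoc)
      qed
    qed (use h k in \<open>simp_all add: FT_list_0 FT_list_1\<close>)
  qed
  ultimately show ?thesis
    using h2 k2 w by (intro exI[of _ h] exI[of _ k] exI[of _ x]) (simp add: encode_FT_list)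
qed

context
  fixes h k :: nat and x :: "ft_var \<Rightarrow> nat" and w :: "bool list"
  assumes h: "2 \<le> h" and k: "2 \<le> k" and x: "x \<in> FT_vars d h k \<rightarrow>\<^sub>E {1..k}"
    and w: "w = encode_FT d h k x"
begin

lemma parse_w: "parse w = Some (FT_list d h k x)"
  unfolding w encode_FT_list by (rule parse_encode_nats)

lemma length_w: "length (FT_list d h k x) \<le> length w"
  unfolding w encode_FT_list by (rule length_encode_nats)

lemma token_value_w:
  assumes "j < length (FT_list d h k x)"
  shows "token_value (Suc (length w)) w j = FT_list d h k x ! j"
proof -
  have "FT_list d h k x ! j \<le> length w"
  proof (cases "j < 2")
    case True
    then consider "j = 0" | "j = 1" by linarith
    then show ?thesis
      using FT_list_bounds[OF h k, of x] length_w height_le_num_nodes[of d h] d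
      by cases (simp_all add: FT_list_0 FT_list_1)
  next
    case False
    then obtain i where "j = 2 + i" using le_Suc_ex[of 2 j] by auto
    then have "FT_list d h k x ! j \<in> {1..k}"
      using FT_list_entries[OF h x, of i] assms by simp
    then show ?thesis using FT_list_bounds(2)[OF h k, of x] length_w by auto
  qed
  then show ?thesis
    using token_value_parse[OF parse_w assms, of "Suc (length w)"] by simp
qed

lemma token_value_0: "token_value (Suc (length w)) w 0 = h"
  and token_value_1: "token_value (Suc (length w)) w (Suc 0) = k"
proof -
  have "0 < length (FT_list d h k x)" "1 < length (FT_list d h k x)"
    using FT_list_bounds(2)[OF h k, of x] k by linarith+
  from this[THEN token_value_w] show "token_value (Suc (length w)) w 0 = h"
    "token_value (Suc (length w)) w (Suc 0) = k"
    by (simp_all add: FT_list_0 FT_list_1)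
qed

lemma num_nodes_cap:
  "min (Suc (length w)) (num_nodes d h) = num_nodes d h"
  "min (Suc (length w)) (num_nodes d (h - Suc 0)) = num_nodes d (h - 1)"
  using FT_list_bounds(1)[OF h k, of x] length_w num_nodes_mono[of "h - 1" h d] by simp_all

lemma eval_params:
  "eval w env height_exp = h" "eval w env arity_exp = k"
  "eval w env (nodes_exp d) = num_nodes d h" "eval w env (inner_exp d) = num_nodes d (h - 1)"
  "eval w env (hat_arity_exp d) = num_nodes d h * k"
  using d by (simp_all add: token_value_0 token_value_1 num_nodes_cap)

lemma eval_valid: "eval w env (valid_exp d) = 1"
proof -
  have wf: "well_formed w"
    using well_formed_iff_parse[of w] parse_w by (cases "w = []") (auto simp: FT_list_def)
  have T: "tokens_before w (Suc (length w)) = length (FT_list d h k x)"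
    using tokens_before_parse[OF parse_w] .
  have "token_value (Suc (length w)) w (Suc (Suc j)) \<in> {1..k}"
    if "j < length (FT_list d h k x) - 2" for j
    using token_value_w[of "2 + j"] FT_list_entries[OF h x, of j] that by simp
  then show ?thesis
    using wf h k d FT_list_bounds(3)[OF h k, of x]
    unfolding valid_exp_def
    by (simp add: eval_params[simplified] T token_value_0 token_value_1 num_nodes_cap)
qed

lemma eval_leaf:
  assumes "env 10 = i" "i < num_nodes d h - num_nodes d (h - 1)"
  shows "eval w env (leaf_exp d) = hat_instance d h k x (HatLeaf (Suc (num_nodes d (h - 1) + i)))"
proof -
  let ?p = "2 + num_nodes d (h - 1) * k ^ d + i"
  have "eval w env (leaf_exp d) = (num_nodes d (h - 1) + i) * k + token_value (length w + 1) w ?p"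
    using d assms(1) by (simp add: leaf_exp_def token_value_0 token_value_1 num_nodes_cap)
  also have "token_value (length w + 1) w ?p = x (Leaf (Suc (num_nodes d (h - 1) + i)))"
    using token_value_w[of ?p] FT_list_Leaf[OF assms(2)] assms(2) by (simp add: length_FT_list)
  finally show ?thesis
    using assms(2) by (simp add: hat_instance_def hatFT_vars_def leaves_def)
qed

lemma eval_digit:
  "eval w env (digit_exp d j) = env 10 div (num_nodes d h * k) ^ (d - 1 - j) mod (num_nodes d h * k)"
proof -
  have "0 < num_nodes d h * k" using k num_nodes_pos[of h d] h by simp
  then show ?thesis
    unfolding digit_exp_def by (simp add: eval_params(5)[unfolded eval_Mul] eval_params[simplified])
qed

lemma eval_entry:
  assumes t: "env 10 = t" "t < (num_nodes d h * k) ^ d"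
  shows "eval w env (Add (entry_exp d) (Eq (entry_exp d) (Const 0))) =
    hat_instance d h k x (HatFn (tuples d (num_nodes d h * k) ! t))"
proof -
  let ?K = "num_nodes d h * k" and ?a = "num_nodes d (h - 1)"
  let ?ys = "tuples d ?K ! t"
  define E where "E j = t div ?K ^ (d - 1 - j) mod ?K" for j
  let ?p = "position d k (\<lambda>j. E j mod k)"
  let ?m = "\<lambda>i. \<forall>j \<in> set [0..<d]. E j div k = d * i + (j + 1)"
  have ys: "?ys = map (\<lambda>j. E j + 1) [0..<d]"
    unfolding E_def by (rule nth_tuples[OF t(2)])
  have k0: "k \<noteq> 0" using k by simp
  have match: "eval w (env(11 := i)) (match_exp d) = of_bool (?m i)" for i
    unfolding match_exp_def
    by (rule eval_Conj) (simp add: eval_digit E_def t eval_params[simplified] k0)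
  have pos: "eval w (env(11 := i)) (position_exp d) = ?p" for i
    unfolding position_exp_def eval_Total position_def
    by (simp add: eval_digit E_def t eval_params[simplified] k0 interv_sum_list_conv_sum_set_nat atLeast0LessThan)
  have pless: "?p < k ^ d" by (rule position_less) (use k in simp)
  have vals: "code_values k ?ys = tuples d k ! ?p"
    unfolding ys code_values_def by (subst nth_tuples_position) (use k in simp_all)
  have nodes: "children d (Suc i) = code_nodes k ?ys \<longleftrightarrow> ?m i" for i
    unfolding ys code_nodes_def list_eq_iff_nth_eq by (auto simp: nth_children)
  have tok: "token_value (length w + 1) w (2 + (i * k ^ d + ?p)) = x (Fn (Suc i) (code_values k ?ys))"
    if "i < ?a" for i
  proof -
    have "i * k ^ d + ?p < Suc i * k ^ d" using pless by simp
    also have "\<dots> \<le> ?a * k ^ d" using that by (intro mult_le_mono1) simp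
    finally show ?thesis
      using token_value_w[of "2 + (i * k ^ d + ?p)"] FT_list_Fn[OF that pless, of x]
      by (simp add: vals length_FT_list)
  qed
  have entry: "eval w env (entry_exp d) = (\<Sum>i<?a. of_bool (?m i) * (i * k + x (Fn (Suc i) (code_values k ?ys))))"
    unfolding entry_exp_def eval.simps(5) eval_params
  proof (rule sum.cong[OF refl])
    fix i assume "i \<in> {..<?a}"
    then have i: "i < ?a" by simp
    have val: "eval w (env(11 := i)) (Add (Mul (Var 11) arity_exp)
          (Value (Add (Const 2) (Add (Mul (Var 11) (Power arity_exp d)) (position_exp d))))) =
        i * k + token_value (length w + 1) w (2 + (i * k ^ d + ?p))"
      by (simp add: pos token_value_1)
    show "eval w (env(11 := i)) (Mul (match_exp d) (Add (Mul (Var 11) arity_exp)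
          (Value (Add (Const 2) (Add (Mul (Var 11) (Power arity_exp d)) (position_exp d)))))) =
        of_bool (?m i) * (i * k + x (Fn (Suc i) (code_values k ?ys)))"
      unfolding eval_Mul match val tok[OF i] ..
  qed
  have "?ys \<in> set (tuples d ?K)" using t by (simp add: length_tuples)
  then have in_hat: "HatFn ?ys \<in> hatFT_vars d h ?K"
    unfolding set_tuples by (auto simp: hatFT_vars_def)
  show ?thesis
  proof (cases "is_siblings d h k ?ys")
    case True
    then obtain i where i: "i < ?a" "children d (Suc i) = code_nodes k ?ys"
      unfolding is_siblings_def internal_nodes_def
      by (metis One_nat_def Suc_le_D Suc_le_lessD atLeastAtMost_iff)
    \<comment> \<open>A second matching node would have the same children, which
      \<open>children_inj\<close> excludes.\<close>
    have uniq: "?m j \<longleftrightarrow> j = i" for j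
      using i(2) children_inj[of d "Suc j" "Suc i"] d nodes by (metis Suc_inject zero_less_Suc less_le_trans pos2)
    have par: "parent d k ?ys = Suc i"
      by (rule parent_eq) (use d i in simp_all)
    have "Fn (Suc i) (code_values k ?ys) \<in> FT_vars d h k"
    proof -
      have "code_values k ?ys \<in> set (tuples d k)" unfolding vals using pless by (simp add: length_tuples)
      then show ?thesis using i unfolding set_tuples by (auto simp: FT_vars_def internal_nodes_def)
    qed
    \<comment> \<open>Function values are at least \<open>1\<close>, so an entry with a parent is
      nonzero and the correction by \<open>Eq (entry_exp d) (Const 0)\<close> adds nothing.\<close>
    then have pos: "0 < x (Fn (Suc i) (code_values k ?ys))" using PiE_mem[OF x] by fastforce
    have "eval w env (entry_exp d) = (\<Sum>j<?a. if j = i then i * k + x (Fn (Suc i) (code_values k ?ys)) else 0)"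
      unfolding entry uniq by (rule sum.cong) auto
    also have "\<dots> = i * k + x (Fn (Suc i) (code_values k ?ys))" using i by simp
    finally show ?thesis
      using pos True in_hat par by (simp add: hat_instance_def)
  next
    case False
    then have no: "\<not> ?m i" if "i < ?a" for i
      using that nodes[of i] unfolding is_siblings_def internal_nodes_def by (metis One_nat_def Suc_leI atLeastAtMost_iff le_numeral_extra(4) less_eq_Suc_le zero_less_Suc)
    have "eval w env (entry_exp d) = (\<Sum>i<?a. 0)"
      unfolding entry by (rule sum.cong[OF refl]) (use no in \<open>simp only: lessThan_iff of_bool_eq(1) mult_zero_left\<close>)
    then show ?thesis
      using False in_hat by (simp add: hat_instance_def)
  qed
qed

lemma outputs_reduction:
  "outputs w env (reduction d) = encode_hatFT d h (num_nodes d h * k) (hat_instance d h k x)"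
proof -
  let ?K = "num_nodes d h * k"
  have table: "map (\<lambda>xs. hat_instance d h k x (HatFn xs)) (tuples d ?K) =
      map (\<lambda>t. hat_instance d h k x (HatFn (tuples d ?K ! t))) [0..<?K ^ d]"
    by (rule nth_equalityI) (simp_all add: length_tuples)
  have 1: "map (\<lambda>t. encode_nat (eval w (env'(10 := t)) (Add (entry_exp d) (Eq (entry_exp d) (Const 0))))) [0..<?K ^ d] =
      map encode_nat (map (\<lambda>xs. hat_instance d h k x (HatFn xs)) (tuples d ?K))" for env'
    unfolding table map_map by (rule map_cong[OF refl]) (simp only: eval_entry[OF fun_upd_same] set_upt atLeastLessThan_iff comp_def)
  have 2: "map (\<lambda>i. encode_nat (eval w (env'(10 := i)) (leaf_exp d))) [0..<num_nodes d h - num_nodes d (h - 1)] =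
      map encode_nat (map (\<lambda>i. hat_instance d h k x (HatLeaf (Suc (num_nodes d (h - 1) + i))))
        [0..<num_nodes d h - num_nodes d (h - 1)])" for env'
    unfolding map_map by (rule map_cong[OF refl]) (simp only: eval_leaf[OF fun_upd_same] set_upt atLeastLessThan_iff comp_def)
  have 3: "[0..<1] = [0::nat]" by simp
  have "outputs w env (reduction d) = encode_nat h @ encode_nat ?K @
      concat (map encode_nat (map (\<lambda>xs. hat_instance d h k x (HatFn xs)) (tuples d ?K))) @
      concat (map encode_nat (map (\<lambda>i. hat_instance d h k x (HatLeaf (Suc (num_nodes d (h - 1) + i))))
        [0..<num_nodes d h - num_nodes d (h - 1)]))"
    unfolding reduction_def outputs.simps eval_valid outputs_emit_nat eval_Power eval_Sub eval_params 1 2 3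
      list.map concat.simps append_Nil2 ..
  then show ?thesis
    by (simp add: encode_hatFT_list hatFT_list_def encode_nats_def)
qed

end

lemma BT_reducible_hatBT: "logspace_reducible (BT_language d) (hatBT_language d)"
  unfolding logspace_reducible_def
proof (intro exI conjI allI)
  show "logspace_computable (\<lambda>w. outputs w (\<lambda>_. 0) (reduction d))"
    by (rule logspace_computable_outputs)
  fix w
  let ?F = "outputs w (\<lambda>_. 0) (reduction d)"
  \<comment> \<open>Membership in a language only provides some instance coded by the word. Both
    equivalences therefore refer to one fixed instance, and any other reading has to be compared
    with it.\<close>
  have iff: "w \<in> BT_language d \<longleftrightarrow> BT d h x" "?F \<in> hatBT_language d \<longleftrightarrow> BT d h x"
    if h: "2 \<le> h" and k: "2 \<le> k" and x: "x \<in> FT_vars d h k \<rightarrow>\<^sub>E {1..k}" and w: "w = encode_FT d h k x"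
    for h k x
  proof -
    let ?K = "num_nodes d h * k" and ?x = "hat_instance d h k x"
    have hat: "hatBT d h ?x \<longleftrightarrow> BT d h x"
      unfolding hatBT_def BT_def using hatFT_hat_instance(1)[OF d h k x] by simp
    have xh: "?x \<in> hatFT_vars d h ?K \<rightarrow>\<^sub>E {1..?K}"
      by (rule hat_instance_in[OF d h k x])
    have K: "2 \<le> ?K" using k num_nodes_pos[of h d] h by (cases "num_nodes d h") auto
    have F: "?F = encode_hatFT d h ?K ?x"
      by (rule outputs_reduction[OF h k x w])
    show "?F \<in> hatBT_language d \<longleftrightarrow> BT d h x"
    proof
      assume "?F \<in> hatBT_language d"
      then obtain h' k' x' where *: "?F = encode_hatFT d h' k' x'"
        "x' \<in> hatFT_vars d h' k' \<rightarrow>\<^sub>E {1..k'}" "hatBT d h' x'"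
        unfolding hatBT_language_def by blast
      have "hatFT_list d h ?K ?x = hatFT_list d h' k' x'"
        using * unfolding F encode_hatFT_list encode_nats_inject by simp
      from hatFT_list_inject[OF this xh *(2)] have "h = h'" "?x = x'" by blast+
      with *(3) have "hatBT d h ?x" by (simp only:)
      then show "BT d h x" using hat by blast
    next
      assume "BT d h x"
      then show "?F \<in> hatBT_language d"
        unfolding hatBT_language_def F using h K xh hat by blast
    qed
    show "w \<in> BT_language d \<longleftrightarrow> BT d h x"
    proof
      assume "w \<in> BT_language d"
      then obtain h' k' x' where *: "w = encode_FT d h' k' x'" "2 \<le> h'" "2 \<le> k'"
        "x' \<in> FT_vars d h' k' \<rightarrow>\<^sub>E {1..k'}" "BT d h' x'"
        unfolding BT_language_def by blast
      have hat': "hatBT d h' (hat_instance d h' k' x')"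
        using *(5) hatFT_hat_instance(1)[OF d *(2,3,4)] by (simp add: hatBT_def BT_def)
      have "?F = encode_hatFT d h' (num_nodes d h' * k') (hat_instance d h' k' x')"
        by (rule outputs_reduction[OF *(2,3,4,1)])
      \<comment> \<open>Two readings of \<open>w\<close> yield the same output word. The injectivity
        of the code on the output side then identifies the two hat instances, so the readings agree
        on the root value being \<open>1\<close>.\<close>
      then have "hatFT_list d h ?K ?x = hatFT_list d h' (num_nodes d h' * k') (hat_instance d h' k' x')"
        unfolding F encode_hatFT_list encode_nats_inject .
      from hatFT_list_inject[OF this xh hat_instance_in[OF d *(2,3,4)]]
      have "h = h'" "?x = hat_instance d h' k' x'" by blast+
      with hat' have "hatBT d h ?x" by (simp only:)
      then show "BT d h x" using hat by blast
    next
      assume "BT d h x"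
      then show "w \<in> BT_language d"
        unfolding BT_language_def using h k x w by blast
    qed
  qed
  show "w \<in> BT_language d \<longleftrightarrow> ?F \<in> hatBT_language d"
  \<comment> \<open>On rejected words the output is empty, whereas every code of an instance at
    least contains its height; and a code of an instance is never rejected, by
    \<open>eval_valid\<close>.\<close>
  proof (cases "eval w (\<lambda>_. 0) (valid_exp d) = 0")
    case True
    have "?F = []" unfolding reduction_def by (simp only: outputs.simps True upt_0 list.map concat.simps)
    moreover have "encode_hatFT d h k x \<noteq> []" for h k x
      by (simp add: encode_hatFT_list hatFT_list_def encode_nats_def encode_nat_def)
    ultimately have "?F \<notin> hatBT_language d"
      unfolding hatBT_language_def mem_Collect_eq by metis
    moreover have "w \<notin> BT_language d"
      using eval_valid True unfolding BT_language_def by fastforce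
    ultimately show ?thesis by blast
  next
    case False
    from valid_instance[OF this] iff show ?thesis by blast
  qed
qed

end

theorem theorem2p5:
  fixes d :: nat
  assumes "d \<ge> 2"
  shows "(\<forall>h k N :: nat. h \<ge> 2 \<longrightarrow> k \<ge> 2 \<longrightarrow> N = (d ^ h - 1) div (d - 1) \<longrightarrow>
            (\<forall>Bhat :: ('s, 'e, hat_var, nat) branching_program.
               solves_hatFT d h (N * k) Bhat \<longrightarrow>
               (\<exists>B :: (nat, nat, ft_var, nat) branching_program.
                  solves_FT d h k B \<and>
                  card (states B) \<le> card (states Bhat) \<and>
                  (deterministic k B \<longleftrightarrow> deterministic (N * k) Bhat))) \<and>
            (\<forall>Bhat :: ('s, 'e, hat_var, bool) branching_program.
               solves_hatBT d h (N * k) Bhat \<longrightarrow>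
               (\<exists>B :: (nat, nat, ft_var, bool) branching_program.
                  solves_BT d h k B \<and>
                  card (states B) \<le> card (states Bhat) \<and>
                  (deterministic k B \<longleftrightarrow> deterministic (N * k) Bhat))))
       \<and> logspace_reducible (BT_language d) (hatBT_language d)"
  unfolding num_nodes_closed_form[OF assms]
  using FT_program_of_hatFT_program[OF assms] BT_program_of_hatBT_program[OF assms]
    BT_reducible_hatBT[OF assms] by blast

end
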